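(* Let $X_1,\ldots,X_n$ be i.i.d. real random variables with absolutely continuous distribution function $F$, and $Y_1,\ldots,Y_m$ i.i.d. real random variables with absolutely continuous distribution function $G$, the two samples being independent, where $c_0 n\le m\le n$ for a fixed constant $0<c_0\le 1$. Let $d=d_n\ge 1$ be an integer and let $\psi_0\equiv 1,\psi_1,\ldots,\psi_d$ be twice differentiable functions on $[0,1]$ that are orthonormal in $L^2([0,1])$ (i.e. $\int_0^1\psi_k\psi_\ell\,dz=\delta_{k\ell}$). For $\ell=0,1,2$ put $B_{\ell d}=\max_{1\le k\le d}\sup_{z\in[0,1]}|\psi_k^{(\ell)}(z)|$. Assume $d\le m$ and, as $n\to\infty$, $$(\log n)^{7/6}B_{0d}=o(n^{1/6}),\qquad (\log n)^{3/2}B_{1d}=o(n^{1/2}),\qquad (\log n)^{1/2}B_{2d}=o(n^{1/2}).$$ Let $F_n(x)=n^{-1}\sum_{i=1}^n I(X_i\le x)$, $\hat V_j=F_n(Y_j)$, $\hat\psi_k=m^{-1}\sum_{j=1}^m\psi_k(\hat V_j)$, and $$\hat\Psi(d)=\sqrt{\tfrac{nm}{n+m}}\max_{1\le k\le d}|\hat\psi_k|.$$ For $0<\alpha<1$ let $c_\alpha(d)=\Phi^{-1}\big(1/2+(1-\alpha)^{1/d}/2\big)$, where $\Phi$ is the standard normal distribution function, and let $\Phi^{\rm S}_\alpha(d)=I\{\hat\Psi(d)\ge c_\alpha(d)\}$. Then, under the null hypothesis $H_0:F=G$, as $n,m\to\infty$, $$\sup_{0<\alpha<1}\big|P_{H_0}\{\Phi^{\rm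 S}_\alpha(d)=1\}-\alpha\big|\to 0.$$
   Context: $c_\alpha(d)$ is the $(1-\alpha)$-quantile of $\max_{1\le k\le d}|G_k|$ for $G_1,\dots,G_d$ i.i.d. standard normal. *)

theory Defs
  imports "HOL-Probability.Probability" "HOL-Library.Landau_Symbols"
begin

definition Phi :: "real \<Rightarrow> real" where
  "Phi x = measure (density lborel std_normal_density) {..x}"

definition Phi_inv :: "real \<Rightarrow> real" where
  "Phi_inv p = (THE x. Phi x = p)"

definition c_alpha :: "real \<Rightarrow> nat \<Rightarrow> real" where
  "c_alpha \<alpha> d = Phi_inv (1/2 + (1 - \<alpha>) powr (1 / real d) / 2)"

text \<open>B_{l d} = max_{1<=k<=d} sup_{z in [0,1]} |f_k(z)|, f_k the l-th derivative of psi_k.\<close>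
definition Bsup :: "(nat \<Rightarrow> real \<Rightarrow> real) \<Rightarrow> nat \<Rightarrow> real" where
  "Bsup f d = Max ((\<lambda>k. SUP z\<in>{0..1}. \<bar>f k z\<bar>) ` {1..d})"

definition emp_cdf :: "nat \<Rightarrow> (nat \<Rightarrow> real) \<Rightarrow> real \<Rightarrow> real" where
  "emp_cdf n x t = real (card {i\<in>{1..n}. x i \<le> t}) / real n"

definition psi_hat :: "nat \<Rightarrow> nat \<Rightarrow> (real \<Rightarrow> real) \<Rightarrow> (nat \<Rightarrow> real) \<Rightarrow> (nat \<Rightarrow> real) \<Rightarrow> real" where
  "psi_hat n m f x y = (\<Sum>j=1..m. f (emp_cdf n x (y j))) / real m"

definition Psi_hat :: "nat \<Rightarrow> nat \<Rightarrow> nat \<Rightarrow> (nat \<Rightarrow> real \<Rightarrow> real) \<Rightarrow> (nat \<Rightarrow> real) \<Rightarrow> (nat \<Rightarrow> real) \<Rightarrow> real" where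
  "Psi_hat n m d psi x y =
     sqrt (real n * real m / (real n + real m)) * Max ((\<lambda>k. \<bar>psi_hat n m (psi k) x y\<bar>) ` {1..d})"

end

theory Submission
  imports Defs "HOL-Real_Asymp.Real_Asymp"
begin

text \<open>
  The quantile transform turns both samples into uniform ones without changing any rank. A Taylor
  expansion of \<open>\<psi>\<^sub>k\<close> around \<open>V\<^sub>j\<close> and the Hoeffding projection of the resulting two-sample U-statistic,
  for which integration by parts returns \<open>- \<psi>\<^sub>k(U\<^sub>i)\<close>, write the normalised \<open>k\<close>-th coefficient as
  a sum \<open>W\<^sub>k\<close> of \<open>n + m\<close> independent centred terms with identity covariance across \<open>k\<close>, plus a quadratic
  remainder (controlled in mean) and a completely degenerate one (controlled by Hoeffding's
  inequality conditionally on the first sample).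

  The law of \<open>max\<^sub>k \<bar>W\<^sub>k\<bar>\<close> is compared with that of \<open>max\<^sub>k \<bar>G\<^sub>k\<bar>\<close> by Lindeberg's replacement method,
  applied to the logistic function of a soft maximum, \<open>1 / (1 + 2 e\<^sup>-\<^sup>\<beta>\<^sup>t \<Sum>\<^sub>k cosh (\<beta> w\<^sub>k))\<close>. The
  coordinates of \<open>G\<close> are independent, so the anti-concentration of the maximum at the
  scale \<open>1 / \<surd>(log n)\<close> is an explicit estimate for \<open>(2 \<Phi>(t) - 1)\<^sup>d\<close>.
\<close>

section \<open>A smooth proxy for the indicator of a cube\<close>

text \<open>Resolving the maximum at scale \<open>1 / sqrt (log n)\<close> forces
  \<open>\<beta>\<close> of order \<open>(log n)^(3/2)\<close>, while the replacement of one
  observation costs \<open>\<beta>^3\<close> times the cube of an increment whose weight has order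
  \<open>n^(-1/2)\<close>. With \<open>\<psi>\<close> as large as \<open>n^(1/6)\<close>, the crude
  bound by \<open>B0^3\<close> would add up to a positive power of \<open>log n\<close>. The
  remainder is therefore kept linear in one coordinate, averaged with weights fixed before the
  increment is seen. Unit variance makes that average bounded in mean, one factor
  \<open>n^(1/6)\<close> is saved, and the total becomes \<open>(log n)^(9/2) * n^(-1/6)\<close>.
  The smoothing width is \<open>\<epsilon> / sqrt (log n)\<close> with \<open>\<epsilon>\<close>
  held fixed while \<open>n\<close> grows. Only the anti-concentration term, of order
  \<open>\<epsilon>\<close>, survives this limit, and \<epsilon> is made small afterwards. No
  estimate depends on the threshold \<open>t\<close>. Since \<open>c_alpha \<alpha> d\<close> is an
  exact quantile of the Gaussian maximum, comparing probabilities of cubes at an arbitrary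
  \<open>t\<close> settles all levels \<alpha> at once.\<close>

text \<open>With \<open>c = 2 * exp (- \<beta> * t)\<close> this is a smooth version of the indicator of
  \<open>max\<^sub>k \<bar>w\<^sub>k\<bar> \<le> t\<close>, with a transition of width of order \<open>log d / \<beta>\<close>.\<close>

definition soft_box :: "'i set \<Rightarrow> real \<Rightarrow> real \<Rightarrow> ('i \<Rightarrow> real) \<Rightarrow> real" where
  "soft_box I \<beta> c w = 1 / (1 + c * (\<Sum>k\<in>I. cosh (\<beta> * w k)))"

lemma cosh_shift_le:
  fixes x h :: real
  shows "cosh (x + h) \<le> exp \<bar>h\<bar> * cosh x"
proof -
  have "exp (x + h) \<le> exp \<bar>h\<bar> * exp x" "exp (- (x + h)) \<le> exp \<bar>h\<bar> * exp (- x)"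
    by (simp_all flip: exp_add)
  then show ?thesis
    by (simp add: cosh_def algebra_simps)
qed

lemma abs_sinh_le_cosh: "\<bar>sinh x\<bar> \<le> cosh (x::real)"
proof (cases "x \<ge> 0")
  case True then show ?thesis using sinh_less_cosh_real[of x] by simp
next
  case False then show ?thesis using sinh_less_cosh_real[of "-x"] by simp
qed

lemma soft_box_nonneg: "c \<ge> 0 \<Longrightarrow> 0 \<le> soft_box I \<beta> c w"
  unfolding soft_box_def by (intro divide_nonneg_nonneg add_nonneg_nonneg mult_nonneg_nonneg sum_nonneg) auto

lemma soft_box_le_1: "c \<ge> 0 \<Longrightarrow> soft_box I \<beta> c w \<le> 1"
proof -
  assume "c \<ge> 0"
  then have "0 \<le> c * (\<Sum>k\<in>I. cosh (\<beta> * w k))"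
    by (intro mult_nonneg_nonneg sum_nonneg) auto
  then show ?thesis unfolding soft_box_def by (simp add: divide_le_eq)
qed

text \<open>The factor 2 in \<open>2 * exp (- \<beta> * t)\<close> compensates the 1/2 in
  \<open>cosh\<close>, so a single coordinate beyond \<open>t + h\<close> already pushes the
  denominator above \<open>exp (\<beta> * h)\<close>.\<close>

lemma soft_box_le:
  assumes "finite I" "k \<in> I" "\<beta> > 0" "\<bar>w k\<bar> \<ge> t + h"
  shows "soft_box I \<beta> (2 * exp (- \<beta> * t)) w \<le> exp (- \<beta> * h)"
proof -
  have "exp (\<beta> * (t + h)) \<le> exp (\<beta> * \<bar>w k\<bar>)"
    using assms by simp
  also have "\<dots> \<le> exp (\<bar>\<beta> * w k\<bar>) + exp (- \<bar>\<beta> * w k\<bar>)"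
    using assms by (simp add: abs_mult)
  also have "\<dots> = 2 * cosh (\<beta> * w k)"
    by (simp add: cosh_def abs_if)
  also have "\<dots> \<le> 2 * (\<Sum>k\<in>I. cosh (\<beta> * w k))"
    using assms member_le_sum[of k I "\<lambda>k. cosh (\<beta> * w k)"] by simp
  finally have "exp (- \<beta> * t) * exp (\<beta> * (t + h)) \<le> exp (- \<beta> * t) * (2 * (\<Sum>k\<in>I. cosh (\<beta> * w k)))"
    by (intro mult_left_mono) auto
  then have "exp (\<beta> * h) \<le> 1 + 2 * exp (- \<beta> * t) * (\<Sum>k\<in>I. cosh (\<beta> * w k))"
    by (simp add: algebra_simps flip: exp_add)
  then have "1 / (1 + 2 * exp (- \<beta> * t) * (\<Sum>k\<in>I. cosh (\<beta> * w k))) \<le> 1 / exp (\<beta> * h)"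
    by (intro divide_left_mono mult_pos_pos add_pos_nonneg mult_nonneg_nonneg sum_nonneg) auto
  then show ?thesis
    by (simp add: soft_box_def exp_minus inverse_eq_divide)
qed

text \<open>Inside the cube every coordinate may contribute to the denominator, so the loss carries
  the factor \<open>card I\<close>. This is why \<open>\<beta> * h\<close> must later exceed the
  logarithm of the dimension.\<close>

lemma soft_box_ge:
  assumes "\<beta> > 0" "\<And>k. k \<in> I \<Longrightarrow> \<bar>w k\<bar> \<le> t - h"
  shows "1 - 2 * real (card I) * exp (- \<beta> * h) \<le> soft_box I \<beta> (2 * exp (- \<beta> * t)) w"
proof -
  define u where "u = 2 * exp (- \<beta> * t) * (\<Sum>k\<in>I. cosh (\<beta> * w k))"
  have "cosh (\<beta> * w k) \<le> exp (\<beta> * (t - h))" if "k \<in> I" for k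
  proof -
    have "cosh (\<beta> * w k) = (exp (\<beta> * \<bar>w k\<bar>) + exp (- (\<beta> * \<bar>w k\<bar>))) / 2"
      using assms by (simp add: cosh_def abs_if)
    also have "\<dots> \<le> exp (\<beta> * \<bar>w k\<bar>)"
      using assms by simp
    also have "\<dots> \<le> exp (\<beta> * (t - h))" using assms that by simp
    finally show ?thesis .
  qed
  then have "u \<le> 2 * exp (- \<beta> * t) * (\<Sum>k\<in>I. exp (\<beta> * (t - h)))"
    unfolding u_def by (intro mult_left_mono sum_mono) auto
  also have "\<dots> = 2 * real (card I) * (exp (- \<beta> * t) * exp (\<beta> * (t - h)))"
    by simp
  also have "exp (- \<beta> * t) * exp (\<beta> * (t - h)) = exp (- \<beta> * h)"
    by (simp add: algebra_simps flip: exp_add)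
  finally have "u \<le> 2 * real (card I) * exp (- \<beta> * h)" .
  moreover have "u \<ge> 0" unfolding u_def by (intro mult_nonneg_nonneg sum_nonneg) auto
  moreover from this have "1 - u \<le> 1 / (1 + u)"
    by (subst pos_le_divide_eq) (auto simp: algebra_simps)
  ultimately show ?thesis by (simp add: soft_box_def u_def)
qed

text \<open>The weights \<open>p\<close> form a sub-probability vector that does not depend on the increment: a
  shift by at most \<open>\<rho>\<close> changes every \<open>cosh\<close> by a factor of at most \<open>exp (\<beta> * \<rho>)\<close>. This stability
  is what lets the remainder involve the moments of single coordinates of \<open>x\<close>.\<close>

lemma soft_box_taylor:
  fixes I :: "'i set" and w :: "'i \<Rightarrow> real"
  assumes fin: "finite I" and \<beta>: "\<beta> > 0" and c: "c > 0"
  obtains a b p where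
    "\<forall>x \<rho>. (\<forall>k\<in>I. \<bar>x k\<bar> \<le> \<rho>) \<longrightarrow> \<rho> \<ge> 0 \<longrightarrow>
      \<bar>soft_box I \<beta> c (\<lambda>k. w k + x k) - (soft_box I \<beta> c w + (\<Sum>k\<in>I. a k * x k)
        + (\<Sum>k\<in>I. \<Sum>l\<in>I. b k l * (x k * x l)))\<bar>
      \<le> 13/6 * \<beta>^3 * \<rho>^2 * min \<rho> (exp (2 * \<beta> * \<rho>) * (\<Sum>k\<in>I. p k * \<bar>x k\<bar>))"
    "\<forall>k. p k \<ge> 0" "(\<Sum>k\<in>I. p k) \<le> 1"
proof -
  define S0 where "S0 = c * (\<Sum>k\<in>I. cosh (\<beta> * w k))"
  have S0: "S0 \<ge> 0" unfolding S0_def using c by (intro mult_nonneg_nonneg sum_nonneg) auto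
  \<comment> \<open>The share of coordinate \<open>k\<close> in the denominator
    \<open>1 + S0\<close> at the unshifted point.\<close>
  define p where "p k = c * cosh (\<beta> * w k) / (1 + S0)" for k
  define a where "a k = - (c * \<beta> * sinh (\<beta> * w k)) / (1 + S0)^2" for k
  \<comment> \<open>Half the Hessian of the soft box at \<open>w\<close>. The diagonal correction
    comes from differentiating \<open>sinh\<close> once more.\<close>
  define b where "b k l = c^2 * \<beta>^2 * sinh (\<beta> * w k) * sinh (\<beta> * w l) / (1 + S0)^3
     - (if k = l then c * \<beta>^2 * cosh (\<beta> * w k) / (2 * (1 + S0)^2) else 0)" for k l
  have p0: "p k \<ge> 0" for k using c S0 by (simp add: p_def)
  have "(\<Sum>k\<in>I. p k) = S0 / (1 + S0)"
    by (simp add: p_def S0_def sum_divide_distrib sum_distrib_left)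
  also have "\<dots> \<le> 1" using S0 by simp
  finally have p1: "(\<Sum>k\<in>I. p k) \<le> 1" .
  have main: "\<bar>soft_box I \<beta> c (\<lambda>k. w k + x k) - (soft_box I \<beta> c w + (\<Sum>k\<in>I. a k * x k)
        + (\<Sum>k\<in>I. \<Sum>l\<in>I. b k l * (x k * x l)))\<bar>
      \<le> 13/6 * \<beta>^3 * \<rho>^2 * min \<rho> (exp (2 * \<beta> * \<rho>) * (\<Sum>k\<in>I. p k * \<bar>x k\<bar>))"
    if x: "\<And>k. k \<in> I \<Longrightarrow> \<bar>x k\<bar> \<le> \<rho>" and \<rho>: "\<rho> \<ge> 0" for x \<rho>
  proof -
    \<comment> \<open>The claim is reduced to one variable by moving along the segment from
      \<open>w\<close> to \<open>w + x\<close>. The functions \<open>u1\<close>, \<open>u2\<close>,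
      \<open>u3\<close> are the successive derivatives of \<open>u\<close>, the sum in the
      denominator.\<close>
    define u u1 u2 u3 where "u \<theta> = c * (\<Sum>k\<in>I. cosh (\<beta> * (w k + \<theta> * x k)))"
      and "u1 \<theta> = c * (\<Sum>k\<in>I. \<beta> * x k * sinh (\<beta> * (w k + \<theta> * x k)))"
      and "u2 \<theta> = c * (\<Sum>k\<in>I. (\<beta> * x k)^2 * cosh (\<beta> * (w k + \<theta> * x k)))"
      and "u3 \<theta> = c * (\<Sum>k\<in>I. (\<beta> * x k)^3 * sinh (\<beta> * (w k + \<theta> * x k)))" for \<theta>
    have u0: "u \<theta> \<ge> 0" for \<theta> unfolding u_def using c by (intro mult_nonneg_nonneg sum_nonneg) auto
    have nz: "1 + u \<theta> \<noteq> 0" for \<theta> using u0[of \<theta>] by linarith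
    have D0: "(u has_real_derivative u1 \<theta>) (at \<theta>)" for \<theta>
      unfolding u_def u1_def by (auto intro!: derivative_eq_intros sum.cong simp: mult_ac)
    have D1: "(u1 has_real_derivative u2 \<theta>) (at \<theta>)" for \<theta>
      unfolding u1_def u2_def by (auto intro!: derivative_eq_intros sum.cong simp: mult_ac power2_eq_square)
    have D2: "(u2 has_real_derivative u3 \<theta>) (at \<theta>)" for \<theta>
      unfolding u2_def u3_def by (auto intro!: derivative_eq_intros sum.cong simp: mult_ac power2_eq_square power3_eq_cube)
    define v where "v \<theta> = 1 / (1 + u \<theta>)" for \<theta>
    have DV: "(v has_real_derivative - u1 \<theta> * (v \<theta>)^2) (at \<theta>)" for \<theta>
      unfolding v_def using nz
      by (auto intro!: derivative_eq_intros D0 simp: power2_eq_square)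
    define f0 f1 f2 f3 where "f0 \<theta> = v \<theta>"
      and "f1 \<theta> = - u1 \<theta> * (v \<theta>)^2"
      and "f2 \<theta> = - u2 \<theta> * (v \<theta>)^2 + 2 * (u1 \<theta>)^2 * (v \<theta>)^3"
      and "f3 \<theta> = - u3 \<theta> * (v \<theta>)^2 + 6 * u1 \<theta> * u2 \<theta> * (v \<theta>)^3 - 6 * (u1 \<theta>)^3 * (v \<theta>)^4" for \<theta>
    have E0: "(f0 has_real_derivative f1 \<theta>) (at \<theta>)" for \<theta>
      unfolding f0_def f1_def by (rule DV)
    have E1: "(f1 has_real_derivative f2 \<theta>) (at \<theta>)" for \<theta>
      unfolding f1_def f2_def
      by (rule derivative_eq_intros DV D1 refl)+ (simp add: algebra_simps power2_eq_square power3_eq_cube)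
    have E2: "(f2 has_real_derivative f3 \<theta>) (at \<theta>)" for \<theta>
      unfolding f2_def f3_def
      by (rule derivative_eq_intros DV D1 D2 refl)+ (simp add: algebra_simps power2_eq_square power3_eq_cube power4_eq_xxxx)
    define diff where "diff m = (if m = 0 then f0 else if m = 1 then f1 else if m = 2 then f2 else f3)" for m :: nat
    have "\<exists>t. 0 < t \<and> t < (1::real) \<and> f0 1 = (\<Sum>m<3. diff m 0 / fact m * 1 ^ m) + diff 3 t / fact 3 * 1 ^ 3"
    proof (rule Maclaurin)
      show "\<forall>m t. m < 3 \<and> 0 \<le> t \<and> t \<le> (1::real) \<longrightarrow> DERIV (diff m) t :> diff (Suc m) t"
        using E0 E1 E2 by (auto simp: diff_def less_Suc_eq numeral_3_eq_3)
    qed (auto simp: diff_def)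
    then obtain \<theta> where \<theta>: "0 < \<theta>" "\<theta> < 1" and eq: "f0 1 = f0 0 + f1 0 + f2 0 / 2 + f3 \<theta> / 6"
      by (auto simp: diff_def eval_nat_numeral)
    have S: "u 0 = S0" by (simp add: u_def S0_def)
    have e1: "f1 0 = (\<Sum>k\<in>I. a k * x k)"
      by (simp add: f1_def v_def power_one_over S a_def u1_def sum_distrib_left sum_divide_distrib sum_negf mult_ac)
    have e2: "f2 0 / 2 = (\<Sum>k\<in>I. \<Sum>l\<in>I. b k l * (x k * x l))"
    proof -
      have "(\<Sum>k\<in>I. \<Sum>l\<in>I. b k l * (x k * x l)) =
        (\<Sum>k\<in>I. \<Sum>l\<in>I. c^2 * \<beta>^2 * sinh (\<beta> * w k) * sinh (\<beta> * w l) / (1 + S0)^3 * (x k * x l))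
        - (\<Sum>k\<in>I. \<Sum>l\<in>I. (if k = l then c * \<beta>^2 * cosh (\<beta> * w k) / (2 * (1 + S0)^2) * (x k * x k) else 0))"
        unfolding sum_subtractf[symmetric] by (intro sum.cong) (auto simp: b_def algebra_simps)
      also have "(\<Sum>k\<in>I. \<Sum>l\<in>I. c^2 * \<beta>^2 * sinh (\<beta> * w k) * sinh (\<beta> * w l) / (1 + S0)^3 * (x k * x l))
        = (u1 0)^2 / (1 + S0)^3"
        by (simp add: u1_def power2_eq_square sum_product sum_divide_distrib sum_distrib_left mult_ac)
      also have "(\<Sum>k\<in>I. \<Sum>l\<in>I. (if k = l then c * \<beta>^2 * cosh (\<beta> * w k) / (2 * (1 + S0)^2) * (x k * x k) else 0))
        = u2 0 / (2 * (1 + S0)^2)"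
        using fin by (simp add: u2_def sum_divide_distrib sum_distrib_left power2_eq_square mult_ac)
      finally show ?thesis
        by (simp add: f2_def v_def power_one_over S)
    qed
    \<comment> \<open>One majorant serves all three derivatives: the \<open>i\<close>-th is at most
      \<open>\<beta>^i * \<rho>^(i-1) * A\<close>. A single factor \<open>\<bar>x k\<bar>\<close>
      stays unestimated inside \<open>A\<close>.\<close>
    define A where "A \<theta> = c * (\<Sum>k\<in>I. \<bar>x k\<bar> * cosh (\<beta> * (w k + \<theta> * x k)))" for \<theta>
    have A0: "A \<theta> \<ge> 0" for \<theta> unfolding A_def using c by (intro mult_nonneg_nonneg sum_nonneg) auto
    have b1: "\<bar>u1 \<theta>\<bar> \<le> \<beta> * A \<theta>"
    proof -
      have "\<bar>u1 \<theta>\<bar> \<le> c * (\<Sum>k\<in>I. \<bar>\<beta> * x k * sinh (\<beta> * (w k + \<theta> * x k))\<bar>)"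
        unfolding u1_def using c by (auto simp: abs_mult intro!: order_trans[OF sum_abs])
      also have "\<dots> \<le> c * (\<Sum>k\<in>I. \<beta> * (\<bar>x k\<bar> * cosh (\<beta> * (w k + \<theta> * x k))))"
        using c \<beta> abs_sinh_le_cosh by (intro mult_left_mono sum_mono) (auto simp: abs_mult intro!: mult_left_mono)
      finally show ?thesis by (simp add: A_def sum_distrib_left mult_ac)
    qed
    have b2: "\<bar>u2 \<theta>\<bar> \<le> \<beta>^2 * \<rho> * A \<theta>"
    proof -
      have "\<bar>u2 \<theta>\<bar> = c * (\<Sum>k\<in>I. (\<beta> * x k)^2 * cosh (\<beta> * (w k + \<theta> * x k)))"
        unfolding u2_def using c by (simp add: abs_mult sum_nonneg)
      also have "\<dots> \<le> c * (\<Sum>k\<in>I. \<beta>^2 * \<rho> * (\<bar>x k\<bar> * cosh (\<beta> * (w k + \<theta> * x k))))"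
      proof (intro mult_left_mono sum_mono)
        fix k assume k: "k \<in> I"
        have "(x k)^2 \<le> \<rho> * \<bar>x k\<bar>"
          using mult_right_mono[OF x[OF k], of "\<bar>x k\<bar>"] by (simp add: power2_eq_square)
        then have "\<beta>^2 * (x k)^2 * cosh (\<beta> * (w k + \<theta> * x k)) \<le> \<beta>^2 * (\<rho> * \<bar>x k\<bar>) * cosh (\<beta> * (w k + \<theta> * x k))"
          by (intro mult_right_mono mult_left_mono) auto
        then show "(\<beta> * x k)^2 * cosh (\<beta> * (w k + \<theta> * x k)) \<le> \<beta>^2 * \<rho> * (\<bar>x k\<bar> * cosh (\<beta> * (w k + \<theta> * x k)))"
          by (simp add: power_mult_distrib mult_ac)
      qed (use c in auto)
      finally show ?thesis by (simp add: A_def sum_distrib_left mult_ac)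
    qed
    have b3: "\<bar>u3 \<theta>\<bar> \<le> \<beta>^3 * \<rho>^2 * A \<theta>"
    proof -
      have "\<bar>u3 \<theta>\<bar> \<le> c * (\<Sum>k\<in>I. \<bar>(\<beta> * x k)^3 * sinh (\<beta> * (w k + \<theta> * x k))\<bar>)"
        unfolding u3_def using c by (auto simp: abs_mult power_abs intro!: order_trans[OF sum_abs])
      also have "\<dots> \<le> c * (\<Sum>k\<in>I. \<beta>^3 * \<rho>^2 * (\<bar>x k\<bar> * cosh (\<beta> * (w k + \<theta> * x k))))"
      proof (intro mult_left_mono sum_mono)
        fix k assume k: "k \<in> I"
        have "\<bar>x k\<bar>^2 \<le> \<rho>^2" using x[OF k] by (intro power_mono) auto
        then have "\<bar>x k\<bar>^2 * \<bar>x k\<bar> \<le> \<rho>^2 * \<bar>x k\<bar>" by (intro mult_right_mono) auto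
        then have "\<bar>x k\<bar>^3 \<le> \<rho>^2 * \<bar>x k\<bar>" by (simp add: power2_eq_square power3_eq_cube)
        then have "\<beta>^3 * \<bar>x k\<bar>^3 * \<bar>sinh (\<beta> * (w k + \<theta> * x k))\<bar> \<le> \<beta>^3 * (\<rho>^2 * \<bar>x k\<bar>) * cosh (\<beta> * (w k + \<theta> * x k))"
          using \<beta> abs_sinh_le_cosh by (intro mult_mono) auto
        then show "\<bar>(\<beta> * x k)^3 * sinh (\<beta> * (w k + \<theta> * x k))\<bar> \<le> \<beta>^3 * \<rho>^2 * (\<bar>x k\<bar> * cosh (\<beta> * (w k + \<theta> * x k)))"
          using \<beta> by (simp add: power_mult_distrib abs_mult power_abs mult_ac)
      qed (use c in auto)
      finally show ?thesis by (simp add: A_def sum_distrib_left mult_ac)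
    qed
    \<comment> \<open>A sub-probability average of the \<open>\<bar>x k\<bar>\<close>, with weights
      taken at the intermediate point. It is at most \<rho>, which yields the first entry of the
      minimum.\<close>
    define q where "q = A \<theta> / (1 + u \<theta>)"
    have q0: "q \<ge> 0" using A0 u0 by (simp add: q_def)
    have "A \<theta> \<le> c * (\<Sum>k\<in>I. \<rho> * cosh (\<beta> * (w k + \<theta> * x k)))"
      unfolding A_def using c x by (intro mult_left_mono sum_mono mult_right_mono) auto
    also have "\<dots> = \<rho> * u \<theta>" by (simp add: u_def sum_distrib_left mult_ac)
    also have "\<dots> \<le> \<rho> * (1 + u \<theta>)" using \<rho> by (intro mult_left_mono) auto
    finally have q\<rho>: "q \<le> \<rho>"
      using u0[of \<theta>] by (simp add: q_def pos_divide_le_eq)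
    have P: "1 + u \<theta> \<ge> 1" using u0 by simp
    have Aq: "A \<theta> = q * (1 + u \<theta>)" using nz[of \<theta>] by (simp add: q_def)
    have t1: "\<bar>u3 \<theta> / (1 + u \<theta>)^2\<bar> \<le> \<beta>^3 * \<rho>^2 * q"
    proof -
      have "\<bar>u3 \<theta> / (1 + u \<theta>)^2\<bar> \<le> \<beta>^3 * \<rho>^2 * (q * (1 + u \<theta>)) / (1 + u \<theta>)^2"
        using b3 by (simp add: Aq abs_divide divide_right_mono)
      also have "\<dots> = \<beta>^3 * \<rho>^2 * q / (1 + u \<theta>)" using nz[of \<theta>] by (simp add: power2_eq_square)
      also have "\<dots> \<le> \<beta>^3 * \<rho>^2 * q / 1" using P q0 \<beta> by (intro divide_left_mono) auto
      finally show ?thesis by simp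
    qed
    have t2: "\<bar>u1 \<theta> * u2 \<theta> / (1 + u \<theta>)^3\<bar> \<le> \<beta>^3 * \<rho>^2 * q"
    proof -
      have "\<bar>u1 \<theta>\<bar> * \<bar>u2 \<theta>\<bar> \<le> (\<beta> * A \<theta>) * (\<beta>^2 * \<rho> * A \<theta>)" using b1 b2 A0[of \<theta>] \<beta> by (intro mult_mono) auto
      then have "\<bar>u1 \<theta> * u2 \<theta> / (1 + u \<theta>)^3\<bar> \<le> (\<beta> * A \<theta>) * (\<beta>^2 * \<rho> * A \<theta>) / (1 + u \<theta>)^3"
        using P by (simp add: abs_divide abs_mult divide_right_mono)
      also have "\<dots> = \<beta>^3 * \<rho> * q * q / (1 + u \<theta>)" using nz[of \<theta>] by (simp add: Aq power2_eq_square power3_eq_cube)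
      also have "\<dots> \<le> \<beta>^3 * \<rho> * q * q / 1" using P q0 \<beta> \<rho> by (intro divide_left_mono) auto
      also have "\<dots> \<le> \<beta>^3 * \<rho> * q * \<rho>" using q0 q\<rho> \<beta> \<rho> by (simp add: mult_left_mono)
      finally show ?thesis by (simp add: power2_eq_square mult_ac)
    qed
    have t3: "\<bar>(u1 \<theta>)^3 / (1 + u \<theta>)^4\<bar> \<le> \<beta>^3 * \<rho>^2 * q"
    proof -
      have "\<bar>u1 \<theta>\<bar>^3 \<le> (\<beta> * A \<theta>)^3" using b1 by (intro power_mono) auto
      then have "\<bar>(u1 \<theta>)^3 / (1 + u \<theta>)^4\<bar> \<le> (\<beta> * A \<theta>)^3 / (1 + u \<theta>)^4"
        using P by (simp add: abs_divide power_abs divide_right_mono)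
      also have "\<dots> = \<beta>^3 * q^3 / (1 + u \<theta>)" using nz[of \<theta>] by (simp add: Aq power_mult_distrib eval_nat_numeral)
      also have "\<dots> \<le> \<beta>^3 * q^3 / 1" using P q0 \<beta> by (intro divide_left_mono) auto
      also have "\<dots> = \<beta>^3 * (q^2 * q)" by (simp add: eval_nat_numeral)
      also have "\<dots> \<le> \<beta>^3 * (\<rho>^2 * q)" using q0 q\<rho> \<beta> by (intro mult_left_mono mult_right_mono power_mono) auto
      finally show ?thesis by (simp add: mult_ac)
    qed
    \<comment> \<open>The three terms of the third derivative carry coefficients 1, 6 and 6, whence
      13. The Taylor factor 1/6 completes the constant.\<close>
    have f3: "\<bar>f3 \<theta>\<bar> \<le> 13 * \<beta>^3 * \<rho>^2 * q"
    proof -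
      have "f3 \<theta> = - (u3 \<theta> / (1 + u \<theta>)^2) + 6 * (u1 \<theta> * u2 \<theta> / (1 + u \<theta>)^3) - 6 * ((u1 \<theta>)^3 / (1 + u \<theta>)^4)"
        by (simp add: f3_def v_def power_one_over)
      then have "\<bar>f3 \<theta>\<bar> \<le> \<bar>u3 \<theta> / (1 + u \<theta>)^2\<bar> + 6 * \<bar>u1 \<theta> * u2 \<theta> / (1 + u \<theta>)^3\<bar> + 6 * \<bar>(u1 \<theta>)^3 / (1 + u \<theta>)^4\<bar>"
        by linarith
      then show ?thesis using t1 t2 t3 by simp
    qed
    \<comment> \<open>The weights are moved from the intermediate point back to \<open>w\<close>.
      The numerator and the denominator each cost a factor \<open>exp (\<beta> * \<rho>)\<close>,
      hence the 2 in the exponent.\<close>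
    have qs: "q \<le> exp (2 * \<beta> * \<rho>) * (\<Sum>k\<in>I. p k * \<bar>x k\<bar>)"
    proof -
      have h: "\<bar>\<beta> * (\<theta> * x k)\<bar> \<le> \<beta> * \<rho>" if "k \<in> I" for k
        using mult_mono[of \<theta> 1 "\<bar>x k\<bar>" \<rho>] x[OF that] \<theta> \<beta> by (simp add: abs_mult)
      have c1: "cosh (\<beta> * (w k + \<theta> * x k)) \<le> exp (\<beta> * \<rho>) * cosh (\<beta> * w k)" if "k \<in> I" for k
      proof -
        have "cosh (\<beta> * w k + \<beta> * (\<theta> * x k)) \<le> exp \<bar>\<beta> * (\<theta> * x k)\<bar> * cosh (\<beta> * w k)" by (rule cosh_shift_le)
        also have "\<dots> \<le> exp (\<beta> * \<rho>) * cosh (\<beta> * w k)" using h[OF that] by (intro mult_right_mono) auto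
        finally show ?thesis by (simp add: distrib_left)
      qed
      have c2: "cosh (\<beta> * w k) \<le> exp (\<beta> * \<rho>) * cosh (\<beta> * (w k + \<theta> * x k))" if "k \<in> I" for k
      proof -
        have "cosh (\<beta> * (w k + \<theta> * x k) + - (\<beta> * (\<theta> * x k))) \<le> exp \<bar>- (\<beta> * (\<theta> * x k))\<bar> * cosh (\<beta> * (w k + \<theta> * x k))" by (rule cosh_shift_le)
        also have "\<dots> \<le> exp (\<beta> * \<rho>) * cosh (\<beta> * (w k + \<theta> * x k))" using h[OF that] by (intro mult_right_mono) auto
        finally show ?thesis by (simp add: distrib_left)
      qed
      have "A \<theta> \<le> c * (\<Sum>k\<in>I. \<bar>x k\<bar> * (exp (\<beta> * \<rho>) * cosh (\<beta> * w k)))"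
        unfolding A_def using c c1 by (intro mult_left_mono sum_mono) auto
      also have "\<dots> = exp (\<beta> * \<rho>) * A 0" by (simp add: A_def sum_distrib_left mult_ac)
      finally have A1: "A \<theta> \<le> exp (\<beta> * \<rho>) * A 0" .
      have "S0 \<le> c * (\<Sum>k\<in>I. exp (\<beta> * \<rho>) * cosh (\<beta> * (w k + \<theta> * x k)))"
        unfolding S0_def using c c2 by (intro mult_left_mono sum_mono) auto
      also have "\<dots> = exp (\<beta> * \<rho>) * u \<theta>" by (simp add: u_def sum_distrib_left mult_ac)
      finally have "S0 \<le> exp (\<beta> * \<rho>) * u \<theta>" .
      moreover have "1 \<le> exp (\<beta> * \<rho>)" using \<beta> \<rho> by simp
      ultimately have "1 + S0 \<le> exp (\<beta> * \<rho>) * (1 + u \<theta>)" unfolding distrib_left by linarith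
      then have "A \<theta> * (1 + S0) \<le> (exp (\<beta> * \<rho>) * A 0) * (exp (\<beta> * \<rho>) * (1 + u \<theta>))"
        using A1 A0[of \<theta>] A0[of 0] S0 by (intro mult_mono) auto
      also have "\<dots> = exp (2 * \<beta> * \<rho>) * A 0 * (1 + u \<theta>)"
        by (simp add: algebra_simps flip: exp_add)
      finally have "q \<le> exp (2 * \<beta> * \<rho>) * (A 0 / (1 + S0))"
        using P S0 by (simp add: q_def field_simps)
      also have "A 0 / (1 + S0) = (\<Sum>k\<in>I. p k * \<bar>x k\<bar>)"
        by (simp add: A_def p_def sum_divide_distrib sum_distrib_left mult_ac)
      finally show ?thesis .
    qed
    have "\<bar>f0 1 - (f0 0 + f1 0 + f2 0 / 2)\<bar> = \<bar>f3 \<theta>\<bar> / 6" by (simp add: eq)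
    also have "\<dots> \<le> 13/6 * \<beta>^3 * \<rho>^2 * q" using f3 by simp
    also have "\<dots> \<le> 13/6 * \<beta>^3 * \<rho>^2 * min \<rho> (exp (2 * \<beta> * \<rho>) * (\<Sum>k\<in>I. p k * \<bar>x k\<bar>))"
      using q\<rho> qs \<beta> by (intro mult_left_mono) auto
    finally show ?thesis
      by (simp add: f0_def v_def u_def soft_box_def e1 e2)
  qed
  show ?thesis using main p0 p1 by (intro that[of a b p]) blast+
qed

section \<open>Independent products and Gaussian vectors\<close>

lemma (in prob_space) integrable_PiM_component:
  fixes f :: "'a \<Rightarrow> real"
  assumes "i \<in> I" "integrable M f"
  shows "integrable (Pi\<^sub>M I (\<lambda>_. M)) (\<lambda>\<omega>. f (\<omega> i))"
proof -
  have "distr (Pi\<^sub>M I (\<lambda>_. M)) M (\<lambda>\<omega>. \<omega> i) = M"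
    using assms by (intro distr_PiM_component) (auto intro: prob_space_axioms)
  then have "integrable (distr (Pi\<^sub>M I (\<lambda>_. M)) M (\<lambda>\<omega>. \<omega> i)) f"
    using assms by simp
  then show ?thesis
    using assms by (subst (asm) integrable_distr_eq) auto
qed

lemma (in prob_space) integral_PiM_component:
  fixes f :: "'a \<Rightarrow> real"
  assumes "i \<in> I" "f \<in> borel_measurable M"
  shows "(\<integral>\<omega>. f (\<omega> i) \<partial>Pi\<^sub>M I (\<lambda>_. M)) = expectation f"
proof -
  have "distr (Pi\<^sub>M I (\<lambda>_. M)) M (\<lambda>\<omega>. \<omega> i) = M"
    using assms by (intro distr_PiM_component) (auto intro: prob_space_axioms)
  then have "expectation f = integral\<^sup>L (distr (Pi\<^sub>M I (\<lambda>_. M)) M (\<lambda>\<omega>. \<omega> i)) f"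
    by simp
  also have "\<dots> = (\<integral>\<omega>. f (\<omega> i) \<partial>Pi\<^sub>M I (\<lambda>_. M))"
    using assms by (subst integral_distr) auto
  finally show ?thesis ..
qed

lemma (in prob_space) PiM_component_mult:
  fixes f g :: "'a \<Rightarrow> real"
  assumes I: "finite I" "i \<in> I" "j \<in> I" "i \<noteq> j" and int: "integrable M f" "integrable M g"
  shows integrable_PiM_component_mult: "integrable (Pi\<^sub>M I (\<lambda>_. M)) (\<lambda>\<omega>. f (\<omega> i) * g (\<omega> j))"
    and integral_PiM_component_mult: "(\<integral>\<omega>. f (\<omega> i) * g (\<omega> j) \<partial>Pi\<^sub>M I (\<lambda>_. M)) = expectation f * expectation g"
proof -
  interpret P: product_prob_space "\<lambda>_. M" I
    by (intro product_prob_spaceI prob_space_axioms)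
  define h where "h k = (if k = i then f else if k = j then g else (\<lambda>_. 1))" for k
  have h: "integrable M (h k)" for k
    using int by (simp add: h_def)
  have split: "(\<Prod>k\<in>I. F k) = F i * F j" if "\<And>k. k \<in> I - {i, j} \<Longrightarrow> F k = 1" for F :: "_ \<Rightarrow> real"
  proof -
    have "(\<Prod>k\<in>I. F k) = (\<Prod>k\<in>{i, j}. F k)"
      using I that by (intro prod.mono_neutral_right) auto
    then show ?thesis using I by simp
  qed
  have eq: "(\<Prod>k\<in>I. h k (\<omega> k)) = f (\<omega> i) * g (\<omega> j)" for \<omega>
    using I by (subst split) (auto simp: h_def)
  show "integrable (Pi\<^sub>M I (\<lambda>_. M)) (\<lambda>\<omega>. f (\<omega> i) * g (\<omega> j))"
    using P.product_integrable_prod[of I h] I h by (simp add: eq)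
  have "(\<integral>\<omega>. f (\<omega> i) * g (\<omega> j) \<partial>Pi\<^sub>M I (\<lambda>_. M)) = (\<Prod>k\<in>I. expectation (h k))"
    using P.product_integral_prod[of I h] I h by (simp add: eq)
  also have "\<dots> = expectation f * expectation g"
    using I by (subst split) (auto simp: h_def prob_space)
  finally show "(\<integral>\<omega>. f (\<omega> i) * g (\<omega> j) \<partial>Pi\<^sub>M I (\<lambda>_. M)) = expectation f * expectation g" .
qed

lemma (in prob_space) indep_vars_PiM_components:
  assumes "I \<noteq> {}"
  shows "prob_space.indep_vars (Pi\<^sub>M I (\<lambda>_. M)) (\<lambda>_. M) (\<lambda>i \<omega>. \<omega> i) I"
proof -
  interpret P: product_prob_space "\<lambda>_. M" I
    by (intro product_prob_spaceI prob_space_axioms)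
  have "distr (Pi\<^sub>M I (\<lambda>_. M)) (Pi\<^sub>M I (\<lambda>_. M)) (\<lambda>x. \<lambda>i\<in>I. x i) = distr (Pi\<^sub>M I (\<lambda>_. M)) (Pi\<^sub>M I (\<lambda>_. M)) (\<lambda>x. x)"
    by (intro distr_cong) (auto simp: space_PiM PiE_def extensional_restrict)
  also have "\<dots> = Pi\<^sub>M I (\<lambda>i. distr (Pi\<^sub>M I (\<lambda>_. M)) M (\<lambda>\<omega>. \<omega> i))"
    by (simp, intro PiM_cong refl) (simp add: P.PiM_component)
  finally show ?thesis
    using assms by (subst P.P.indep_vars_iff_distr_eq_PiM') auto
qed

abbreviation gauss :: "'i set \<Rightarrow> ('i \<Rightarrow> real) measure" where
  "gauss I \<equiv> Pi\<^sub>M I (\<lambda>_. std_normal_distribution)"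

lemma prob_space_std_normal: "prob_space std_normal_distribution"
  by (intro prob_space_normal_density) simp

lemma prob_space_gauss: "prob_space (gauss I)"
  by (intro prob_space_PiM prob_space_std_normal)

section \<open>Sums of scaled independent Gaussian vectors\<close>

lemma distr_std_normal_scale:
  assumes "\<sigma> > 0"
  shows "distr std_normal_distribution borel (\<lambda>x. \<sigma> * x) = density lborel (normal_density 0 \<sigma>)"
proof -
  interpret N: prob_space std_normal_distribution by (rule prob_space_std_normal)
  have "distributed std_normal_distribution lborel (\<lambda>x. x) std_normal_density"
    by (simp add: distributed_def distr_id2)
  from N.normal_density_affine[OF this, of \<sigma> 0] assms
  have "distributed std_normal_distribution lborel (\<lambda>x. \<sigma> * x) (normal_density 0 \<sigma>)"
    by simp
  then have "distr std_normal_distribution lborel (\<lambda>x. \<sigma> * x) = density lborel (normal_density 0 \<sigma>)"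
    by (rule distributed_distr_eq_density)
  also have "distr std_normal_distribution lborel (\<lambda>x. \<sigma> * x) = distr std_normal_distribution borel (\<lambda>x. \<sigma> * x)"
    by (intro distr_cong) auto
  finally show ?thesis .
qed

lemma distr_std_normal_convolution:
  assumes "\<sigma> > 0" "\<tau> > 0"
  shows "distr (std_normal_distribution \<Otimes>\<^sub>M std_normal_distribution) borel (\<lambda>(x, y). \<sigma> * x + \<tau> * y)
    = distr std_normal_distribution borel (\<lambda>x. sqrt (\<sigma>\<^sup>2 + \<tau>\<^sup>2) * x)"
proof -
  let ?N = "std_normal_distribution :: real measure"
  interpret N: prob_space ?N by (rule prob_space_std_normal)
  have [simp]: "sigma_finite_measure (density lborel (normal_density 0 s))" if "s > 0" for s
    using prob_space_normal_density[OF that, of 0] by (simp add: prob_space_imp_sigma_finite)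
  have "distr (?N \<Otimes>\<^sub>M ?N) borel (\<lambda>(x, y). \<sigma> * x + \<tau> * y)
    = distr (distr (?N \<Otimes>\<^sub>M ?N) (borel \<Otimes>\<^sub>M borel) (\<lambda>(x, y). (\<sigma> * x, \<tau> * y))) borel (\<lambda>(x, y). x + y)"
    by (subst distr_distr) (auto intro!: distr_cong)
  also have "distr (?N \<Otimes>\<^sub>M ?N) (borel \<Otimes>\<^sub>M borel) (\<lambda>(x, y). (\<sigma> * x, \<tau> * y))
    = distr ?N borel (\<lambda>x. \<sigma> * x) \<Otimes>\<^sub>M distr ?N borel (\<lambda>x. \<tau> * x)"
    by (subst pair_measure_distr) (auto simp: distr_std_normal_scale assms)
  also have "\<dots> = density lborel (normal_density 0 \<sigma>) \<Otimes>\<^sub>M density lborel (normal_density 0 \<tau>)"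
    using assms by (simp add: distr_std_normal_scale)
  also have "distr \<dots> borel (\<lambda>(x, y). x + y) = convolution (density lborel (normal_density 0 \<sigma>)) (density lborel (normal_density 0 \<tau>))"
    by (simp add: convolution_def)
  also have "\<dots> = density lborel (\<lambda>x. \<integral>\<^sup>+y. ennreal (normal_density 0 \<sigma> (x - y)) * ennreal (normal_density 0 \<tau> y) \<partial>lborel)"
    using assms prob_space_normal_density[of \<sigma> 0] prob_space_normal_density[of \<tau> 0]
    by (intro convolution_density) (auto simp: prob_space_def)
  also have "\<dots> = density lborel (normal_density 0 (sqrt (\<sigma>\<^sup>2 + \<tau>\<^sup>2)))"
    using conv_normal_density_zero_mean[OF assms] by (simp add: ennreal_mult'[symmetric])
  finally show ?thesis
    using assms by (subst distr_std_normal_scale) (auto simp: sum_power2_gt_zero_iff)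
qed

text \<open>Both laws are determined by boxes, on which the independence of the coordinates reduces the
  claim to the one-dimensional convolution identity.\<close>

lemma distr_gauss_convolution:
  assumes fin: "finite I" and pos: "\<sigma> > 0" "\<tau> > 0"
  shows "distr (gauss I \<Otimes>\<^sub>M gauss I) (Pi\<^sub>M I (\<lambda>_. borel)) (\<lambda>(z, z'). \<lambda>k\<in>I. \<sigma> * z k + \<tau> * z' k)
    = distr (gauss I) (Pi\<^sub>M I (\<lambda>_. borel)) (\<lambda>z. \<lambda>k\<in>I. sqrt (\<sigma>\<^sup>2 + \<tau>\<^sup>2) * z k)"
proof -
  let ?N = "std_normal_distribution :: real measure"
  define s where "s = sqrt (\<sigma>\<^sup>2 + \<tau>\<^sup>2)"
  interpret N: prob_space ?N by (rule prob_space_std_normal)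
  interpret G: prob_space "gauss I" by (rule prob_space_gauss)
  interpret P: product_prob_space "\<lambda>_. ?N" I
    by (intro product_prob_spaceI prob_space_std_normal)
  interpret F: finite_product_prob_space "\<lambda>_. ?N" I
    by standard (rule fin)
  define L where "L = distr ?N borel (\<lambda>x. s * x)"
  interpret L: prob_space L unfolding L_def by (intro N.prob_space_distr) simp
  interpret Q: product_prob_space "\<lambda>_. L" I
    by (intro product_prob_spaceI L.prob_space_axioms)
  have [measurable_cong, simp]: "sets L = sets borel" by (simp add: L_def)
  have sets: "sets (Pi\<^sub>M I (\<lambda>_. borel :: real measure)) = sets (Pi\<^sub>M I (\<lambda>_. L))"
    by (intro sets_PiM_cong) auto
  have meas1: "(\<lambda>(z, z'). \<lambda>k\<in>I. \<sigma> * z k + \<tau> * z' k) \<in> (gauss I \<Otimes>\<^sub>M gauss I) \<rightarrow>\<^sub>M Pi\<^sub>M I (\<lambda>_. borel)"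
    by measurable
  have meas2: "(\<lambda>z. \<lambda>k\<in>I. s * z k) \<in> gauss I \<rightarrow>\<^sub>M Pi\<^sub>M I (\<lambda>_. borel)"
    by measurable
  \<comment> \<open>The sum is identified as a product of copies of its one-dimensional marginal
    \<open>L\<close>, which is then recognised as the law of the rescaled vector.\<close>
  have "distr (gauss I \<Otimes>\<^sub>M gauss I) (Pi\<^sub>M I (\<lambda>_. borel)) (\<lambda>(z, z'). \<lambda>k\<in>I. \<sigma> * z k + \<tau> * z' k) = Pi\<^sub>M I (\<lambda>_. L)"
  proof (rule Q.PiM_eqI[OF fin])
    fix A assume A: "\<And>i. i \<in> I \<Longrightarrow> A i \<in> sets L"
    then have [measurable]: "i \<in> I \<Longrightarrow> A i \<in> sets borel" for i by simp
    let ?E = "\<lambda>x k. {y\<in>space ?N. \<sigma> * x + \<tau> * y \<in> A k}"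
    have meas: "Pi\<^sub>E I A \<in> sets (Pi\<^sub>M I (\<lambda>_. borel :: real measure))"
      using fin by (intro sets_PiM_I_finite) auto
    have "emeasure (distr (gauss I \<Otimes>\<^sub>M gauss I) (Pi\<^sub>M I (\<lambda>_. borel)) (\<lambda>(z, z'). \<lambda>k\<in>I. \<sigma> * z k + \<tau> * z' k)) (Pi\<^sub>E I A)
      = emeasure (gauss I \<Otimes>\<^sub>M gauss I) ((\<lambda>(z, z'). \<lambda>k\<in>I. \<sigma> * z k + \<tau> * z' k) -` Pi\<^sub>E I A \<inter> space (gauss I \<Otimes>\<^sub>M gauss I))"
      by (rule emeasure_distr[OF meas1 meas])
    also have "\<dots> = (\<integral>\<^sup>+z. emeasure (gauss I) (Pair z -` ((\<lambda>(z, z'). \<lambda>k\<in>I. \<sigma> * z k + \<tau> * z' k) -` Pi\<^sub>E I A \<inter> space (gauss I \<Otimes>\<^sub>M gauss I))) \<partial>gauss I)"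
      by (rule G.emeasure_pair_measure_alt[OF measurable_sets[OF meas1 meas]])
    also have "\<dots> = (\<integral>\<^sup>+z. (\<Prod>k\<in>I. emeasure ?N (?E (z k) k)) \<partial>gauss I)"
    proof (intro nn_integral_cong)
      fix z assume z: "z \<in> space (gauss I)"
      have "Pair z -` ((\<lambda>(z, z'). \<lambda>k\<in>I. \<sigma> * z k + \<tau> * z' k) -` Pi\<^sub>E I A \<inter> space (gauss I \<Otimes>\<^sub>M gauss I)) = Pi\<^sub>E I (\<lambda>k. ?E (z k) k)"
        using z by (auto simp: space_pair_measure space_PiM PiE_iff)
      then show "emeasure (gauss I) (Pair z -` ((\<lambda>(z, z'). \<lambda>k\<in>I. \<sigma> * z k + \<tau> * z' k) -` Pi\<^sub>E I A \<inter> space (gauss I \<Otimes>\<^sub>M gauss I))) = (\<Prod>k\<in>I. emeasure ?N (?E (z k) k))"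
        by (simp, subst P.emeasure_PiM[OF fin]) auto
    qed
    also have "\<dots> = (\<Prod>k\<in>I. \<integral>\<^sup>+x. emeasure ?N (?E x k) \<partial>?N)"
      using fin by (intro P.product_nn_integral_prod) auto
    also have "\<dots> = (\<Prod>k\<in>I. emeasure L (A k))"
    proof (intro prod.cong refl)
      fix k assume k: "k \<in> I"
      have m: "(\<lambda>(x, y). \<sigma> * x + \<tau> * y) \<in> borel_measurable (?N \<Otimes>\<^sub>M ?N)" by measurable
      have "emeasure L (A k) = emeasure (?N \<Otimes>\<^sub>M ?N) ((\<lambda>(x, y). \<sigma> * x + \<tau> * y) -` A k \<inter> space (?N \<Otimes>\<^sub>M ?N))"
        unfolding L_def s_def distr_std_normal_convolution[OF pos, symmetric]
        using k by (intro emeasure_distr m) auto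
      also have "\<dots> = (\<integral>\<^sup>+x. emeasure ?N (Pair x -` ((\<lambda>(x, y). \<sigma> * x + \<tau> * y) -` A k \<inter> space (?N \<Otimes>\<^sub>M ?N))) \<partial>?N)"
        using k by (intro N.emeasure_pair_measure_alt measurable_sets[OF m]) auto
      also have "\<dots> = (\<integral>\<^sup>+x. emeasure ?N (?E x k) \<partial>?N)"
        by (intro nn_integral_cong arg_cong2[where f=emeasure]) (auto simp: space_pair_measure)
      finally show "(\<integral>\<^sup>+x. emeasure ?N (?E x k) \<partial>?N) = emeasure L (A k)" ..
    qed
    finally show "emeasure (distr (gauss I \<Otimes>\<^sub>M gauss I) (Pi\<^sub>M I (\<lambda>_. borel)) (\<lambda>(z, z'). \<lambda>k\<in>I. \<sigma> * z k + \<tau> * z' k)) (Pi\<^sub>E I A) = (\<Prod>i\<in>I. emeasure L (A i))" .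
  qed (simp add: sets)
  also have "\<dots> = Pi\<^sub>M I (\<lambda>_. distr ?N L (\<lambda>x. s * x))"
    by (intro PiM_cong refl) (auto simp: L_def intro!: distr_cong)
  also have "\<dots> = distr (gauss I) (Pi\<^sub>M I (\<lambda>_. L)) (compose I (\<lambda>x. s * x))"
    using fin L.prob_space_axioms
    by (intro distr_PiM_finite_prob_space'[symmetric]) (auto intro: prob_space_std_normal)
  also have "\<dots> = distr (gauss I) (Pi\<^sub>M I (\<lambda>_. borel)) (compose I (\<lambda>x. s * x))"
    by (intro distr_cong sets[symmetric] refl)
  also have "\<dots> = distr (gauss I) (Pi\<^sub>M I (\<lambda>_. borel)) (\<lambda>z. \<lambda>k\<in>I. s * z k)"
    by (intro distr_cong refl) (simp add: compose_def)
  finally show ?thesis by (simp add: s_def)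
qed

section \<open>Lindeberg replacement\<close>

lemma soft_box_cong: "(\<And>k. k \<in> I \<Longrightarrow> w k = w' k) \<Longrightarrow> soft_box I \<beta> c w = soft_box I \<beta> c w'"
  by (simp add: soft_box_def)

lemma borel_measurable_cosh [measurable]:
  fixes f :: "'a \<Rightarrow> real"
  assumes [measurable]: "f \<in> borel_measurable M"
  shows "(\<lambda>x. cosh (f x)) \<in> borel_measurable M"
  unfolding cosh_field_def by measurable

lemma borel_measurable_soft_box:
  assumes [measurable]: "\<And>k. k \<in> I \<Longrightarrow> (\<lambda>x. w x k) \<in> borel_measurable M"
  shows "(\<lambda>x. soft_box I \<beta> c (w x)) \<in> borel_measurable M"
  unfolding soft_box_def by measurable

lemma (in prob_space) integrable_soft_box:
  assumes "\<And>k. k \<in> I \<Longrightarrow> (\<lambda>x. w x k) \<in> borel_measurable M" "c \<ge> 0"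
  shows "integrable M (\<lambda>x. soft_box I \<beta> c (w x))"
  using assms soft_box_nonneg[of c I \<beta>] soft_box_le_1[of c I \<beta>]
  by (intro integrable_const_bound[where B=1] borel_measurable_soft_box) auto

text \<open>The Gaussian remainder only needs \<open>E max\<^sub>k \<bar>z\<^sub>k\<bar>\<^sup>3\<close> to be a small power of the sample size; it is
  bounded by truncation at a level \<open>A\<close>, with a sixteenth moment above it.\<close>

definition normal_moment16 :: real where "normal_moment16 = fact 16 / (2 ^ 8 * fact 8)"

lemma std_normal_integrals:
  "integrable std_normal_distribution (\<lambda>x. x ^ k)"
  "(\<integral>x. x \<partial>std_normal_distribution) = 0"
  "(\<integral>x. x^2 \<partial>std_normal_distribution) = 1"
  "(\<integral>x. x^16 \<partial>std_normal_distribution) = normal_moment16"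
proof -
  show "integrable std_normal_distribution (\<lambda>x. x ^ k)"
    by (rule integrable_std_normal_distribution_moment)
  show "(\<integral>x. x \<partial>std_normal_distribution) = 0"
    using integral_std_normal_distribution_moment_odd[of 1] by simp
  show "(\<integral>x. x^2 \<partial>std_normal_distribution) = 1"
    using std_normal_distribution_even_moments(1)[of 1] by simp
  show "(\<integral>x. x^16 \<partial>std_normal_distribution) = normal_moment16"
    using std_normal_distribution_even_moments(1)[of 8] by (simp add: normal_moment16_def)
qed

lemma gauss_integrals:
  assumes "finite I" "k \<in> I" "l \<in> I"
  shows "integrable (gauss I) (\<lambda>z. z k ^ p)"
    and "(\<integral>z. z k \<partial>gauss I) = 0"
    and "integrable (gauss I) (\<lambda>z. z k * z l)"
    and "(\<integral>z. z k * z l \<partial>gauss I) = (if k = l then 1 else 0)"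
    and "(\<integral>z. z k ^ 16 \<partial>gauss I) = normal_moment16"
proof -
  interpret N: prob_space std_normal_distribution by (rule prob_space_std_normal)
  note I = std_normal_integrals
  have i1: "integrable std_normal_distribution (\<lambda>x::real. x)" using I(1)[of 1] by simp
  show *: "integrable (gauss I) (\<lambda>z. z k ^ p)" for p
    using N.integrable_PiM_component[OF assms(2) I(1)] .
  show "(\<integral>z. z k \<partial>gauss I) = 0"
    using N.integral_PiM_component[OF assms(2), of "\<lambda>x. x"] I(2) by simp
  show "(\<integral>z. z k ^ 16 \<partial>gauss I) = normal_moment16"
    using N.integral_PiM_component[OF assms(2), of "\<lambda>x. x^16"] I(4) by simp
  show "integrable (gauss I) (\<lambda>z. z k * z l)"
    using N.integrable_PiM_component_mult[OF assms(1-3) _ i1 i1] *[of 2]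
    by (cases "k = l") (auto simp: power2_eq_square)
  show "(\<integral>z. z k * z l \<partial>gauss I) = (if k = l then 1 else 0)"
    using N.integral_PiM_component_mult[OF assms(1-3) _ i1 i1]
      N.integral_PiM_component[OF assms(2), of "\<lambda>x. x^2"] I(2,3)
    by (cases "k = l") (auto simp: power2_eq_square)
qed

text \<open>The quadratic polynomial sees the increment only through its mean and covariance. Two
  increments with mean zero and the same multiple of the identity as covariance therefore have
  expectations within the sum of their remainders.\<close>

lemma (in prob_space) second_order_expansion:
  fixes x :: "'i \<Rightarrow> 'a \<Rightarrow> real"
  assumes fin: "finite I"
    and F: "integrable M F" and R: "integrable M R"
    and x: "\<And>k. k \<in> I \<Longrightarrow> integrable M (x k)" "\<And>k. k \<in> I \<Longrightarrow> expectation (x k) = 0"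
    and xx: "\<And>k l. k \<in> I \<Longrightarrow> l \<in> I \<Longrightarrow> integrable M (\<lambda>\<omega>. x k \<omega> * x l \<omega>)"
      "\<And>k l. k \<in> I \<Longrightarrow> l \<in> I \<Longrightarrow> expectation (\<lambda>\<omega>. x k \<omega> * x l \<omega>) = (if k = l then v else 0)"
    and bd: "\<And>\<omega>. \<omega> \<in> space M \<Longrightarrow> \<bar>F \<omega> - (f0 + (\<Sum>k\<in>I. a k * x k \<omega>) + (\<Sum>k\<in>I. \<Sum>l\<in>I. b k l * (x k \<omega> * x l \<omega>)))\<bar> \<le> R \<omega>"
  shows "\<bar>expectation F - (f0 + v * (\<Sum>k\<in>I. b k k))\<bar> \<le> expectation R"
proof -
  let ?T = "\<lambda>\<omega>. f0 + (\<Sum>k\<in>I. a k * x k \<omega>) + (\<Sum>k\<in>I. \<Sum>l\<in>I. b k l * (x k \<omega> * x l \<omega>))"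
  have T: "integrable M ?T"
    using x xx by (intro Bochner_Integration.integrable_add Bochner_Integration.integrable_sum integrable_mult_right) auto
  have "expectation ?T = f0 + (\<Sum>k\<in>I. a k * expectation (x k)) + (\<Sum>k\<in>I. \<Sum>l\<in>I. b k l * expectation (\<lambda>\<omega>. x k \<omega> * x l \<omega>))"
    using x xx by (simp add: Bochner_Integration.integral_add Bochner_Integration.integral_sum
        Bochner_Integration.integrable_sum Bochner_Integration.integrable_add prob_space)
  also have "\<dots> = f0 + (\<Sum>k\<in>I. \<Sum>l\<in>I. if k = l then b k k * v else 0)"
    using x xx by (simp, intro sum.cong) auto
  also have "\<dots> = f0 + v * (\<Sum>k\<in>I. b k k)"
    using fin by (simp add: sum_distrib_left mult_ac)
  finally have "expectation F - (f0 + v * (\<Sum>k\<in>I. b k k)) = expectation (\<lambda>\<omega>. F \<omega> - ?T \<omega>)"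
    using F T by (simp add: Bochner_Integration.integral_diff)
  also have "\<bar>\<dots>\<bar> \<le> expectation (\<lambda>\<omega>. \<bar>F \<omega> - ?T \<omega>\<bar>)"
    by (rule integral_abs_bound)
  also have "\<dots> \<le> expectation R"
    using bd F T R by (intro integral_mono integrable_abs Bochner_Integration.integrable_diff) auto
  finally show ?thesis .
qed

text \<open>The summand with \<open>B\<close> comes from the bounded variable. The two with
  \<open>A\<close> come from its Gaussian substitute, below and above the truncation level.\<close>

definition lindeberg_err :: "nat \<Rightarrow> real \<Rightarrow> real \<Rightarrow> real \<Rightarrow> real \<Rightarrow> real" where
  "lindeberg_err d \<beta> B A b = 13/6 * \<beta>^3 * \<bar>b\<bar>^3 *
     (B\<^sup>2 * exp (2 * \<beta> * \<bar>b\<bar> * B) + A^3 + real d * normal_moment16 / A^13)"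

text \<open>Both increments have covariance \<open>b^2\<close> times the identity, so they share the
  second-order value and only the cubic remainders differ. The Gaussian is symmetric, so its scale
  can be taken as \<open>\<bar>b\<bar>\<close>, the form needed for merging Gaussian scales.\<close>

lemma lindeberg_step:
  fixes I :: "'i set" and \<psi> :: "'i \<Rightarrow> 'a \<Rightarrow> real"
  assumes fin: "finite I" and \<beta>: "\<beta> > 0" and c: "c > 0" and A: "A > 0" and B: "B \<ge> 0"
    and prob: "prob_space \<mu>"
    and meas [measurable]: "\<And>k. k \<in> I \<Longrightarrow> \<psi> k \<in> borel_measurable \<mu>"
    and bound: "\<And>k u. k \<in> I \<Longrightarrow> u \<in> space \<mu> \<Longrightarrow> \<bar>\<psi> k u\<bar> \<le> B"
    and mean: "\<And>k. k \<in> I \<Longrightarrow> (\<integral>u. \<psi> k u \<partial>\<mu>) = 0"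
    and cov: "\<And>k l. k \<in> I \<Longrightarrow> l \<in> I \<Longrightarrow> (\<integral>u. \<psi> k u * \<psi> l u \<partial>\<mu>) = (if k = l then 1 else 0)"
  shows "\<bar>(\<integral>u. soft_box I \<beta> c (\<lambda>k. w k + b * \<psi> k u) \<partial>\<mu>)
      - (\<integral>z. soft_box I \<beta> c (\<lambda>k. w k + \<bar>b\<bar> * z k) \<partial>gauss I)\<bar> \<le> lindeberg_err (card I) \<beta> B A b"
proof -
  interpret \<mu>: prob_space \<mu> by fact
  interpret G: prob_space "gauss I" by (rule prob_space_gauss)
  obtain a e p where taylor: "\<forall>x \<rho>. (\<forall>k\<in>I. \<bar>x k\<bar> \<le> \<rho>) \<longrightarrow> \<rho> \<ge> 0 \<longrightarrow>
      \<bar>soft_box I \<beta> c (\<lambda>k. w k + x k) - (soft_box I \<beta> c w + (\<Sum>k\<in>I. a k * x k)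
        + (\<Sum>k\<in>I. \<Sum>l\<in>I. e k l * (x k * x l)))\<bar>
      \<le> 13/6 * \<beta>^3 * \<rho>^2 * min \<rho> (exp (2 * \<beta> * \<rho>) * (\<Sum>k\<in>I. p k * \<bar>x k\<bar>))"
    and p: "\<forall>k. p k \<ge> 0" "(\<Sum>k\<in>I. p k) \<le> 1"
    by (rule soft_box_taylor[OF fin \<beta> c, of w]) blast
  let ?C = "soft_box I \<beta> c w + b\<^sup>2 * (\<Sum>k\<in>I. e k k)"
  have int: "integrable \<mu> (\<psi> k)" "integrable \<mu> (\<lambda>u. \<psi> k u * \<psi> l u)" if "k \<in> I" "l \<in> I" for k l
  proof -
    show "integrable \<mu> (\<psi> k)"
      using that bound by (intro \<mu>.integrable_const_bound[where B=B]) auto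
    have "\<bar>\<psi> k u\<bar> * \<bar>\<psi> l u\<bar> \<le> B * B" if "u \<in> space \<mu>" for u
      using bound[OF \<open>k \<in> I\<close> that] bound[OF \<open>l \<in> I\<close> that] B by (intro mult_mono) auto
    then show "integrable \<mu> (\<lambda>u. \<psi> k u * \<psi> l u)"
      using that by (intro \<mu>.integrable_const_bound[where B="B * B"]) (auto simp: abs_mult)
  qed
  \<comment> \<open>The free factor \<open>\<bar>\<psi> k u\<bar>\<close> is bounded by
    \<open>(1 + \<psi> k u * \<psi> k u) / 2\<close>, whose mean is 1 by unit variance. As the
    weights \<open>p\<close> sum to at most 1, the expected remainder involves \<open>B\<close>
    squared and not cubed.\<close>
  define R where "R u = 13/6 * \<beta>^3 * (\<bar>b\<bar> * B)\<^sup>2 * exp (2 * \<beta> * \<bar>b\<bar> * B) * \<bar>b\<bar> * (\<Sum>k\<in>I. p k * ((1 + \<psi> k u * \<psi> k u) / 2))" for u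
  have Rint: "integrable \<mu> R"
    unfolding R_def using int
    by (intro integrable_mult_right Bochner_Integration.integrable_sum) auto
  have 1: "\<bar>(\<integral>u. soft_box I \<beta> c (\<lambda>k. w k + b * \<psi> k u) \<partial>\<mu>) - ?C\<bar> \<le> (\<integral>u. R u \<partial>\<mu>)"
  proof (rule \<mu>.second_order_expansion[OF fin, where x = "\<lambda>k u. b * \<psi> k u" and a = a and b = e])
    show "integrable \<mu> (\<lambda>u. soft_box I \<beta> c (\<lambda>k. w k + b * \<psi> k u))"
      using c by (intro \<mu>.integrable_soft_box) auto
    fix k l assume kl: "k \<in> I" "l \<in> I"
    have eq: "(\<lambda>u. b * \<psi> k u * (b * \<psi> l u)) = (\<lambda>u. b\<^sup>2 * (\<psi> k u * \<psi> l u))"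
      by (auto simp: power2_eq_square)
    show "integrable \<mu> (\<lambda>u. b * \<psi> k u * (b * \<psi> l u))"
      unfolding eq using int[OF kl] by simp
    show "(\<integral>u. b * \<psi> k u * (b * \<psi> l u) \<partial>\<mu>) = (if k = l then b\<^sup>2 else 0)"
      unfolding eq using cov[OF kl] by simp
  next
    fix u assume u: "u \<in> space \<mu>"
    have le: "\<bar>b * \<psi> k u\<bar> \<le> \<bar>b\<bar> * B" if "k \<in> I" for k
      using bound[OF that u] by (simp add: abs_mult mult_left_mono)
    have "\<bar>soft_box I \<beta> c (\<lambda>k. w k + b * \<psi> k u) - (soft_box I \<beta> c w + (\<Sum>k\<in>I. a k * (b * \<psi> k u)) +
         (\<Sum>k\<in>I. \<Sum>l\<in>I. e k l * (b * \<psi> k u * (b * \<psi> l u))))\<bar>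
       \<le> 13/6 * \<beta>^3 * (\<bar>b\<bar> * B)^2 * min (\<bar>b\<bar> * B) (exp (2 * \<beta> * (\<bar>b\<bar> * B)) * (\<Sum>k\<in>I. p k * \<bar>b * \<psi> k u\<bar>))"
      using le B by (intro taylor[rule_format]) auto
    also have "\<dots> \<le> 13/6 * \<beta>^3 * (\<bar>b\<bar> * B)^2 * (exp (2 * \<beta> * (\<bar>b\<bar> * B)) * (\<Sum>k\<in>I. p k * (\<bar>b\<bar> * ((1 + \<psi> k u * \<psi> k u) / 2))))"
    proof (intro mult_left_mono min.coboundedI2 sum_mono)
      fix k assume "k \<in> I"
      have "\<bar>\<psi> k u\<bar> \<le> (1 + \<psi> k u * \<psi> k u) / 2"
        using zero_le_power2[of "\<bar>\<psi> k u\<bar> - 1"] by (simp add: power2_eq_square algebra_simps)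
      then show "\<bar>b * \<psi> k u\<bar> \<le> \<bar>b\<bar> * ((1 + \<psi> k u * \<psi> k u) / 2)"
        unfolding abs_mult by (intro mult_left_mono) auto
    qed (use \<beta> p in auto)
    also have "\<dots> = R u"
      by (simp add: R_def sum_distrib_left mult_ac)
    finally show "\<bar>soft_box I \<beta> c (\<lambda>k. w k + b * \<psi> k u) - (soft_box I \<beta> c w + (\<Sum>k\<in>I. a k * (b * \<psi> k u)) +
         (\<Sum>k\<in>I. \<Sum>l\<in>I. e k l * (b * \<psi> k u * (b * \<psi> l u))))\<bar> \<le> R u" .
  qed (use int mean Rint in auto)
  have "(\<integral>u. R u \<partial>\<mu>) = 13/6 * \<beta>^3 * (\<bar>b\<bar> * B)\<^sup>2 * exp (2 * \<beta> * \<bar>b\<bar> * B) * \<bar>b\<bar> * (\<Sum>k\<in>I. p k * ((1 + 1) / 2))"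
    unfolding R_def using int cov
    by (simp add: Bochner_Integration.integral_sum Bochner_Integration.integral_add \<mu>.prob_space)
  also have "\<dots> \<le> 13/6 * \<beta>^3 * (\<bar>b\<bar> * B)\<^sup>2 * exp (2 * \<beta> * \<bar>b\<bar> * B) * \<bar>b\<bar> * 1"
    using \<beta> p by (intro mult_left_mono) auto
  finally have 2: "(\<integral>u. R u \<partial>\<mu>) \<le> 13/6 * \<beta>^3 * \<bar>b\<bar>^3 * (B\<^sup>2 * exp (2 * \<beta> * \<bar>b\<bar> * B))"
    by (simp add: power_mult_distrib power2_eq_square power3_eq_cube mult_ac)
  define S where "S z = 13/6 * \<beta>^3 * \<bar>b\<bar>^3 * (A^3 + (\<Sum>k\<in>I. z k ^ 16 / A^13))" for z :: "'i \<Rightarrow> real"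
  have Sint: "integrable (gauss I) S"
    unfolding S_def using gauss_integrals(1)[OF fin]
    by (intro integrable_mult_right Bochner_Integration.integrable_add Bochner_Integration.integrable_sum integrable_divide) auto
  have 3: "\<bar>(\<integral>z. soft_box I \<beta> c (\<lambda>k. w k + \<bar>b\<bar> * z k) \<partial>gauss I) - ?C\<bar> \<le> (\<integral>z. S z \<partial>gauss I)"
  proof (rule G.second_order_expansion[OF fin, where x = "\<lambda>k z. \<bar>b\<bar> * z k" and a = a and b = e])
    show "integrable (gauss I) (\<lambda>z. soft_box I \<beta> c (\<lambda>k. w k + \<bar>b\<bar> * z k))"
      using c by (intro G.integrable_soft_box) auto
    fix k l assume kl: "k \<in> I" "l \<in> I"
    have eq: "(\<lambda>z. \<bar>b\<bar> * z k * (\<bar>b\<bar> * z l)) = (\<lambda>z. b\<^sup>2 * (z k * z l))"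
      by (auto simp: power2_eq_square algebra_simps simp flip: abs_mult)
    show "integrable (gauss I) (\<lambda>z. \<bar>b\<bar> * z k * (\<bar>b\<bar> * z l))"
      unfolding eq using gauss_integrals(3)[OF fin kl] by simp
    show "(\<integral>z. \<bar>b\<bar> * z k * (\<bar>b\<bar> * z l) \<partial>gauss I) = (if k = l then b\<^sup>2 else 0)"
      unfolding eq using gauss_integrals(4)[OF fin kl] by simp
  next
    fix z :: "'i \<Rightarrow> real"
    \<comment> \<open>Inserting 0 makes the maximum meaningful and nonnegative also when
      \<open>I\<close> is empty.\<close>
    define m where "m = Max (insert 0 ((\<lambda>k. \<bar>z k\<bar>) ` I))"
    have m: "m \<ge> 0" "\<And>k. k \<in> I \<Longrightarrow> \<bar>z k\<bar> \<le> m" using fin by (auto simp: m_def)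
    have m3: "m^3 \<le> A^3 + (\<Sum>k\<in>I. z k ^ 16 / A^13)"
    proof -
      have pos: "(\<Sum>k\<in>I. z k ^ 16 / A^13) \<ge> 0" using A by (intro sum_nonneg) (auto simp: zero_le_even_power)
      show ?thesis
      proof (cases "m \<le> A")
        case True
        then have "m^3 \<le> A^3" using m by (intro power_mono) auto
        then show ?thesis using pos by simp
      next
        case False
        have "m \<in> insert 0 ((\<lambda>k. \<bar>z k\<bar>) ` I)" unfolding m_def using fin by (intro Max_in) auto
        then obtain k where k: "k \<in> I" "m = \<bar>z k\<bar>" using False A by auto
        \<comment> \<open>Above the level \<open>A\<close>, thirteen surplus powers are traded for
          \<open>A^13\<close>. The sum over \<open>k\<close> then dominates the coordinate that
          attains the maximum.\<close>
        have "m^3 * A^13 \<le> m^3 * m^13" using False A m by (intro mult_left_mono power_mono) auto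
        also have "\<dots> = m^16" by (simp flip: power_add)
        also have "\<dots> = z k ^ 16" by (simp add: k power_even_abs)
        finally have "m^3 \<le> z k ^ 16 / A^13" using A by (simp add: field_simps)
        also have "\<dots> \<le> (\<Sum>k\<in>I. z k ^ 16 / A^13)"
          using k fin A by (intro member_le_sum) (auto simp: zero_le_even_power)
        finally show ?thesis using A zero_le_power[of A 3] by linarith
      qed
    qed
    have "\<bar>soft_box I \<beta> c (\<lambda>k. w k + \<bar>b\<bar> * z k) - (soft_box I \<beta> c w + (\<Sum>k\<in>I. a k * (\<bar>b\<bar> * z k)) +
         (\<Sum>k\<in>I. \<Sum>l\<in>I. e k l * (\<bar>b\<bar> * z k * (\<bar>b\<bar> * z l))))\<bar>
       \<le> 13/6 * \<beta>^3 * (\<bar>b\<bar> * m)^2 * min (\<bar>b\<bar> * m) (exp (2 * \<beta> * (\<bar>b\<bar> * m)) * (\<Sum>k\<in>I. p k * \<bar>\<bar>b\<bar> * z k\<bar>))"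
      using m by (intro taylor[rule_format]) (auto simp: abs_mult intro: mult_left_mono)
    \<comment> \<open>Here the first entry of the minimum is used: Gaussian coordinates are
      unbounded, and a plain cube avoids the exponential factor.\<close>
    also have "\<dots> \<le> 13/6 * \<beta>^3 * (\<bar>b\<bar> * m)^2 * (\<bar>b\<bar> * m)"
      using \<beta> by (intro mult_left_mono) auto
    also have "\<dots> = 13/6 * \<beta>^3 * \<bar>b\<bar>^3 * m^3"
      by (simp add: power_mult_distrib power2_eq_square power3_eq_cube)
    also have "\<dots> \<le> S z"
      unfolding S_def using m3 \<beta> by (intro mult_left_mono) auto
    finally show "\<bar>soft_box I \<beta> c (\<lambda>k. w k + \<bar>b\<bar> * z k) - (soft_box I \<beta> c w + (\<Sum>k\<in>I. a k * (\<bar>b\<bar> * z k)) +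
         (\<Sum>k\<in>I. \<Sum>l\<in>I. e k l * (\<bar>b\<bar> * z k * (\<bar>b\<bar> * z l))))\<bar> \<le> S z" .
  qed (use gauss_integrals(1)[OF fin, of _ _ 1] gauss_integrals(2)[OF fin] Sint in auto)
  have 4: "(\<integral>z. S z \<partial>gauss I) = 13/6 * \<beta>^3 * \<bar>b\<bar>^3 * (A^3 + real (card I) * normal_moment16 / A^13)"
    unfolding S_def using gauss_integrals(1,5)[OF fin]
    by (simp add: Bochner_Integration.integral_sum Bochner_Integration.integral_add
        Bochner_Integration.integrable_sum integrable_divide G.prob_space)
  have "lindeberg_err (card I) \<beta> B A b = 13/6 * \<beta>^3 * \<bar>b\<bar>^3 * (B\<^sup>2 * exp (2 * \<beta> * \<bar>b\<bar> * B))
      + 13/6 * \<beta>^3 * \<bar>b\<bar>^3 * (A^3 + real (card I) * normal_moment16 / A^13)"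
    by (simp add: lindeberg_err_def algebra_simps)
  then show ?thesis
    using 1 2 3[unfolded 4] by linarith
qed

lemma (in prob_space) expectation_diff_le:
  fixes f g :: "'a \<Rightarrow> real"
  assumes "integrable M f" "integrable M g" "\<And>x. x \<in> space M \<Longrightarrow> \<bar>f x - g x\<bar> \<le> e"
  shows "\<bar>expectation f - expectation g\<bar> \<le> e"
proof -
  have "\<bar>expectation f - expectation g\<bar> = \<bar>expectation (\<lambda>x. f x - g x)\<bar>"
    using assms by simp
  also have "\<dots> \<le> expectation (\<lambda>x. \<bar>f x - g x\<bar>)"
    by (rule integral_abs_bound)
  also have "\<dots> \<le> expectation (\<lambda>x. e)"
    using assms by (intro integral_mono integrable_abs Bochner_Integration.integrable_diff) auto
  finally show ?thesis by (simp add: prob_space)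
qed

text \<open>Merges a newly inserted Gaussian term with the Gaussian that has replaced the rest of
  the sum. The value \<open>\<sigma> = 0\<close> covers the case in which no other observations
  remain.\<close>

lemma soft_box_gauss_convolution:
  assumes fin: "finite I" and c: "c \<ge> 0" and \<sigma>: "\<sigma> \<ge> 0" and \<tau>: "\<tau> > 0"
  shows "(\<integral>z. (\<integral>z'. soft_box I \<beta> c (\<lambda>k. w k + \<tau> * z k + \<sigma> * z' k) \<partial>gauss I) \<partial>gauss I)
    = (\<integral>z. soft_box I \<beta> c (\<lambda>k. w k + sqrt (\<sigma>\<^sup>2 + \<tau>\<^sup>2) * z k) \<partial>gauss I)"
proof (cases "\<sigma> = 0")
  case True
  interpret G: prob_space "gauss I" by (rule prob_space_gauss)
  show ?thesis using True \<tau> by (simp add: G.prob_space)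
next
  case False
  with \<sigma> have \<sigma>: "\<sigma> > 0" by simp
  interpret G: prob_space "gauss I" by (rule prob_space_gauss)
  interpret GG: pair_prob_space "gauss I" "gauss I" ..
  let ?f = "\<lambda>v. soft_box I \<beta> c (\<lambda>k. w k + v k)"
  have meas: "?f \<in> borel_measurable (Pi\<^sub>M I (\<lambda>_. borel))"
    by (intro borel_measurable_soft_box) measurable
  have "(\<integral>z. (\<integral>z'. soft_box I \<beta> c (\<lambda>k. w k + \<tau> * z k + \<sigma> * z' k) \<partial>gauss I) \<partial>gauss I)
    = (\<integral>x. soft_box I \<beta> c (\<lambda>k. w k + \<tau> * fst x k + \<sigma> * snd x k) \<partial>(gauss I \<Otimes>\<^sub>M gauss I))"
    using c GG.integral_fst'[of "\<lambda>x. soft_box I \<beta> c (\<lambda>k. w k + \<tau> * fst x k + \<sigma> * snd x k)"]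
    by (simp add: GG.integrable_soft_box)
  also have "\<dots> = (\<integral>x. ?f (case x of (z, z') \<Rightarrow> \<lambda>k\<in>I. \<tau> * z k + \<sigma> * z' k) \<partial>(gauss I \<Otimes>\<^sub>M gauss I))"
    by (intro Bochner_Integration.integral_cong refl soft_box_cong) (auto simp: case_prod_beta)
  also have "\<dots> = integral\<^sup>L (distr (gauss I \<Otimes>\<^sub>M gauss I) (Pi\<^sub>M I (\<lambda>_. borel)) (\<lambda>(z, z'). \<lambda>k\<in>I. \<tau> * z k + \<sigma> * z' k)) ?f"
    by (subst integral_distr) (auto intro!: meas)
  also have "\<dots> = (\<integral>z. ?f (\<lambda>k\<in>I. sqrt (\<tau>\<^sup>2 + \<sigma>\<^sup>2) * z k) \<partial>gauss I)"
    unfolding distr_gauss_convolution[OF fin \<tau> \<sigma>] by (subst integral_distr) (auto intro!: meas)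
  also have "\<dots> = (\<integral>z. soft_box I \<beta> c (\<lambda>k. w k + sqrt (\<sigma>\<^sup>2 + \<tau>\<^sup>2) * z k) \<partial>gauss I)"
    by (intro Bochner_Integration.integral_cong refl soft_box_cong) (auto simp: add_ac)
  finally show ?thesis .
qed

text \<open>The induction generalises the base point \<open>w\<close>: whatever is not being
  replaced is frozen into it. This allows arbitrary unequal weights, and
  \<open>b s \<noteq> 0\<close> keeps every Gaussian scale positive when two of them are
  merged.\<close>

lemma lindeberg_sum:
  fixes I :: "'i set" and \<psi> :: "'i \<Rightarrow> 'a \<Rightarrow> real" and S :: "'s set"
  assumes fin: "finite I" and \<beta>: "\<beta> > 0" and c: "c > 0" and A: "A > 0" and B: "B \<ge> 0"
    and prob: "prob_space \<mu>"
    and meas [measurable]: "\<And>k. k \<in> I \<Longrightarrow> \<psi> k \<in> borel_measurable \<mu>"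
    and bound: "\<And>k u. k \<in> I \<Longrightarrow> u \<in> space \<mu> \<Longrightarrow> \<bar>\<psi> k u\<bar> \<le> B"
    and mean: "\<And>k. k \<in> I \<Longrightarrow> (\<integral>u. \<psi> k u \<partial>\<mu>) = 0"
    and cov: "\<And>k l. k \<in> I \<Longrightarrow> l \<in> I \<Longrightarrow> (\<integral>u. \<psi> k u * \<psi> l u \<partial>\<mu>) = (if k = l then 1 else 0)"
    and S: "finite S" and b: "\<And>s. s \<in> S \<Longrightarrow> b s \<noteq> 0"
  shows "\<bar>(\<integral>\<omega>. soft_box I \<beta> c (\<lambda>k. w k + (\<Sum>s\<in>S. b s * \<psi> k (\<omega> s))) \<partial>Pi\<^sub>M S (\<lambda>_. \<mu>))
      - (\<integral>z. soft_box I \<beta> c (\<lambda>k. w k + sqrt (\<Sum>s\<in>S. (b s)\<^sup>2) * z k) \<partial>gauss I)\<bar>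
    \<le> (\<Sum>s\<in>S. lindeberg_err (card I) \<beta> B A (b s))"
  using S b
proof (induction S arbitrary: w rule: finite_induct)
  case empty
  interpret G: prob_space "gauss I" by (rule prob_space_gauss)
  interpret P: prob_space "Pi\<^sub>M ({} :: 's set) (\<lambda>_. \<mu>)" by (intro prob_space_PiM prob)
  show ?case by (simp add: G.prob_space P.prob_space)
next
  case (insert s S)
  let ?P = "Pi\<^sub>M S (\<lambda>_. \<mu>)"
  interpret \<mu>: prob_space \<mu> by fact
  interpret G: prob_space "gauss I" by (rule prob_space_gauss)
  interpret PP: product_prob_space "\<lambda>_. \<mu>" "insert s S" by (intro product_prob_spaceI prob)
  interpret P: prob_space ?P by (intro prob_space_PiM prob)
  interpret PG: pair_prob_space ?P "gauss I" ..
  interpret P\<mu>: pair_prob_space ?P \<mu> ..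
  let ?f = "soft_box I \<beta> c"
  let ?\<sigma> = "sqrt (\<Sum>s\<in>S. (b s)\<^sup>2)" and ?\<tau> = "\<bar>b s\<bar>"
  let ?T = "\<lambda>k \<omega>. \<Sum>s\<in>S. b s * \<psi> k (\<omega> s)"
  have c0: "c \<ge> 0" using c by simp
  have "(\<integral>\<omega>. ?f (\<lambda>k. w k + (\<Sum>s\<in>insert s S. b s * \<psi> k (\<omega> s))) \<partial>Pi\<^sub>M (insert s S) (\<lambda>_. \<mu>))
    = (\<integral>x. (\<integral>u. ?f (\<lambda>k. w k + (\<Sum>r\<in>insert s S. b r * \<psi> k ((x(s := u)) r))) \<partial>\<mu>) \<partial>?P)"
    using insert.hyps c0
    by (intro PP.product_integral_insert PP.integrable_soft_box) (auto intro!: borel_measurable_sum borel_measurable_times measurable_compose[OF _ meas])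
  also have "\<dots> = (\<integral>\<omega>. (\<integral>u. ?f (\<lambda>k. (w k + ?T k \<omega>) + b s * \<psi> k u) \<partial>\<mu>) \<partial>?P)"
  proof (intro Bochner_Integration.integral_cong refl soft_box_cong)
    fix x u k
    have "(\<Sum>r\<in>S. b r * \<psi> k ((x(s := u)) r)) = ?T k x"
      using insert.hyps by (intro sum.cong) auto
    then show "w k + (\<Sum>r\<in>insert s S. b r * \<psi> k ((x(s := u)) r)) = w k + ?T k x + b s * \<psi> k u"
      using insert.hyps by simp
  qed
  finally have 1: "(\<integral>\<omega>. ?f (\<lambda>k. w k + (\<Sum>s\<in>insert s S. b s * \<psi> k (\<omega> s))) \<partial>Pi\<^sub>M (insert s S) (\<lambda>_. \<mu>))
    = (\<integral>\<omega>. (\<integral>u. ?f (\<lambda>k. (w k + ?T k \<omega>) + b s * \<psi> k u) \<partial>\<mu>) \<partial>?P)" .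
  have i1: "integrable (?P \<Otimes>\<^sub>M \<mu>) (\<lambda>x. ?f (\<lambda>k. (w k + ?T k (fst x)) + b s * \<psi> k (snd x)))"
    using c0 by (intro P\<mu>.integrable_soft_box) measurable
  have i2: "integrable (?P \<Otimes>\<^sub>M gauss I) (\<lambda>x. ?f (\<lambda>k. (w k + ?T k (fst x)) + ?\<tau> * snd x k))"
    using c0 by (intro PG.integrable_soft_box) measurable
  have 2: "\<bar>(\<integral>\<omega>. (\<integral>u. ?f (\<lambda>k. (w k + ?T k \<omega>) + b s * \<psi> k u) \<partial>\<mu>) \<partial>?P)
      - (\<integral>\<omega>. (\<integral>z. ?f (\<lambda>k. (w k + ?T k \<omega>) + ?\<tau> * z k) \<partial>gauss I) \<partial>?P)\<bar> \<le> lindeberg_err (card I) \<beta> B A (b s)"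
  proof (rule P.expectation_diff_le)
    show "integrable (?P) (\<lambda>\<omega>. \<integral>u. ?f (\<lambda>k. (w k + ?T k \<omega>) + b s * \<psi> k u) \<partial>\<mu>)"
      using P\<mu>.integrable_fst'[OF i1] by simp
    show "integrable (?P) (\<lambda>\<omega>. \<integral>z. ?f (\<lambda>k. (w k + ?T k \<omega>) + ?\<tau> * z k) \<partial>gauss I)"
      using PG.integrable_fst'[OF i2] by simp
  qed (intro lindeberg_step[OF fin \<beta> c A B prob meas bound mean cov])
  \<comment> \<open>Fubini moves the new Gaussian variable outside, so that for each of its values
    it can be absorbed into \<open>w\<close> and the induction hypothesis applies to the remaining
    sum.\<close>
  have 3: "(\<integral>\<omega>. (\<integral>z. ?f (\<lambda>k. (w k + ?T k \<omega>) + ?\<tau> * z k) \<partial>gauss I) \<partial>?P)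
    = (\<integral>z. (\<integral>\<omega>. ?f (\<lambda>k. (w k + ?\<tau> * z k) + ?T k \<omega>) \<partial>?P) \<partial>gauss I)"
    using PG.Fubini_integral[of "\<lambda>\<omega> z. ?f (\<lambda>k. (w k + ?T k \<omega>) + ?\<tau> * z k)"] i2
    by (simp add: case_prod_beta' add_ac)
  interpret GP: pair_prob_space "gauss I" ?P ..
  interpret GG: pair_prob_space "gauss I" "gauss I" ..
  have i3: "integrable (gauss I \<Otimes>\<^sub>M ?P) (\<lambda>x. ?f (\<lambda>k. (w k + ?\<tau> * fst x k) + ?T k (snd x)))"
    using c0 by (intro GP.integrable_soft_box) measurable
  have i4: "integrable (gauss I \<Otimes>\<^sub>M gauss I) (\<lambda>x. ?f (\<lambda>k. (w k + ?\<tau> * fst x k) + ?\<sigma> * snd x k))"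
    using c0 by (intro GG.integrable_soft_box) measurable
  have 4: "\<bar>(\<integral>z. (\<integral>\<omega>. ?f (\<lambda>k. (w k + ?\<tau> * z k) + ?T k \<omega>) \<partial>?P) \<partial>gauss I)
     - (\<integral>z. (\<integral>z'. ?f (\<lambda>k. (w k + ?\<tau> * z k) + ?\<sigma> * z' k) \<partial>gauss I) \<partial>gauss I)\<bar> \<le> (\<Sum>s\<in>S. lindeberg_err (card I) \<beta> B A (b s))"
  proof (rule G.expectation_diff_le)
    show "integrable (gauss I) (\<lambda>z. \<integral>\<omega>. ?f (\<lambda>k. (w k + ?\<tau> * z k) + ?T k \<omega>) \<partial>?P)"
      using GP.integrable_fst'[OF i3] by simp
    show "integrable (gauss I) (\<lambda>z. \<integral>z'. ?f (\<lambda>k. (w k + ?\<tau> * z k) + ?\<sigma> * z' k) \<partial>gauss I)"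
      using GG.integrable_fst'[OF i4] by simp
  qed (intro insert.IH insert.prems, auto)
  have 5: "(\<integral>z. (\<integral>z'. ?f (\<lambda>k. (w k + ?\<tau> * z k) + ?\<sigma> * z' k) \<partial>gauss I) \<partial>gauss I)
    = (\<integral>z. ?f (\<lambda>k. w k + sqrt (\<Sum>s\<in>insert s S. (b s)\<^sup>2) * z k) \<partial>gauss I)"
    using insert.prems insert.hyps
    by (subst soft_box_gauss_convolution[OF fin c0]) (auto simp: sum_nonneg add_ac)
  show ?case
    using 1 2 3 4 5 insert.hyps by simp
qed

section \<open>The maximum of independent Gaussian variables\<close>

lemma measure_std_normal_le:
  assumes "0 \<le> t" "0 \<le> h"
  shows "measure std_normal_distribution {t<..t + h} \<le> h * std_normal_density t"
proof -
  interpret N: prob_space std_normal_distribution by (rule prob_space_std_normal)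
  have "emeasure std_normal_distribution {t<..t + h}
    = (\<integral>\<^sup>+x. ennreal (std_normal_density x) * indicator {t<..t + h} x \<partial>lborel)"
    by (simp add: emeasure_density)
  also have "\<dots> \<le> (\<integral>\<^sup>+x. ennreal (std_normal_density t) * indicator {t<..t + h} x \<partial>lborel)"
  proof (intro nn_integral_mono)
    fix x
    show "ennreal (std_normal_density x) * indicator {t<..t + h} x \<le> ennreal (std_normal_density t) * indicator {t<..t + h} x"
    proof (cases "x \<in> {t<..t + h}")
      case True
      then have "t\<^sup>2 \<le> x\<^sup>2" using assms by (intro power_mono) auto
      then have "std_normal_density x \<le> std_normal_density t"
        by (simp add: std_normal_density_def divide_right_mono)
      then show ?thesis by (auto intro!: mult_right_mono ennreal_leI)
    qed auto
  qed
  also have "\<dots> = ennreal (std_normal_density t * h)"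
    using assms by (simp add: nn_integral_cmult ennreal_mult)
  finally show ?thesis
    using assms by (simp add: N.emeasure_eq_measure mult.commute)
qed

lemma measure_std_normal_ge:
  assumes "0 \<le> t" "0 \<le> h"
  shows "h * std_normal_density (t + h) \<le> measure std_normal_distribution {t<..t + h}"
proof -
  interpret N: prob_space std_normal_distribution by (rule prob_space_std_normal)
  have "ennreal (std_normal_density (t + h) * h) = (\<integral>\<^sup>+x. ennreal (std_normal_density (t + h)) * indicator {t<..t + h} x \<partial>lborel)"
    using assms by (simp add: nn_integral_cmult ennreal_mult)
  also have "\<dots> \<le> (\<integral>\<^sup>+x. ennreal (std_normal_density x) * indicator {t<..t + h} x \<partial>lborel)"
  proof (intro nn_integral_mono)
    fix x
    show "ennreal (std_normal_density (t + h)) * indicator {t<..t + h} x \<le> ennreal (std_normal_density x) * indicator {t<..t + h} x"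
    proof (cases "x \<in> {t<..t + h}")
      case True
      then have "x\<^sup>2 \<le> (t + h)\<^sup>2" using assms by (intro power_mono) auto
      then have "std_normal_density (t + h) \<le> std_normal_density x"
        by (simp add: std_normal_density_def divide_right_mono)
      then show ?thesis by (auto intro!: mult_right_mono ennreal_leI)
    qed auto
  qed
  also have "\<dots> = emeasure std_normal_distribution {t<..t + h}"
    by (simp add: emeasure_density)
  finally show ?thesis
    using assms by (simp add: N.emeasure_eq_measure mult.commute)
qed

lemma std_normal_uminus: "distr std_normal_distribution borel uminus = std_normal_distribution"
proof -
  interpret N: prob_space std_normal_distribution by (rule prob_space_std_normal)
  have "distributed std_normal_distribution lborel (\<lambda>x. x) std_normal_density"
    by (simp add: distributed_def distr_id2)
  from N.normal_density_affine[OF this, of "-1" 0]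
  have "distributed std_normal_distribution lborel (\<lambda>x. - x) std_normal_density"
    by simp
  then have "distr std_normal_distribution lborel uminus = std_normal_distribution"
    using distributed_distr_eq_density by fastforce
  then show ?thesis
    by (metis distr_cong sets_lborel)
qed

lemma measure_std_normal_singleton: "measure std_normal_distribution {x} = 0"
proof -
  interpret N: prob_space std_normal_distribution by (rule prob_space_std_normal)
  have "emeasure std_normal_distribution {x} = 0"
    by (simp add: emeasure_density nn_integral_indicator_singleton')
  then show ?thesis by (simp add: measure_def)
qed

lemma Phi_uminus: "Phi (- x) = 1 - Phi x"
proof -
  interpret N: prob_space std_normal_distribution by (rule prob_space_std_normal)
  have "Phi (- x) = measure (distr std_normal_distribution borel uminus) {..- x}"
    by (simp add: Phi_def std_normal_uminus)
  also have "\<dots> = measure std_normal_distribution {x..}"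
    by (subst measure_distr) (auto intro!: arg_cong2[where f=measure])
  also have "{x..} = {x} \<union> {x<..}" by auto
  also have "measure std_normal_distribution \<dots> = measure std_normal_distribution {x} + measure std_normal_distribution {x<..}"
    by (intro N.finite_measure_Union) auto
  also have "\<dots> = measure std_normal_distribution (space std_normal_distribution - {..x})"
    by (auto simp: measure_std_normal_singleton intro!: arg_cong2[where f=measure])
  also have "\<dots> = 1 - Phi x"
    unfolding Phi_def by (intro N.prob_compl) auto
  finally show ?thesis .
qed

lemma Phi_diff: "x \<le> y \<Longrightarrow> Phi y - Phi x = measure std_normal_distribution {x<..y}"
proof -
  interpret N: prob_space std_normal_distribution by (rule prob_space_std_normal)
  assume "x \<le> y"
  then have "{..y} = {..x} \<union> {x<..y}" by auto
  then have "Phi y = measure std_normal_distribution {..x} + measure std_normal_distribution {x<..y}"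
    unfolding Phi_def by (simp only:) (intro N.finite_measure_Union, auto)
  then show ?thesis by (simp add: Phi_def)
qed

definition box_prob :: "real \<Rightarrow> real" where
  "box_prob t = measure std_normal_distribution {-t..t}"

lemma box_prob_bounds: "0 \<le> box_prob t" "box_prob t \<le> 1"
  using prob_space.prob_le_1[OF prob_space_std_normal] by (auto simp: box_prob_def)

lemma box_prob_mono: "s \<le> t \<Longrightarrow> box_prob s \<le> box_prob t"
proof -
  interpret N: prob_space std_normal_distribution by (rule prob_space_std_normal)
  show "s \<le> t \<Longrightarrow> box_prob s \<le> box_prob t"
    unfolding box_prob_def by (intro N.finite_measure_mono) auto
qed

lemma box_prob_nonpos: "t \<le> 0 \<Longrightarrow> box_prob t = 0"
  using measure_std_normal_singleton[of 0] by (cases "t = 0") (auto simp: box_prob_def)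

lemma box_prob_Phi: "t \<ge> 0 \<Longrightarrow> box_prob t = 2 * Phi t - 1"
proof -
  interpret N: prob_space std_normal_distribution by (rule prob_space_std_normal)
  assume t: "t \<ge> 0"
  then have "{-t..t} = {-t} \<union> {-t<..t}" by auto
  then have "box_prob t = measure std_normal_distribution {-t} + measure std_normal_distribution {-t<..t}"
    unfolding box_prob_def by (simp only:) (intro N.finite_measure_Union, auto)
  also have "\<dots> = Phi t - Phi (- t)"
    using t Phi_diff[of "-t" t] by (simp add: measure_std_normal_singleton)
  finally show ?thesis by (simp add: Phi_uminus)
qed

lemma measure_gauss_box:
  assumes "finite I"
  shows "measure (gauss I) {z \<in> space (gauss I). \<forall>k\<in>I. \<bar>z k\<bar> \<le> t} = box_prob t ^ card I"
proof -
  interpret P: product_prob_space "\<lambda>_. std_normal_distribution" I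
    by (intro product_prob_spaceI prob_space_std_normal)
  interpret F: finite_product_prob_space "\<lambda>_. std_normal_distribution" I
    by standard (rule assms)
  have "{z \<in> space (gauss I). \<forall>k\<in>I. \<bar>z k\<bar> \<le> t} = Pi\<^sub>E I (\<lambda>_. {-t..t})"
    by (intro set_eqI) (simp add: space_PiM PiE_iff abs_le_iff minus_le_iff, blast)
  then show ?thesis
    by (simp add: F.finite_measure_PiM_emb box_prob_def)
qed

lemma power_diff_le:
  fixes a b :: real
  assumes "0 \<le> b" "b \<le> a"
  shows "a ^ d - b ^ d \<le> real d * a ^ (d - 1) * (a - b)"
proof -
  have "(\<Sum>i<d. b ^ (d - Suc i) * a ^ i) \<le> (\<Sum>i<d. a ^ (d - 1))"
  proof (intro sum_mono)
    fix i assume "i \<in> {..<d}"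
    then have "d - 1 = (d - Suc i) + i" by auto
    then have "a ^ (d - 1) = a ^ (d - Suc i) * a ^ i" by (simp add: power_add)
    then show "b ^ (d - Suc i) * a ^ i \<le> a ^ (d - 1)"
      using assms by (simp add: mult_right_mono power_mono)
  qed
  then have "(a - b) * (\<Sum>i<d. b ^ (d - Suc i) * a ^ i) \<le> (a - b) * (real d * a ^ (d - 1))"
    using assms by (intro mult_left_mono) auto
  then show ?thesis by (simp add: power_diff_sumr2 mult_ac)
qed

text \<open>The left side is the probability that exactly one of \<open>d\<close> independent events
  of probability \<open>a\<close> fails. Analytically, \<open>d\<close> copies of the smallest power
  are compared with a geometric sum.\<close>

lemma power_times_compl_le:
  fixes a :: real
  assumes "0 \<le> a" "a \<le> 1"
  shows "real d * a ^ (d - 1) * (1 - a) \<le> 1"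
proof -
  have "(\<Sum>i<d. a ^ (d - 1)) \<le> (\<Sum>i<d. a ^ i)"
    using assms by (intro sum_mono power_decreasing) auto
  then have "(1 - a) * (real d * a ^ (d - 1)) \<le> (1 - a) * (\<Sum>i<d. a ^ i)"
    using assms by (intro mult_left_mono) auto
  also have "\<dots> = 1 - a ^ d"
    by (simp add: one_diff_power_eq)
  also have "\<dots> \<le> 1" using assms by simp
  finally show ?thesis by (simp add: mult_ac)
qed

text \<open>In the bulk the Gaussian density at \<open>t\<close> is at most \<open>D\<close> times the tail beyond \<open>t + h\<close>,
  up to a constant, so the density of the maximum is controlled by \<open>d q\<^sup>d\<^sup>-\<^sup>1 (1 - q) \<le> 1\<close>.\<close>

lemma box_prob_anticoncentration:
  assumes h: "0 \<le> h" "h * D \<le> 1" and D: "D \<ge> 1" "real d \<le> exp (D\<^sup>2 / 2)"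
  shows "box_prob (t + h) ^ d - box_prob t ^ d \<le> exp 4 * h * D"
proof -
  have main: "box_prob (t + h) ^ d - box_prob t ^ d \<le> exp 4 * h * D" if t: "t \<ge> 0" for t
  proof -
    let ?q = "box_prob (t + h)"
    have le: "?q - box_prob t \<le> 2 * h * std_normal_density t"
      using measure_std_normal_le[OF t h(1)] Phi_diff[of t "t + h"] t h by (simp add: box_prob_Phi)
    have "?q ^ d - box_prob t ^ d \<le> real d * ?q ^ (d - 1) * (?q - box_prob t)"
      using h by (intro power_diff_le box_prob_bounds box_prob_mono) auto
    also have "\<dots> \<le> real d * ?q ^ (d - 1) * (2 * h * std_normal_density t)"
      using le box_prob_bounds[of "t + h"] by (intro mult_left_mono) auto
    finally have 1: "?q ^ d - box_prob t ^ d \<le> real d * ?q ^ (d - 1) * (2 * h * std_normal_density t)" .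
    show ?thesis
    proof (cases "t \<ge> D")
      \<comment> \<open>Far out, the density at \<open>t\<close> is below
        \<open>exp (- (D\<^sup>2 / 2))\<close>, which cancels the factor \<open>d\<close>.\<close>
      case True
      have "D\<^sup>2 \<le> t\<^sup>2" using True D by (intro power_mono) auto
      then have "std_normal_density t \<le> exp (- (D\<^sup>2 / 2)) / sqrt (2 * pi)"
        by (simp add: std_normal_density_def divide_right_mono)
      also have "\<dots> \<le> exp (- (D\<^sup>2 / 2)) / 1"
        using pi_gt3 by (intro divide_left_mono) auto
      finally have "2 * h * std_normal_density t \<le> 2 * h * exp (- (D\<^sup>2 / 2))"
        using h by (intro mult_left_mono) auto
      moreover
      have "?q ^ (d - 1) \<le> 1" using box_prob_bounds by (intro power_le_one) auto
      then have "real d * ?q ^ (d - 1) \<le> exp (D\<^sup>2 / 2) * 1"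
        using D box_prob_bounds by (intro mult_mono) auto
      ultimately have "real d * ?q ^ (d - 1) * (2 * h * std_normal_density t) \<le> exp (D\<^sup>2 / 2) * 1 * (2 * h * exp (- (D\<^sup>2 / 2)))"
        using h by (intro mult_mono[of "real d * ?q ^ (d - 1)"]) auto
      also have "\<dots> = 2 * h * 1" by (simp add: exp_minus)
      also have "\<dots> \<le> 2 * h * D" using h D by (intro mult_left_mono) auto
      also have "\<dots> \<le> exp 4 * (h * D)" using h D exp_ge_add_one_self[of 4] mult_right_mono[of 2 "exp 4" "h * D"] by simp
      finally show ?thesis using 1 by (simp add: mult_ac)
    next
      case False
      \<comment> \<open>The tail beyond \<open>t + h\<close> is bounded below by a window of length
        \<open>1 / D\<close>. With \<open>t < D\<close> and \<open>h \<le> 1 / D\<close>, one has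
        \<open>t * u \<le> 2\<close> and \<open>u \<le> 2\<close>. The Gaussian exponent thus drops
        by at most 2 + 2 across the window, the origin of \<open>exp 4\<close>.\<close>
      define u where "u = h + 1 / D"
      have u: "0 \<le> u" "u \<le> 2 / D" using h D by (auto simp: u_def field_simps)
      have "t * u \<le> D * (2 / D)" using False t u D by (intro mult_mono) auto
      then have tu: "t * u \<le> 2" using D by simp
      have "2 / D \<le> 2" using D by (simp add: field_simps)
      then have "u \<le> 2" using u by linarith
      then have "u\<^sup>2 \<le> 2\<^sup>2" using u by (intro power_mono) auto
      then have "(t + u)\<^sup>2 / 2 \<le> t\<^sup>2 / 2 + 4"
        using tu by (simp add: power2_sum)
      then have "exp (- (t\<^sup>2 / 2 + 4)) \<le> exp (- ((t + u)\<^sup>2 / 2))" by simp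
      then have "exp (- 4) * std_normal_density t \<le> std_normal_density (t + u)"
        by (simp add: std_normal_density_def divide_right_mono mult.commute flip: exp_add)
      then have "1 / D * (exp (- 4) * std_normal_density t) \<le> 1 / D * std_normal_density (t + h + 1 / D)"
        using D by (intro mult_left_mono) (auto simp: u_def add_ac)
      also have "\<dots> \<le> measure std_normal_distribution {t + h<..t + h + 1 / D}"
        using t h D by (intro measure_std_normal_ge) auto
      also have "\<dots> = Phi (t + h + 1 / D) - Phi (t + h)"
        using D by (subst Phi_diff) auto
      also have "\<dots> \<le> 1 - Phi (t + h)"
        using prob_space.prob_le_1[OF prob_space_std_normal] by (simp add: Phi_def)
      also have "\<dots> = (1 - ?q) / 2"
        using t h by (simp add: box_prob_Phi field_simps)
      finally have "std_normal_density t * 2 \<le> exp 4 * D * (1 - ?q)"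
        using D by (simp add: exp_minus field_simps)
      then have "h * (std_normal_density t * 2) \<le> h * (exp 4 * D * (1 - ?q))"
        using h by (intro mult_left_mono) auto
      then have "real d * ?q ^ (d - 1) * (2 * h * std_normal_density t) \<le> real d * ?q ^ (d - 1) * (h * (exp 4 * D * (1 - ?q)))"
        using box_prob_bounds by (intro mult_left_mono) (auto simp: mult_ac)
      also have "\<dots> = exp 4 * h * D * (real d * ?q ^ (d - 1) * (1 - ?q))" by simp
      also have "\<dots> \<le> exp 4 * h * D * 1"
        using h D box_prob_bounds by (intro mult_left_mono power_times_compl_le) auto
      finally show ?thesis using 1 by simp
    qed
  qed
  show ?thesis
  proof (cases "t \<ge> 0")
    \<comment> \<open>For negative \<open>t\<close> the smaller cube has zero probability for
      positive \<open>d\<close>, and the larger one only grows when \<open>t\<close> is raised to 0.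
      For \<open>d = 0\<close> both powers are 1.\<close>
    case False
    then have "box_prob (t + h) ^ d - box_prob t ^ d \<le> box_prob (0 + h) ^ d - box_prob 0 ^ d"
      using box_prob_nonpos[of t] box_prob_nonpos[of 0] box_prob_mono[of "t + h" "0 + h"] box_prob_bounds[of "t + h"]
      by (auto intro!: power_mono)
    also have "\<dots> \<le> exp 4 * h * D" by (rule main) simp
    finally show ?thesis .
  qed (rule main)
qed

section \<open>The critical value as a quantile of the Gaussian maximum\<close>

lemma Phi_eq_cdf: "Phi = cdf std_normal_distribution"
  by (simp add: fun_eq_iff Phi_def cdf_def)

lemma Phi_strict_mono: "x < y \<Longrightarrow> Phi x < Phi y"
proof -
  have pos: "Phi x < Phi y" if "0 \<le> x" "x < y" for x y
  proof -
    have "0 < (y - x) * std_normal_density (x + (y - x))"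
      using that by (intro mult_pos_pos normal_density_pos) auto
    also have "\<dots> \<le> measure std_normal_distribution {x<..x + (y - x)}"
      using that by (intro measure_std_normal_ge) auto
    also have "\<dots> = Phi y - Phi x" using that by (subst Phi_diff) auto
    finally show ?thesis by simp
  qed
  assume xy: "x < y"
  consider "0 \<le> x" | "y \<le> 0" | "x < 0" "0 < y" by linarith
  then show "Phi x < Phi y"
  proof cases
    case 2
    then have "Phi (- y) < Phi (- x)" using xy by (intro pos) auto
    then show ?thesis by (simp add: Phi_uminus)
  next
    case 3
    then have "Phi 0 < Phi (- x)" "Phi 0 < Phi y" by (auto intro!: pos)
    then show ?thesis using Phi_uminus[of 0] by (simp add: Phi_uminus)
  qed (use xy pos in auto)
qed

lemma Phi_surj:
  assumes "0 < p" "p < 1"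
  shows "\<exists>x. Phi x = p"
proof -
  interpret N: real_distribution std_normal_distribution
    using prob_space_std_normal by (intro real_distribution.intro real_distribution_axioms.intro) auto
  have "eventually (\<lambda>x. Phi x < p) at_bot" "eventually (\<lambda>x. p < Phi x) at_top"
    unfolding Phi_eq_cdf using N.cdf_lim_at_bot N.cdf_lim_at_top_prob assms by (auto intro: order_tendstoD)
  then obtain a b where ab: "Phi a < p" "p < Phi b"
    by (metis eventually_at_bot_linorder eventually_at_top_linorder order_refl)
  have "a \<le> b" using ab Phi_strict_mono[of b a] by linarith
  moreover have "isCont Phi x" for x
    unfolding Phi_eq_cdf N.isCont_cdf by (rule measure_std_normal_singleton)
  ultimately show ?thesis
    using IVT[of Phi a p b] ab by auto
qed

text \<open>The argument of \<open>Phi_inv\<close> lies strictly between 1/2 and 1. So the quantile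
  exists, is unique and nonnegative, and \<open>2 * Phi t - 1\<close> at this point is the
  \<open>d\<close>-th root of \<open>1 - \<alpha>\<close>. Independence of the coordinates turns the
  \<open>d\<close>-th power into the law of the maximum.\<close>

lemma box_prob_c_alpha:
  assumes "0 < \<alpha>" "\<alpha> < 1" "d \<ge> 1"
  shows "box_prob (c_alpha \<alpha> d) ^ d = 1 - \<alpha>"
proof -
  define r where "r = (1 - \<alpha>) powr (1 / real d)"
  have r: "0 < r" "r < 1"
    using assms powr_less_mono2[of "1 / real d" "1 - \<alpha>" 1] by (auto simp: r_def)
  obtain x where x: "Phi x = 1/2 + r/2"
    using Phi_surj[of "1/2 + r/2"] r by auto
  have "c_alpha \<alpha> d = x"
    unfolding c_alpha_def Phi_inv_def r_def[symmetric]
    by (rule the_equality[of _ x]) (use x Phi_strict_mono in \<open>metis linorder_less_linear order_less_irrefl\<close>)+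
  moreover have "x \<ge> 0"
  proof (rule ccontr)
    assume "\<not> x \<ge> 0"
    then have "Phi x < Phi 0" by (intro Phi_strict_mono) auto
    then show False using x r Phi_uminus[of 0] by simp
  qed
  ultimately have "box_prob (c_alpha \<alpha> d) = r"
    using x by (simp add: box_prob_Phi)
  then show ?thesis
    using assms by (simp add: r_def flip: powr_realpow' powr_realpow) (simp add: powr_powr)
qed

section \<open>Normal approximation on cubes\<close>

text \<open>The event is strict so that its failure provides a coordinate with
  \<open>\<bar>W \<omega> k\<bar> \<ge> t + h\<close>, the situation of \<open>soft_box_le\<close>.
  The closed event in the companion estimate below matches \<open>soft_box_ge\<close> in the same
  way.\<close>

lemma (in prob_space) soft_box_expectation_le:
  assumes fin: "finite I" and meas [measurable]: "\<And>k. k \<in> I \<Longrightarrow> (\<lambda>\<omega>. W \<omega> k) \<in> borel_measurable M"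
    and \<beta>: "\<beta> > 0"
  shows "expectation (\<lambda>\<omega>. soft_box I \<beta> (2 * exp (- \<beta> * t)) (W \<omega>))
    \<le> prob {\<omega> \<in> space M. \<forall>k\<in>I. \<bar>W \<omega> k\<bar> < t + h} + exp (- \<beta> * h)"
proof -
  let ?E = "{\<omega> \<in> space M. \<forall>k\<in>I. \<bar>W \<omega> k\<bar> < t + h}"
  have [measurable]: "?E \<in> events" using fin by measurable
  have ii: "integrable M (indicator ?E :: _ \<Rightarrow> real)"
    by (intro integrable_real_indicator) (auto simp: emeasure_eq_measure)
  have int: "integrable M (\<lambda>\<omega>. indicator ?E \<omega> + exp (- \<beta> * h))"
    using ii by simp
  have "expectation (\<lambda>\<omega>. soft_box I \<beta> (2 * exp (- \<beta> * t)) (W \<omega>)) \<le> expectation (\<lambda>\<omega>. indicator ?E \<omega> + exp (- \<beta> * h))"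
  proof (intro integral_mono integrable_soft_box int meas)
    fix \<omega> assume \<omega>: "\<omega> \<in> space M"
    show "soft_box I \<beta> (2 * exp (- \<beta> * t)) (W \<omega>) \<le> indicator ?E \<omega> + exp (- \<beta> * h)"
    proof (cases "\<omega> \<in> ?E")
      case True
      then show ?thesis
        using soft_box_le_1[of "2 * exp (- \<beta> * t)" I \<beta> "W \<omega>"]
        by (simp add: add_increasing2)
    next
      case False
      then obtain k where "k \<in> I" "\<bar>W \<omega> k\<bar> \<ge> t + h" using \<omega> by force
      then show ?thesis using soft_box_le[OF fin _ \<beta>] False by auto
    qed
  qed auto
  then show ?thesis using ii by (simp add: prob_space)
qed

lemma (in prob_space) soft_box_expectation_ge:
  assumes fin: "finite I" and meas [measurable]: "\<And>k. k \<in> I \<Longrightarrow> (\<lambda>\<omega>. W \<omega> k) \<in> borel_measurable M"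
    and \<beta>: "\<beta> > 0"
  shows "prob {\<omega> \<in> space M. \<forall>k\<in>I. \<bar>W \<omega> k\<bar> \<le> t - h}
    \<le> expectation (\<lambda>\<omega>. soft_box I \<beta> (2 * exp (- \<beta> * t)) (W \<omega>)) + 2 * real (card I) * exp (- \<beta> * h)"
proof -
  let ?E = "{\<omega> \<in> space M. \<forall>k\<in>I. \<bar>W \<omega> k\<bar> \<le> t - h}"
  have [measurable]: "?E \<in> events" using fin by measurable
  have int: "integrable M (\<lambda>\<omega>. soft_box I \<beta> (2 * exp (- \<beta> * t)) (W \<omega>))"
    by (intro integrable_soft_box meas) auto
  have "expectation (\<lambda>\<omega>. indicator ?E \<omega>) \<le> expectation (\<lambda>\<omega>. soft_box I \<beta> (2 * exp (- \<beta> * t)) (W \<omega>) + 2 * real (card I) * exp (- \<beta> * h))"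
  proof (intro integral_mono Bochner_Integration.integrable_add int integrable_real_indicator)
    fix \<omega> assume \<omega>: "\<omega> \<in> space M"
    show "indicator ?E \<omega> \<le> soft_box I \<beta> (2 * exp (- \<beta> * t)) (W \<omega>) + 2 * real (card I) * exp (- \<beta> * h)"
    proof (cases "\<omega> \<in> ?E")
      case True
      then show ?thesis using soft_box_ge[OF \<beta>, of I "W \<omega>" t h] by simp
    next
      case False
      have "0 \<le> soft_box I \<beta> (2 * exp (- \<beta> * t)) (W \<omega>)" by (rule soft_box_nonneg) simp
      then show ?thesis using False by simp
    qed
  qed (auto simp: emeasure_eq_measure)
  then show ?thesis using int by (simp add: prob_space)
qed

text \<open>The soft box is centred at \<open>t + h\<close> for the upper bound and at
  \<open>t - h\<close> for the lower one. Entering and leaving the smooth function each costs one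
  \<open>h\<close>, so the Gaussian cube is shifted by \<open>2 * h\<close>.\<close>

lemma normalized_sum_box_bounds:
  fixes I :: "'i set" and \<psi> :: "'i \<Rightarrow> 'a \<Rightarrow> real" and S :: "'s set" and t h :: real
  assumes fin: "finite I" and \<beta>: "\<beta> > 0" and A: "A > 0" and B: "B \<ge> 0"
    and prob: "prob_space \<mu>"
    and meas [measurable]: "\<And>k. k \<in> I \<Longrightarrow> \<psi> k \<in> borel_measurable \<mu>"
    and bound: "\<And>k u. k \<in> I \<Longrightarrow> u \<in> space \<mu> \<Longrightarrow> \<bar>\<psi> k u\<bar> \<le> B"
    and mean: "\<And>k. k \<in> I \<Longrightarrow> (\<integral>u. \<psi> k u \<partial>\<mu>) = 0"
    and cov: "\<And>k l. k \<in> I \<Longrightarrow> l \<in> I \<Longrightarrow> (\<integral>u. \<psi> k u * \<psi> l u \<partial>\<mu>) = (if k = l then 1 else 0)"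
    and S: "finite S" and b: "\<And>s. s \<in> S \<Longrightarrow> b s \<noteq> 0" "(\<Sum>s\<in>S. (b s)\<^sup>2) = 1"
  defines "W \<equiv> \<lambda>\<omega> k. \<Sum>s\<in>S. b s * \<psi> k (\<omega> s)"
    and "P \<equiv> Pi\<^sub>M S (\<lambda>_. \<mu>)"
    and "err \<equiv> (\<Sum>s\<in>S. lindeberg_err (card I) \<beta> B A (b s)) + (2 * real (card I) + 1) * exp (- \<beta> * h)"
  shows "measure P {\<omega> \<in> space P. \<forall>k\<in>I. \<bar>W \<omega> k\<bar> \<le> t} \<le> box_prob (t + 2 * h) ^ card I + err"
    and "box_prob (t - 2 * h) ^ card I - err \<le> measure P {\<omega> \<in> space P. \<forall>k\<in>I. \<bar>W \<omega> k\<bar> < t}"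
proof -
  interpret P: prob_space P unfolding P_def by (intro prob_space_PiM prob)
  interpret G: prob_space "gauss I" by (rule prob_space_gauss)
  have W: "(\<lambda>\<omega>. W \<omega> k) \<in> borel_measurable P" if "k \<in> I" for k
    using that unfolding W_def P_def by measurable
  have Z: "(\<lambda>z. z k) \<in> borel_measurable (gauss I)" if "k \<in> I" for k
    using that by measurable
  let ?c = "\<lambda>t. 2 * exp (- \<beta> * t)"
  have clt: "\<bar>P.expectation (\<lambda>\<omega>. soft_box I \<beta> (?c t) (W \<omega>)) - G.expectation (\<lambda>z. soft_box I \<beta> (?c t) z)\<bar>
      \<le> (\<Sum>s\<in>S. lindeberg_err (card I) \<beta> B A (b s))" for t
    using lindeberg_sum[where b = b and c = "?c t" and w = "\<lambda>_. 0", OF fin \<beta> _ A B prob meas bound mean cov S b(1)] b(2)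
    by (simp add: W_def P_def)
  have "measure P {\<omega> \<in> space P. \<forall>k\<in>I. \<bar>W \<omega> k\<bar> \<le> (t + h) - h}
      \<le> P.expectation (\<lambda>\<omega>. soft_box I \<beta> (?c (t + h)) (W \<omega>)) + 2 * real (card I) * exp (- \<beta> * h)"
    by (rule P.soft_box_expectation_ge[OF fin W \<beta>])
  also have "G.expectation (\<lambda>z. soft_box I \<beta> (?c (t + h)) z)
      \<le> measure (gauss I) {z \<in> space (gauss I). \<forall>k\<in>I. \<bar>z k\<bar> < (t + h) + h} + exp (- \<beta> * h)"
    by (rule G.soft_box_expectation_le[OF fin Z \<beta>])
  moreover have "measure (gauss I) {z \<in> space (gauss I). \<forall>k\<in>I. \<bar>z k\<bar> < (t + h) + h}
      \<le> measure (gauss I) {z \<in> space (gauss I). \<forall>k\<in>I. \<bar>z k\<bar> \<le> t + 2 * h}"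
    using fin by (intro G.finite_measure_mono) (auto intro!: sets.sets_Collect_finite_All borel_measurable_le)
  ultimately show "measure P {\<omega> \<in> space P. \<forall>k\<in>I. \<bar>W \<omega> k\<bar> \<le> t} \<le> box_prob (t + 2 * h) ^ card I + err"
    using clt[of "t + h"] unfolding measure_gauss_box[OF fin] err_def by (simp add: algebra_simps)
  have "measure (gauss I) {z \<in> space (gauss I). \<forall>k\<in>I. \<bar>z k\<bar> \<le> (t - h) - h}
      \<le> G.expectation (\<lambda>z. soft_box I \<beta> (?c (t - h)) z) + 2 * real (card I) * exp (- \<beta> * h)"
    by (rule G.soft_box_expectation_ge[OF fin Z \<beta>])
  moreover have "P.expectation (\<lambda>\<omega>. soft_box I \<beta> (?c (t - h)) (W \<omega>))
      \<le> measure P {\<omega> \<in> space P. \<forall>k\<in>I. \<bar>W \<omega> k\<bar> < (t - h) + h} + exp (- \<beta> * h)"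
    by (rule P.soft_box_expectation_le[OF fin W \<beta>])
  ultimately show "box_prob (t - 2 * h) ^ card I - err \<le> measure P {\<omega> \<in> space P. \<forall>k\<in>I. \<bar>W \<omega> k\<bar> < t}"
    using clt[of "t - h"] unfolding measure_gauss_box[OF fin] err_def by (simp add: algebra_simps)
qed

section \<open>Uniform samples\<close>

text \<open>The open interval is the domain on which the quantile function is finite and, for a
  continuous law, reflects the order.\<close>

abbreviation unif :: "real measure" where
  "unif \<equiv> restrict_space lborel {0<..<1}"

abbreviation unifs :: "'s set \<Rightarrow> ('s \<Rightarrow> real) measure" where
  "unifs S \<equiv> Pi\<^sub>M S (\<lambda>_. unif)"

lemma prob_space_unif: "prob_space unif"
  by (auto simp: emeasure_restrict_space space_restrict_space intro!: prob_spaceI)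

lemma space_unif: "space unif = {0<..<1}"
  by (simp add: space_restrict_space)

lemma sets_unif: "sets unif = sets (restrict_space borel {0<..<1})"
  by (intro sets_restrict_space_cong) simp

lemma borel_measurable_unif_ident: "(\<lambda>x. x) \<in> borel_measurable unif"
  by (intro measurable_restrict_space1) simp

lemma borel_measurable_unif_continuous:
  fixes f :: "real \<Rightarrow> real"
  assumes "continuous_on {0..1} f"
  shows "f \<in> borel_measurable unif"
proof -
  have "continuous_on {0<..<1} f"
    using assms by (rule continuous_on_subset) auto
  then have "f \<in> borel_measurable (restrict_space borel {0<..<1})"
    by (rule borel_measurable_continuous_on_restrict)
  then show ?thesis
    using measurable_cong_sets[OF sets_unif refl] by blast
qed

lemma borel_measurable_of_bool_le:
  fixes f g :: "'a \<Rightarrow> real"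
  assumes [measurable]: "f \<in> borel_measurable M" "g \<in> borel_measurable M"
  shows "(\<lambda>x. of_bool (f x \<le> g x) :: real) \<in> borel_measurable M"
  by measurable

lemma borel_measurable_PiM_unif_component:
  "i \<in> I \<Longrightarrow> (\<lambda>\<omega>. \<omega> i) \<in> borel_measurable (unifs I)"
  using measurable_compose[OF measurable_component_singleton[of i I "\<lambda>_. unif"] borel_measurable_unif_ident] by simp

lemma integrable_unif:
  fixes f :: "real \<Rightarrow> real"
  assumes "f \<in> borel_measurable unif" "\<And>x. 0 < x \<Longrightarrow> x < 1 \<Longrightarrow> \<bar>f x\<bar> \<le> B"
  shows "integrable unif f"
proof -
  interpret prob_space unif by (rule prob_space_unif)
  show ?thesis
    using assms by (intro integrable_const_bound[where B=B]) (auto simp: space_unif)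
qed

lemma integral_unif:
  fixes f :: "real \<Rightarrow> real"
  assumes "f \<in> borel_measurable unif" "\<And>x. 0 < x \<Longrightarrow> x < 1 \<Longrightarrow> \<bar>f x\<bar> \<le> B"
  shows "integral\<^sup>L unif f = integral {0..1} f"
proof -
  have "integrable unif f"
    using assms by (rule integrable_unif)
  then have "set_integrable lborel {0<..<1} f"
    unfolding set_integrable_def
    by (subst (asm) integrable_restrict_space) auto
  then have "(LINT x:{0<..<1}|lborel. f x) = integral {0<..<1} f"
    by (rule set_borel_integral_eq_integral)
  then show ?thesis
    unfolding integral_open_interval_real set_lebesgue_integral_def
    by (subst integral_restrict_space) auto
qed

lemma bounded_continuous_01:
  fixes f :: "real \<Rightarrow> real"
  assumes "continuous_on {0..1} f"
  obtains B where "\<And>x. x \<in> {0..1} \<Longrightarrow> \<bar>f x\<bar> \<le> B"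
proof -
  have "bounded (f ` {0..1})"
    using assms by (intro compact_imp_bounded compact_continuous_image) auto
  then obtain B where "\<forall>x\<in>{0..1}. \<bar>f x\<bar> \<le> B" by (auto simp: bounded_iff)
  then show thesis using that by blast
qed

lemma integral_unif_continuous:
  fixes f :: "real \<Rightarrow> real"
  assumes "continuous_on {0..1} f"
  shows "integral\<^sup>L unif f = integral {0..1} f"
proof -
  obtain B where "\<And>x. x \<in> {0..1} \<Longrightarrow> \<bar>f x\<bar> \<le> B"
    using bounded_continuous_01[OF assms] by blast
  then show ?thesis
    by (intro integral_unif[where B=B] borel_measurable_unif_continuous assms) auto
qed

text \<open>The projection of the two-sample statistic onto the first sample: integration by parts
  returns \<open>\<psi>\<close> itself.\<close>

lemma integral_unif_kernel:
  fixes \<psi> \<psi>' :: "real \<Rightarrow> real"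
  assumes d: "\<And>z. z \<in> {0..1} \<Longrightarrow> (\<psi> has_real_derivative \<psi>' z) (at z within {0..1})"
    and cont: "continuous_on {0..1} \<psi>'"
    and mean: "integral {0..1} \<psi> = 0"
    and u: "0 < u" "u < 1"
  shows "integrable unif (\<lambda>v. \<psi>' v * (of_bool (u \<le> v) - v))"
    and "(\<integral>v. \<psi>' v * (of_bool (u \<le> v) - v) \<partial>unif) = - \<psi> u"
proof -
  let ?g = "\<lambda>v. \<psi>' v * (of_bool (u \<le> v) - v)"
  obtain B where B: "\<And>x. x \<in> {0..1} \<Longrightarrow> \<bar>\<psi>' x\<bar> \<le> B"
    using bounded_continuous_01[OF cont] by blast
  have \<psi>'_meas: "\<psi>' \<in> borel_measurable unif"
    by (rule borel_measurable_unif_continuous[OF cont])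
  have meas: "?g \<in> borel_measurable unif"
    by (intro borel_measurable_times borel_measurable_diff borel_measurable_of_bool_le \<psi>'_meas
        borel_measurable_unif_ident borel_measurable_const)
  have bd: "\<bar>?g v\<bar> \<le> B" if "0 < v" "v < 1" for v
  proof -
    have "\<bar>of_bool (u \<le> v) - v\<bar> \<le> 1"
      using that by (cases "u \<le> v") auto
    then have "\<bar>\<psi>' v\<bar> * \<bar>of_bool (u \<le> v) - v\<bar> \<le> \<bar>\<psi>' v\<bar> * 1"
      by (rule mult_left_mono) simp
    then show ?thesis using B[of v] that by (simp add: abs_mult)
  qed
  show "integrable unif ?g" using meas bd by (rule integrable_unif)
  have "(\<psi>' has_integral (\<psi> 1 - \<psi> u)) {u..1}"
  proof (rule fundamental_theorem_of_calculus)
    fix x assume "x \<in> {u..1}"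
    then have "(\<psi> has_real_derivative \<psi>' x) (at x within {u..1})"
      using u by (intro DERIV_subset[OF d[of x]]) auto
    then show "(\<psi> has_vector_derivative \<psi>' x) (at x within {u..1})"
      by (simp add: has_real_derivative_iff_has_vector_derivative)
  qed (use u in auto)
  then have 1: "((\<lambda>v. if v \<in> {u..1} then \<psi>' v else 0) has_integral (\<psi> 1 - \<psi> u)) {0..1}"
    using u by (subst has_integral_restrict) auto
  have c\<psi>: "continuous_on {0..1} \<psi>"
    using d by (meson DERIV_continuous_on)
  \<comment> \<open>Integration by parts in the form of the antiderivative
    \<open>v * \<psi> v\<close>. The mean-zero condition removes the integral of \<psi>, and the
    boundary value \<open>\<psi> 1\<close> cancels against the one from
    \<open>{u..1}\<close>.\<close>
  have "((\<lambda>v. \<psi> v + v * \<psi>' v) has_integral (1 * \<psi> 1 - 0 * \<psi> 0)) {0..1}"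
  proof (rule fundamental_theorem_of_calculus)
    fix x :: real assume "x \<in> {0..1}"
    then have "((\<lambda>v. v * \<psi> v) has_real_derivative \<psi> x + x * \<psi>' x) (at x within {0..1})"
      by (auto intro!: derivative_eq_intros d)
    then show "((\<lambda>v. v * \<psi> v) has_vector_derivative \<psi> x + x * \<psi>' x) (at x within {0..1})"
      by (simp add: has_real_derivative_iff_has_vector_derivative)
  qed simp
  moreover have "(\<psi> has_integral 0) {0..1}"
    using integrable_integral[OF integrable_continuous_real[OF c\<psi>]] mean by simp
  ultimately have 2: "((\<lambda>v. (\<psi> v + v * \<psi>' v) - \<psi> v) has_integral ((1 * \<psi> 1 - 0 * \<psi> 0) - 0)) {0..1}"
    by (rule has_integral_diff)
  have "(?g has_integral ((\<psi> 1 - \<psi> u) - ((1 * \<psi> 1 - 0 * \<psi> 0) - 0))) {0..1}"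
    by (rule has_integral_eq[OF _ has_integral_diff[OF 1 2]]) (auto simp: algebra_simps)
  then have "integral {0..1} ?g = - \<psi> u"
    by (simp add: integral_unique)
  then show "(\<integral>v. ?g v \<partial>unif) = - \<psi> u"
    using integral_unif[OF meas bd] by simp
qed

lemma integral_unif_indicator:
  assumes "v \<in> {0..1}"
  shows "(\<integral>u. of_bool (u \<le> v) - v \<partial>unif) = 0"
proof -
  have meas: "(\<lambda>u. of_bool (u \<le> v) - v) \<in> borel_measurable unif"
    by (intro borel_measurable_diff borel_measurable_of_bool_le borel_measurable_unif_ident borel_measurable_const)
  have "((\<lambda>u. 1::real) has_integral v) {0..v}"
    using assms has_integral_const_real[of "1::real" 0 v] by simp
  then have 1: "((\<lambda>u. if u \<in> {0..v} then 1 else 0) has_integral v) {0..1}"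
    using assms by (subst has_integral_restrict) auto
  have 2: "((\<lambda>u::real. v) has_integral v) {0..1::real}"
    using has_integral_const_real[of v 0 1] by simp
  have "((\<lambda>u. of_bool (u \<le> v) - v) has_integral (v - v)) {0..1}"
    by (rule has_integral_eq[OF _ has_integral_diff[OF 1 2]]) auto
  then have "integral {0..1} (\<lambda>u. of_bool (u \<le> v) - v) = 0"
    by (simp add: integral_unique)
  then show ?thesis
    using integral_unif[OF meas, where B = 1] assms by auto
qed

lemma (in prob_space) PiM_Hoeffding:
  fixes g :: "'a \<Rightarrow> real"
  assumes J: "finite J" "J \<noteq> {}" and [measurable]: "g \<in> borel_measurable M"
    and K: "K > 0" "\<And>x. x \<in> space M \<Longrightarrow> \<bar>g x\<bar> \<le> K"
    and mean: "expectation g = 0" and r: "r \<ge> 0"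
  shows "measure (Pi\<^sub>M J (\<lambda>_. M)) {\<omega> \<in> space (Pi\<^sub>M J (\<lambda>_. M)). r \<le> \<bar>\<Sum>j\<in>J. g (\<omega> j)\<bar>}
    \<le> 2 * exp (- (r\<^sup>2 / (2 * real (card J) * K\<^sup>2)))"
proof -
  interpret P: product_prob_space "\<lambda>_. M" J
    by (intro product_prob_spaceI prob_space_axioms)
  interpret H: Hoeffding_ineq "Pi\<^sub>M J (\<lambda>_. M)" J "\<lambda>j \<omega>. g (\<omega> j)" "\<lambda>_. - K" "\<lambda>_. K" 0
  proof unfold_locales
    show "P.indep_vars (\<lambda>_. borel) (\<lambda>j \<omega>. g (\<omega> j)) J"
      using P.indep_vars_compose2[OF indep_vars_PiM_components[OF J(2)], of "\<lambda>_. g" "\<lambda>_. borel"] by simp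
    show "AE x in Pi\<^sub>M J (\<lambda>_. M). g (x i) \<in> {- K..K}" if "i \<in> J" for i
    proof (intro AE_I2)
      fix x assume "x \<in> space (Pi\<^sub>M J (\<lambda>_. M))"
      then have "\<bar>g (x i)\<bar> \<le> K" using that by (intro K(2)) (auto simp: space_PiM)
      then show "g (x i) \<in> {- K..K}" by auto
    qed
    show "0 \<equiv> \<Sum>i\<in>J. P.expectation (\<lambda>\<omega>. g (\<omega> i))"
      using mean by (simp add: integral_PiM_component)
  qed (use J in auto)
  have pos: "(\<Sum>i\<in>J. (K - - K)\<^sup>2) > 0"
    using J K by (simp add: card_gt_0_iff)
  have "- 2 * r\<^sup>2 / (\<Sum>i\<in>J. (K - - K)\<^sup>2) = - (r\<^sup>2 / (2 * real (card J) * K\<^sup>2))"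
    using J K by (simp add: power2_eq_square field_simps)
  then show ?thesis
    using H.Hoeffding_ineq_abs_ge[OF r pos] by (simp add: mult.assoc)
qed

section \<open>The degenerate remainder\<close>

text \<open>An arbitrary index set lets both samples be coordinates of one point of a product space,
  and a sum of indicators keeps the dependence on the observations additive.\<close>

definition ecdf :: "'s set \<Rightarrow> ('s \<Rightarrow> real) \<Rightarrow> real \<Rightarrow> real" where
  "ecdf I x v = (\<Sum>i\<in>I. of_bool (x i \<le> v)) / real (card I)"

lemma ecdf_mono: "v \<le> w \<Longrightarrow> ecdf I x v \<le> ecdf I x w"
  unfolding ecdf_def by (intro divide_right_mono sum_mono) auto

lemma ecdf_bounds: "0 \<le> ecdf I x v" "ecdf I x v \<le> 1"
proof -
  show "0 \<le> ecdf I x v" unfolding ecdf_def by (intro divide_nonneg_nonneg sum_nonneg) auto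
  have "(\<Sum>i\<in>I. of_bool (x i \<le> v)) \<le> (\<Sum>i\<in>I. 1 :: real)" by (intro sum_mono) auto
  then show "ecdf I x v \<le> 1" unfolding ecdf_def by (simp add: divide_le_eq)
qed

lemma ecdf_diff:
  assumes "finite I" "I \<noteq> {}"
  shows "ecdf I x v - v = (\<Sum>i\<in>I. of_bool (x i \<le> v) - v) / real (card I)"
  using assms by (simp add: ecdf_def sum_subtractf diff_divide_distrib)

lemma ecdf_cong: "(\<And>i. i \<in> I \<Longrightarrow> x i = y i) \<Longrightarrow> ecdf I x v = ecdf I y v"
  unfolding ecdf_def by simp

text \<open>Monotonicity of both functions between neighbouring grid points costs one mesh width. A
  union bound over \<open>n + 1\<close> points thus controls the supremum of the
  discrepancy.\<close>

lemma ecdf_grid: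
  assumes I: "finite I" "I \<noteq> {}"
    and grid: "\<And>j. j \<le> card I \<Longrightarrow> \<bar>ecdf I x (real j / real (card I)) - real j / real (card I)\<bar> \<le> \<eta>"
    and v: "0 \<le> v" "v \<le> 1"
  shows "\<bar>ecdf I x v - v\<bar> \<le> \<eta> + 1 / real (card I)"
proof -
  define n where "n = card I"
  have n: "n > 0" using I by (simp add: n_def card_gt_0_iff)
  \<comment> \<open>The grid points just above and just below \<open>v\<close> serve the upper and
    the lower bound respectively.\<close>
  define j where "j = nat \<lceil>real n * v\<rceil>"
  define l where "l = nat \<lfloor>real n * v\<rfloor>"
  have nv: "0 \<le> real n * v" "real n * v \<le> real n" using v n by (auto simp: mult_left_le)
  have j: "real n * v \<le> real j" "real j \<le> real n * v + 1" "j \<le> n"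
    using nv unfolding j_def by (auto simp: nat_le_iff ceiling_le_iff)
  have l: "real l \<le> real n * v" "real n * v \<le> real l + 1" "l \<le> n"
    using nv unfolding l_def by (auto simp: nat_le_iff) linarith+
  have "ecdf I x v \<le> ecdf I x (real j / n)"
    using j n by (intro ecdf_mono) (simp add: field_simps)
  also have "\<dots> \<le> real j / n + \<eta>" using grid[of j] j by (simp add: n_def abs_le_iff)
  also have "real j / n \<le> v + 1 / n" using j n by (simp add: field_simps)
  finally have 1: "ecdf I x v - v \<le> \<eta> + 1 / n" by simp
  have "v \<le> (real l + 1) / n" using l n by (simp add: pos_le_divide_eq mult.commute)
  then have "v - 1 / n \<le> real l / n" by (simp add: add_divide_distrib)
  also have "real l / n \<le> ecdf I x (real l / n) + \<eta>" using grid[of l] l by (simp add: n_def abs_le_iff)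
  also have "ecdf I x (real l / n) \<le> ecdf I x v"
    using l n by (intro ecdf_mono) (simp add: field_simps)
  finally show ?thesis using 1 by (simp add: n_def abs_le_iff)
qed

lemma borel_measurable_ecdf:
  assumes "\<And>i. i \<in> I \<Longrightarrow> (\<lambda>\<omega>. x \<omega> i) \<in> borel_measurable M" "v \<in> borel_measurable M"
  shows "(\<lambda>\<omega>. ecdf I (x \<omega>) (v \<omega>)) \<in> borel_measurable M"
  unfolding ecdf_def
  by (intro borel_measurable_divide borel_measurable_sum borel_measurable_of_bool_le borel_measurable_const assms)

lemma ecdf_grid_prob:
  assumes I: "finite I" "I \<noteq> {}" and \<eta>: "\<eta> \<ge> 0"
  defines "P \<equiv> unifs I" and "n \<equiv> card I"
  shows "measure P {x \<in> space P. \<exists>j\<in>{0..n}. \<eta> \<le> \<bar>ecdf I x (real j / n) - real j / n\<bar>}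
    \<le> 2 * (real n + 1) * exp (- (real n * \<eta>\<^sup>2 / 2))"
proof -
  interpret U: prob_space unif by (rule prob_space_unif)
  interpret P: prob_space P unfolding P_def by (intro prob_space_PiM prob_space_unif)
  have n: "n > 0" using I by (simp add: n_def card_gt_0_iff)
  let ?E = "\<lambda>j. {x \<in> space P. \<eta> \<le> \<bar>ecdf I x (real j / n) - real j / n\<bar>}"
  have meas: "?E j \<in> sets P" for j
  proof -
    have "(\<lambda>x. ecdf I x (real j / n)) \<in> borel_measurable P"
      unfolding P_def by (intro borel_measurable_ecdf borel_measurable_PiM_unif_component borel_measurable_const)
    then show ?thesis by measurable
  qed
  have bd: "measure P (?E j) \<le> 2 * exp (- (real n * \<eta>\<^sup>2 / 2))" if j: "j \<le> n" for j
  proof -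
    let ?v = "real j / real n"
    have v: "?v \<in> {0..1}" using j n by (simp add: field_simps)
    have "?E j = {x \<in> space P. real n * \<eta> \<le> \<bar>\<Sum>i\<in>I. of_bool (x i \<le> ?v) - ?v\<bar>}"
      using n unfolding ecdf_diff[OF I] n_def[symmetric] by (simp add: field_simps)
    also have "measure P \<dots> \<le> 2 * exp (- ((real n * \<eta>)\<^sup>2 / (2 * real n * 1\<^sup>2)))"
      unfolding P_def n_def
    proof (rule U.PiM_Hoeffding[OF I, where K = 1])
      show "(\<lambda>u. of_bool (u \<le> real j / real (card I)) - real j / real (card I)) \<in> borel_measurable unif"
        by (intro borel_measurable_diff borel_measurable_of_bool_le borel_measurable_unif_ident borel_measurable_const)
      show "\<bar>of_bool (u \<le> real j / real (card I)) - real j / real (card I)\<bar> \<le> 1" for u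
        using v unfolding n_def by (cases "u \<le> real j / real (card I)") auto
      show "U.expectation (\<lambda>u. of_bool (u \<le> real j / real (card I)) - real j / real (card I)) = 0"
        using v unfolding n_def by (rule integral_unif_indicator)
    qed (use \<eta> in auto)
    also have "(real n * \<eta>)\<^sup>2 / (2 * real n * 1\<^sup>2) = real n * \<eta>\<^sup>2 / 2"
      using n by (simp add: power2_eq_square)
    finally show ?thesis .
  qed
  have "{x \<in> space P. \<exists>j\<in>{0..n}. \<eta> \<le> \<bar>ecdf I x (real j / n) - real j / n\<bar>} = (\<Union>j\<in>{0..n}. ?E j)"
    by auto
  also have "measure P \<dots> \<le> (\<Sum>j\<in>{0..n}. measure P (?E j))"
    using meas by (intro P.finite_measure_subadditive_finite) auto
  also have "\<dots> \<le> (\<Sum>j\<in>{0..n}. 2 * exp (- (real n * \<eta>\<^sup>2 / 2)))"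
    using bd by (intro sum_mono) auto
  also have "\<dots> = 2 * (real n + 1) * exp (- (real n * \<eta>\<^sup>2 / 2))"
    by (simp add: algebra_simps)
  finally show ?thesis .
qed

text \<open>Conditionally on the first sample the degenerate remainder is a sum of independent centred
  variables bounded by a multiple of the discrepancy of that sample.\<close>

lemma degenerate_remainder_prob:
  fixes \<psi> \<psi>' :: "'k \<Rightarrow> real \<Rightarrow> real" and I J :: "'s set"
  assumes I: "finite I" "I \<noteq> {}" and J: "finite J" "J \<noteq> {}" and IJ: "I \<inter> J = {}" and K: "finite K"
    and d: "\<And>k z. k \<in> K \<Longrightarrow> z \<in> {0..1} \<Longrightarrow> (\<psi> k has_real_derivative \<psi>' k z) (at z within {0..1})"
    and cont: "\<And>k. k \<in> K \<Longrightarrow> continuous_on {0..1} (\<psi>' k)"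
    and mean: "\<And>k. k \<in> K \<Longrightarrow> integral {0..1} (\<psi> k) = 0"
    and B: "\<And>k z. k \<in> K \<Longrightarrow> z \<in> {0..1} \<Longrightarrow> \<bar>\<psi>' k z\<bar> \<le> B" "B > 0"
    and \<eta>: "\<eta> > 0" and r: "r \<ge> 0"
  defines "n \<equiv> real (card I)" and "m \<equiv> real (card J)"
  defines "rem \<equiv> \<lambda>k x. (\<Sum>j\<in>J. \<psi>' k (x j) * (ecdf I x (x j) - x j) + (\<Sum>i\<in>I. \<psi> k (x i)) / n) / m"
    and "P \<equiv> unifs (I \<union> J)"
  shows "measure P {x \<in> space P. \<exists>k\<in>K. r \<le> \<bar>rem k x\<bar>}
    \<le> 2 * (n + 1) * exp (- (n * \<eta>\<^sup>2 / 2)) + 2 * real (card K) * exp (- (m * r\<^sup>2 / (2 * (2 * B * (\<eta> + 1 / n))\<^sup>2)))"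
    (is ?bound)
    and "k \<in> K \<Longrightarrow> rem k \<in> borel_measurable P"
proof -
  interpret U: prob_space unif by (rule prob_space_unif)
  interpret P: prob_space P unfolding P_def by (intro prob_space_PiM prob_space_unif)
  interpret PI: prob_space "unifs I" by (intro prob_space_PiM prob_space_unif)
  interpret PJ: prob_space "unifs J" by (intro prob_space_PiM prob_space_unif)
  interpret PP: product_prob_space "\<lambda>_. unif" "I \<union> J" by (intro product_prob_spaceI prob_space_unif)
  have n: "n > 0" and m: "m > 0" using I J by (simp_all add: n_def m_def card_gt_0_iff)
  have \<psi>'_meas: "\<psi>' k \<in> borel_measurable unif" if "k \<in> K" for k
    using cont[OF that] by (rule borel_measurable_unif_continuous)
  have \<psi>_meas: "\<psi> k \<in> borel_measurable unif" if "k \<in> K" for k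
    using d[OF that] by (intro borel_measurable_unif_continuous) (meson DERIV_continuous_on)
  have rem_meas: "rem k \<in> borel_measurable P" if k: "k \<in> K" for k
  proof -
    have 1: "(\<lambda>x. x i) \<in> borel_measurable P" if "i \<in> I \<union> J" for i
      unfolding P_def using that by (rule borel_measurable_PiM_unif_component)
    have 2: "(\<lambda>x. f (x i)) \<in> borel_measurable P" if "i \<in> I \<union> J" "f \<in> borel_measurable unif" for i f
      unfolding P_def using that measurable_compose[OF measurable_component_singleton[of i "I \<union> J" "\<lambda>_. unif"], of f] by blast
    show ?thesis
      unfolding rem_def using k
      by (intro borel_measurable_divide borel_measurable_sum borel_measurable_add borel_measurable_times
          borel_measurable_diff borel_measurable_const borel_measurable_ecdf 1 2 \<psi>'_meas \<psi>_meas) auto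
  qed
  then show "k \<in> K \<Longrightarrow> rem k \<in> borel_measurable P" .
  \<comment> \<open>The grid level plus one mesh width bounds the discrepancy at every point of the
    unit interval.\<close>
  define \<eta>' where "\<eta>' = \<eta> + 1 / n"
  have \<eta>': "\<eta>' > 0" using \<eta> n by (simp add: \<eta>'_def add_pos_pos)
  let ?E = "{x \<in> space P. \<exists>k\<in>K. r \<le> \<bar>rem k x\<bar>}"
  have E: "?E \<in> sets P"
    using rem_meas K by (intro sets.sets_Collect_finite_Ex) auto
  \<comment> \<open>Stated on the grid only, the exceptional set is a finite union and its
    measurability is immediate.\<close>
  let ?Bad = "{x \<in> space (unifs I). \<exists>j\<in>{0..card I}. \<eta> \<le> \<bar>ecdf I x (real j / card I) - real j / card I\<bar>}"
  have Bad: "?Bad \<in> sets (unifs I)"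
  proof (intro sets.sets_Collect_finite_Ex)
    fix j
    have "(\<lambda>x. ecdf I x (real j / card I)) \<in> borel_measurable (unifs I)"
      by (intro borel_measurable_ecdf borel_measurable_PiM_unif_component borel_measurable_const)
    then show "{x \<in> space (unifs I). \<eta> \<le> \<bar>ecdf I x (real j / card I) - real j / card I\<bar>} \<in> sets (unifs I)"
      by measurable
  qed simp
  define e where "e = 2 * exp (- (m * r\<^sup>2 / (2 * (2 * B * \<eta>')\<^sup>2)))"
  have cond: "measure (unifs J) ((\<lambda>y. merge I J (x, y)) -` ?E \<inter> space (unifs J)) \<le> real (card K) * e"
    if x: "x \<in> space (unifs I)" "x \<notin> ?Bad" for x
  proof -
    have x01: "0 < x i" "x i < 1" if "i \<in> I" for i
      using x(1) that by (auto simp: space_PiM space_unif PiE_iff)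
    have disc: "\<bar>ecdf I x v - v\<bar> \<le> \<eta>'" if "0 \<le> v" "v \<le> 1" for v
      unfolding \<eta>'_def n_def using x that by (intro ecdf_grid[OF I]) force+
    \<comment> \<open>With the first sample frozen at \<open>x\<close>, the added constant is minus
      the mean of the first term by the kernel identity, so \<open>g k\<close> is centred.\<close>
    define g where "g k v = \<psi>' k v * (ecdf I x v - v) + (\<Sum>i\<in>I. \<psi> k (x i)) / n" for k v
    have g: "g k \<in> borel_measurable unif" "U.expectation (g k) = 0" "\<And>v. v \<in> space unif \<Longrightarrow> \<bar>g k v\<bar> \<le> 2 * B * \<eta>'"
      if k: "k \<in> K" for k
    proof -
      let ?f = "\<lambda>v. \<psi>' k v * (ecdf I x v - v)"
      have f_meas: "?f \<in> borel_measurable unif"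
        by (intro borel_measurable_times borel_measurable_diff borel_measurable_ecdf borel_measurable_const
            borel_measurable_unif_ident \<psi>'_meas k)
      then show "g k \<in> borel_measurable unif"
        unfolding g_def by (intro borel_measurable_add borel_measurable_const)
      have f_bd: "\<bar>?f v\<bar> \<le> B * \<eta>'" if "0 < v" "v < 1" for v
        unfolding abs_mult using B(1)[OF k, of v] B(2) disc[of v] that by (intro mult_mono) auto
      have f_int: "integrable unif ?f"
        using f_meas f_bd by (rule integrable_unif)
      have f_eq: "?f = (\<lambda>v. (\<Sum>i\<in>I. \<psi>' k v * (of_bool (x i \<le> v) - v)) / n)"
        by (simp add: fun_eq_iff ecdf_diff[OF I] n_def sum_distrib_left)
      have "U.expectation ?f = (\<Sum>i\<in>I. \<integral>v. \<psi>' k v * (of_bool (x i \<le> v) - v) \<partial>unif) / n"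
        unfolding f_eq using integral_unif_kernel(1)[OF d[OF k] cont[OF k] mean[OF k]] x01
        by (simp add: Bochner_Integration.integral_sum)
      also have "\<dots> = - ((\<Sum>i\<in>I. \<psi> k (x i)) / n)"
        using integral_unif_kernel(2)[OF d[OF k] cont[OF k] mean[OF k]] x01 by (simp add: sum_negf)
      finally have Ef: "U.expectation ?f = - ((\<Sum>i\<in>I. \<psi> k (x i)) / n)" .
      show "U.expectation (g k) = 0"
        unfolding g_def using f_int Ef U.prob_space by (simp add: space_unif)
      \<comment> \<open>The centring constant is itself a mean of the first term and inherits its
        bound \<open>B * \<eta>'\<close>. This doubling is the 2 in
        \<open>2 * B * \<eta>'\<close>.\<close>
      have "\<bar>U.expectation ?f - U.expectation (\<lambda>_. 0)\<bar> \<le> B * \<eta>'"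
        using f_int f_bd by (intro U.expectation_diff_le) (auto simp: space_unif)
      then have c: "\<bar>(\<Sum>i\<in>I. \<psi> k (x i)) / n\<bar> \<le> B * \<eta>'" using Ef by simp
      show "\<bar>g k v\<bar> \<le> 2 * B * \<eta>'" if "v \<in> space unif" for v
      proof -
        have "\<bar>?f v\<bar> \<le> B * \<eta>'" using f_bd[of v] that by (simp add: space_unif)
        then have "\<bar>?f v + (\<Sum>i\<in>I. \<psi> k (x i)) / n\<bar> \<le> B * \<eta>' + B * \<eta>'"
          using c by linarith
        then show ?thesis by (simp add: g_def)
      qed
    qed
    have bd: "measure (unifs J) {y \<in> space (unifs J). m * r \<le> \<bar>\<Sum>j\<in>J. g k (y j)\<bar>} \<le> e"
      if k: "k \<in> K" for k
    proof -
      have "measure (unifs J) {y \<in> space (unifs J). m * r \<le> \<bar>\<Sum>j\<in>J. g k (y j)\<bar>}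
        \<le> 2 * exp (- ((m * r)\<^sup>2 / (2 * real (card J) * (2 * B * \<eta>')\<^sup>2)))"
        using g[OF k] B(2) \<eta>' m r by (intro U.PiM_Hoeffding[OF J]) auto
      also have "(m * r)\<^sup>2 / (2 * real (card J) * (2 * B * \<eta>')\<^sup>2) = m * r\<^sup>2 / (2 * (2 * B * \<eta>')\<^sup>2)"
        using m by (simp add: power2_eq_square flip: m_def)
      finally show ?thesis by (simp add: e_def)
    qed
    have mg: "(\<lambda>y. \<Sum>j\<in>J. g k (y j)) \<in> borel_measurable (unifs J)" if "k \<in> K" for k
      using g(1)[OF that] by (intro borel_measurable_sum) (auto intro: measurable_compose[OF measurable_component_singleton])
    have sub: "(\<lambda>y. merge I J (x, y)) -` ?E \<inter> space (unifs J)
      \<subseteq> (\<Union>k\<in>K. {y \<in> space (unifs J). m * r \<le> \<bar>\<Sum>j\<in>J. g k (y j)\<bar>})"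
    proof
      fix y assume y: "y \<in> (\<lambda>y. merge I J (x, y)) -` ?E \<inter> space (unifs J)"
      then obtain k where k: "k \<in> K" "r \<le> \<bar>rem k (merge I J (x, y))\<bar>" by auto
      have mi: "merge I J (x, y) i = x i" if "i \<in> I" for i using that IJ by (simp add: merge_def)
      have mj: "merge I J (x, y) j = y j" if "j \<in> J" for j using that IJ by (auto simp: merge_def)
      have ec: "ecdf I (merge I J (x, y)) v = ecdf I x v" for v by (intro ecdf_cong mi)
      have "rem k (merge I J (x, y)) = (\<Sum>j\<in>J. g k (y j)) / m"
        unfolding rem_def g_def ec by (intro arg_cong2[where f="(/)"] sum.cong refl arg_cong2[where f="(+)"]) (simp_all add: mi mj)
      then have "\<bar>\<Sum>j\<in>J. g k (y j)\<bar> = m * \<bar>rem k (merge I J (x, y))\<bar>"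
        using m by (simp add: abs_divide)
      then have "m * r \<le> \<bar>\<Sum>j\<in>J. g k (y j)\<bar>"
        using k m by (simp add: mult_left_mono)
      then show "y \<in> (\<Union>k\<in>K. {y \<in> space (unifs J). m * r \<le> \<bar>\<Sum>j\<in>J. g k (y j)\<bar>})"
        using k y by auto
    qed
    have sets: "{y \<in> space (unifs J). m * r \<le> \<bar>\<Sum>j\<in>J. g k (y j)\<bar>} \<in> sets (unifs J)" if "k \<in> K" for k
      using mg[OF that] by measurable
    have "measure (unifs J) ((\<lambda>y. merge I J (x, y)) -` ?E \<inter> space (unifs J))
      \<le> measure (unifs J) (\<Union>k\<in>K. {y \<in> space (unifs J). m * r \<le> \<bar>\<Sum>j\<in>J. g k (y j)\<bar>})"
      using sub sets K by (intro PJ.finite_measure_mono sets.finite_UN) auto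
    also have "\<dots> \<le> (\<Sum>k\<in>K. measure (unifs J) {y \<in> space (unifs J). m * r \<le> \<bar>\<Sum>j\<in>J. g k (y j)\<bar>})"
      using sets K by (intro PJ.finite_measure_subadditive_finite) auto
    also have "\<dots> \<le> (\<Sum>k\<in>K. e)" using bd by (intro sum_mono) auto
    finally show ?thesis by simp
  qed
  have e0: "e \<ge> 0" by (simp add: e_def)
  \<comment> \<open>Integrating over the second sample first leaves the conditional bound off the
    exceptional set and the trivial bound 1 on it.\<close>
  have "emeasure P ?E = (\<integral>\<^sup>+x. emeasure (unifs J) ((\<lambda>y. merge I J (x, y)) -` ?E \<inter> space (unifs J)) \<partial>unifs I)"
    using E unfolding P_def by (intro PP.emeasure_fold_integral IJ I J)
  also have "\<dots> \<le> (\<integral>\<^sup>+x. indicator ?Bad x + ennreal (real (card K) * e) \<partial>unifs I)"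
  proof (intro nn_integral_mono)
    fix x assume x: "x \<in> space (unifs I)"
    show "emeasure (unifs J) ((\<lambda>y. merge I J (x, y)) -` ?E \<inter> space (unifs J))
      \<le> indicator ?Bad x + ennreal (real (card K) * e)"
    proof (cases "x \<in> ?Bad")
      case True
      have "emeasure (unifs J) ((\<lambda>y. merge I J (x, y)) -` ?E \<inter> space (unifs J)) \<le> 1"
        by (rule PJ.emeasure_le_1)
      then show ?thesis using True by (simp add: add_increasing2)
    next
      case False
      then show ?thesis using cond[OF x False] unfolding PJ.emeasure_eq_measure by (simp add: ennreal_leI)
    qed
  qed
  also have "\<dots> = emeasure (unifs I) ?Bad + ennreal (real (card K) * e)"
    using Bad by (simp add: nn_integral_add PI.emeasure_space_1)
  also have "\<dots> = ennreal (measure (unifs I) ?Bad + real (card K) * e)"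
    using e0 by (simp add: PI.emeasure_eq_measure)
  finally have "measure P ?E \<le> measure (unifs I) ?Bad + real (card K) * e"
    unfolding P.emeasure_eq_measure using e0 by (subst (asm) ennreal_le_iff) auto
  also have "measure (unifs I) ?Bad \<le> 2 * (n + 1) * exp (- (n * \<eta>\<^sup>2 / 2))"
    unfolding n_def using \<eta> by (intro ecdf_grid_prob I) auto
  finally show ?bound
    by (simp add: e_def \<eta>'_def)
qed

section \<open>Mean square discrepancy of the empirical distribution function\<close>

lemma (in prob_space) PiM_sum_square_le:
  fixes g :: "'a \<Rightarrow> real"
  assumes I: "finite I" and g: "g \<in> borel_measurable M" "\<And>x. x \<in> space M \<Longrightarrow> \<bar>g x\<bar> \<le> 1" "expectation g = 0"
  shows "(\<integral>x. (\<Sum>i\<in>I. g (x i))\<^sup>2 \<partial>Pi\<^sub>M I (\<lambda>_. M)) \<le> real (card I)"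
proof -
  let ?P = "Pi\<^sub>M I (\<lambda>_. M)"
  have int: "integrable M g"
    using g by (intro integrable_const_bound[where B=1]) auto
  have gg: "\<bar>g x * g x\<bar> \<le> 1" if "x \<in> space M" for x
    using g(2)[OF that] mult_mono[of "\<bar>g x\<bar>" 1 "\<bar>g x\<bar>" 1] by (simp add: abs_mult)
  have int2: "integrable M (\<lambda>x. g x * g x)"
    using g gg by (intro integrable_const_bound[where B=1]) auto
  have ii: "integrable ?P (\<lambda>x. g (x i) * g (x j))" if "i \<in> I" "j \<in> I" for i j
    using integrable_PiM_component_mult[OF I that _ int int] integrable_PiM_component[OF that(1) int2]
    by (cases "i = j") auto
  have e: "(\<integral>x. g (x i) * g (x j) \<partial>?P) = (if i = j then expectation (\<lambda>x. g x * g x) else 0)"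
    if "i \<in> I" "j \<in> I" for i j
    using integral_PiM_component_mult[OF I that _ int int] integral_PiM_component[OF that(1), of "\<lambda>x. g x * g x"] int2 g(3)
    by (cases "i = j") auto
  have "(\<integral>x. (\<Sum>i\<in>I. g (x i))\<^sup>2 \<partial>?P) = (\<integral>x. (\<Sum>i\<in>I. \<Sum>j\<in>I. g (x i) * g (x j)) \<partial>?P)"
    by (simp add: power2_eq_square sum_product)
  also have "\<dots> = (\<Sum>i\<in>I. \<Sum>j\<in>I. \<integral>x. g (x i) * g (x j) \<partial>?P)"
    using ii by (simp add: Bochner_Integration.integral_sum Bochner_Integration.integrable_sum)
  also have "\<dots> = (\<Sum>i\<in>I. \<Sum>j\<in>I. if i = j then expectation (\<lambda>x. g x * g x) else 0)"
    using e by (intro sum.cong) auto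
  also have "\<dots> = real (card I) * expectation (\<lambda>x. g x * g x)"
    using I by simp
  also have "expectation (\<lambda>x. g x * g x) \<le> expectation (\<lambda>x. 1)"
    using int2 gg by (intro integral_mono) (auto simp: abs_le_iff)
  finally show ?thesis by (simp add: prob_space mult_left_mono)
qed

text \<open>Given the second sample, the discrepancy at \<open>x j\<close> is an average of
  independent centred variables bounded by 1, so its second moment is at most \<open>1 / n\<close>.
  The product is split with \<open>J\<close> outside, which makes the first sample the inner
  variable.\<close>

lemma ecdf_sq_expectation:
  assumes I: "finite I" "I \<noteq> {}" and J: "finite J" "J \<noteq> {}" and IJ: "I \<inter> J = {}"
  defines "P \<equiv> unifs (I \<union> J)"
    and "Q \<equiv> \<lambda>x. (\<Sum>j\<in>J. (ecdf I x (x j) - x j)\<^sup>2) / real (card J)"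
  shows "integrable P Q" and "(\<integral>x. Q x \<partial>P) \<le> 1 / real (card I)"
proof -
  interpret U: prob_space unif by (rule prob_space_unif)
  interpret P: prob_space P unfolding P_def by (intro prob_space_PiM prob_space_unif)
  interpret PJ: prob_space "unifs J" by (intro prob_space_PiM prob_space_unif)
  interpret PI: prob_space "unifs I" by (intro prob_space_PiM prob_space_unif)
  interpret PP: product_prob_space "\<lambda>_. unif" "J \<union> I" by (intro product_prob_spaceI prob_space_unif)
  define n where "n = real (card I)"
  have n: "n > 0" using I by (simp add: n_def card_gt_0_iff)
  let ?f = "\<lambda>j x. (ecdf I x (x j) - x j)\<^sup>2"
  have bd: "\<bar>?f j x\<bar> \<le> 1" if "x j \<in> {0..1}" for x j
  proof -
    have "\<bar>ecdf I x (x j) - x j\<bar> \<le> 1" using that ecdf_bounds[of I x "x j"] by auto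
    then show ?thesis by (simp add: abs_square_le_1)
  qed
  have meas: "?f j \<in> borel_measurable P" if "j \<in> J" for j
    unfolding P_def using that
    by (intro borel_measurable_power borel_measurable_diff borel_measurable_ecdf borel_measurable_PiM_unif_component) auto
  have int: "integrable P (?f j)" if "j \<in> J" for j
  proof (intro P.integrable_const_bound[where B=1] AE_I2 meas that)
    fix x assume "x \<in> space P"
    then have "0 < x j" "x j < 1" using that unfolding P_def by (auto simp: space_PiM space_unif PiE_iff)
    then show "norm (?f j x) \<le> 1" using bd[of x j] by simp
  qed
  then show "integrable P Q" unfolding Q_def by (intro integrable_divide Bochner_Integration.integrable_sum)
  have one: "(\<integral>x. ?f j x \<partial>P) \<le> 1 / n" if j: "j \<in> J" for j
  proof -
    have intm: "integrable (unifs J \<Otimes>\<^sub>M unifs I) (\<lambda>z. ?f j (merge J I z))"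
    proof -
      have d: "distr (unifs J \<Otimes>\<^sub>M unifs I) (unifs (J \<union> I)) (merge J I) = P"
        using IJ PP.distr_merge[of J I] I J by (simp add: P_def Int_commute Un_commute)
      have "integrable (distr (unifs J \<Otimes>\<^sub>M unifs I) (unifs (J \<union> I)) (merge J I)) (?f j)"
        unfolding d by (rule int[OF j])
      then show ?thesis
        by (rule integrable_distr[OF measurable_merge])
    qed
    interpret JI: pair_prob_space "unifs J" "unifs I" ..
    have "(\<integral>x. ?f j x \<partial>P) = (\<integral>y. (\<integral>x. ?f j (merge J I (y, x)) \<partial>unifs I) \<partial>unifs J)"
      using PP.product_integral_fold[of J I "?f j"] IJ I J int[OF j] by (simp add: P_def Int_commute Un_commute)
    also have "\<dots> \<le> (\<integral>y. 1 / n \<partial>unifs J)"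
    proof (intro integral_mono)
      show "integrable (unifs J) (\<lambda>y. \<integral>x. ?f j (merge J I (y, x)) \<partial>unifs I)"
        using JI.integrable_fst'[OF intm] by simp
      fix y assume y: "y \<in> space (unifs J)"
      define v where "v = y j"
      have v: "v \<in> {0..1}" using y j by (auto simp: v_def space_PiM space_unif PiE_iff less_imp_le)
      have eq: "?f j (merge J I (y, x)) = (\<Sum>i\<in>I. of_bool (x i \<le> v) - v)\<^sup>2 / n\<^sup>2" for x
      proof -
        have "merge J I (y, x) j = v" using j by (simp add: merge_def v_def)
        moreover have "ecdf I (merge J I (y, x)) v = ecdf I x v"
          using IJ by (intro ecdf_cong) (auto simp: merge_def)
        ultimately have "?f j (merge J I (y, x)) = (ecdf I x v - v)\<^sup>2" by simp
        also have "\<dots> = (\<Sum>i\<in>I. of_bool (x i \<le> v) - v)\<^sup>2 / n\<^sup>2"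
          unfolding ecdf_diff[OF I] by (simp add: power_divide n_def)
        finally show ?thesis .
      qed
      have "(\<integral>x. (\<Sum>i\<in>I. of_bool (x i \<le> v) - v)\<^sup>2 \<partial>unifs I) \<le> n"
        unfolding n_def
      proof (rule U.PiM_sum_square_le[OF I(1)])
        show "(\<lambda>u. of_bool (u \<le> v) - v) \<in> borel_measurable unif"
          by (intro borel_measurable_diff borel_measurable_of_bool_le borel_measurable_unif_ident borel_measurable_const)
        show "\<bar>of_bool (u \<le> v) - v\<bar> \<le> 1" for u using v by (cases "u \<le> v") auto
        show "U.expectation (\<lambda>u. of_bool (u \<le> v) - v) = 0" using v by (rule integral_unif_indicator)
      qed
      then have "(\<integral>x. (\<Sum>i\<in>I. of_bool (x i \<le> v) - v)\<^sup>2 \<partial>unifs I) / n\<^sup>2 \<le> n / n\<^sup>2"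
        by (intro divide_right_mono) auto
      then show "(\<integral>x. ?f j (merge J I (y, x)) \<partial>unifs I) \<le> 1 / n"
        unfolding eq using n by (simp add: power2_eq_square)
    qed auto
    also have "\<dots> = 1 / n" using PJ.prob_space by simp
    finally show ?thesis .
  qed
  have "(\<integral>x. Q x \<partial>P) = (\<Sum>j\<in>J. \<integral>x. ?f j x \<partial>P) / real (card J)"
    unfolding Q_def using int by (simp add: Bochner_Integration.integral_sum)
  also have "\<dots> \<le> (\<Sum>j\<in>J. 1 / n) / real (card J)"
    using one by (intro divide_right_mono sum_mono) auto
  also have "\<dots> = 1 / n" using J by simp
  finally show "(\<integral>x. Q x \<partial>P) \<le> 1 / real (card I)" by (simp add: n_def)
qed

section \<open>The rank statistic for uniform samples\<close>

text \<open>Since the squared weights sum to 1,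
  \<open>\<bar>b s\<bar>^3 \<le> a * (b s)\<^sup>2\<close> turns the sum over all observations into
  one error scaled by the largest weight.\<close>

lemma sum_lindeberg_err_le:
  assumes "finite S" "\<And>s. s \<in> S \<Longrightarrow> \<bar>b s\<bar> \<le> a" "(\<Sum>s\<in>S. (b s)\<^sup>2) = 1"
    and pos: "\<beta> > 0" "B \<ge> 0" "A > 0"
  shows "(\<Sum>s\<in>S. lindeberg_err d \<beta> B A (b s))
    \<le> 13/6 * \<beta>^3 * a * (B\<^sup>2 * exp (2 * \<beta> * a * B) + A^3 + real d * normal_moment16 / A^13)"
proof -
  let ?C = "B\<^sup>2 * exp (2 * \<beta> * a * B) + A^3 + real d * normal_moment16 / A^13"
  have m: "normal_moment16 \<ge> 0" by (simp add: normal_moment16_def)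
  have "lindeberg_err d \<beta> B A (b s) \<le> 13/6 * \<beta>^3 * a * ?C * (b s)\<^sup>2" if s: "s \<in> S" for s
  proof -
    have a: "0 \<le> a" "\<bar>b s\<bar> \<le> a" using assms(2)[OF s] by auto
    have "\<bar>b s\<bar>^3 = \<bar>b s\<bar> * (b s)\<^sup>2" by (simp add: power2_eq_square power3_eq_cube)
    also have "\<dots> \<le> a * (b s)\<^sup>2" using a by (intro mult_right_mono) auto
    finally have 1: "\<bar>b s\<bar>^3 \<le> a * (b s)\<^sup>2" .
    have "2 * \<beta> * \<bar>b s\<bar> * B \<le> 2 * \<beta> * a * B" using a pos by (intro mult_left_mono mult_right_mono) auto
    then have "B\<^sup>2 * exp (2 * \<beta> * \<bar>b s\<bar> * B) \<le> B\<^sup>2 * exp (2 * \<beta> * a * B)"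
      by (intro mult_left_mono) auto
    then have "13/6 * \<beta>^3 * \<bar>b s\<bar>^3 * (B\<^sup>2 * exp (2 * \<beta> * \<bar>b s\<bar> * B) + A^3 + real d * normal_moment16 / A^13)
      \<le> 13/6 * \<beta>^3 * (a * (b s)\<^sup>2) * ?C"
      using 1 pos m a by (intro mult_mono add_nonneg_nonneg mult_nonneg_nonneg divide_nonneg_nonneg) auto
    then show ?thesis by (simp add: lindeberg_err_def mult_ac)
  qed
  then have "(\<Sum>s\<in>S. lindeberg_err d \<beta> B A (b s)) \<le> (\<Sum>s\<in>S. 13/6 * \<beta>^3 * a * ?C * (b s)\<^sup>2)"
    by (rule sum_mono)
  also have "\<dots> = 13/6 * \<beta>^3 * a * ?C" unfolding sum_distrib_left[symmetric] assms(3) by simp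
  finally show ?thesis .
qed

lemma borel_measurable_continuous_01:
  fixes f :: "real \<Rightarrow> real"
  assumes "continuous_on {0..1} f" "g \<in> borel_measurable M" "\<And>x. x \<in> space M \<Longrightarrow> g x \<in> {0..1}"
  shows "(\<lambda>x. f (g x)) \<in> borel_measurable M"
proof -
  have 1: "g \<in> M \<rightarrow>\<^sub>M restrict_space borel {0..1}"
    using assms by (intro measurable_restrict_space2) auto
  have 2: "f \<in> borel_measurable (restrict_space borel {0..1})"
    using assms(1) by (rule borel_measurable_continuous_on_restrict)
  show ?thesis by (rule measurable_compose[OF 1 2])
qed

text \<open>The second derivative is known only to exist and to be bounded, so the remainder is
  estimated pointwise and not written as an integral. The form of the remainder used gives the
  constant \<open>B\<close> where the sharp one would be half of it.\<close>

lemma taylor_first_order_01: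
  fixes \<psi> \<psi>1 \<psi>2 :: "real \<Rightarrow> real"
  assumes "\<And>z. z \<in> {0..1} \<Longrightarrow> (\<psi> has_real_derivative \<psi>1 z) (at z within {0..1})"
    "\<And>z. z \<in> {0..1} \<Longrightarrow> (\<psi>1 has_real_derivative \<psi>2 z) (at z within {0..1})"
    "\<And>z. z \<in> {0..1} \<Longrightarrow> \<bar>\<psi>2 z\<bar> \<le> B" "v \<in> {0..1}" "y \<in> {0..1}"
  shows "\<bar>\<psi> y - \<psi> v - \<psi>1 v * (y - v)\<bar> \<le> B * (y - v)\<^sup>2"
proof -
  define f where "f i = (if i = 0 then \<psi> else if i = 1 then \<psi>1 else \<psi>2)" for i :: nat
  have "norm (f 0 y - (\<Sum>i\<le>1. f i v * (y - v) ^ i / fact i)) \<le> B * norm (y - v) ^ Suc 1 / fact 1"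
    using assms by (intro field_Taylor[where S = "{0..1}"]) (auto simp: f_def le_Suc_eq)
  then show ?thesis by (simp add: f_def power2_eq_square algebra_simps)
qed

text \<open>The error terms are, in order: anti-concentration of the Gaussian maximum, replacement,
  smoothing, an irregular first sample, conditional deviation of the degenerate remainder, and
  Markov's inequality for the quadratic remainder. The cube shift of \<open>4 * h\<close> is spent
  as \<open>2 * h\<close> on smoothing and \<open>h\<close> on each of the two remainders.\<close>

lemma two_sample_bound:
  fixes \<psi> \<psi>1 \<psi>2 :: "'k \<Rightarrow> real \<Rightarrow> real" and I J :: "'s set" and t :: real
  assumes I: "finite I" "I \<noteq> {}" and J: "finite J" "J \<noteq> {}" and IJ: "I \<inter> J = {}" and K: "finite K"
    and d1: "\<And>k z. k \<in> K \<Longrightarrow> z \<in> {0..1} \<Longrightarrow> (\<psi> k has_real_derivative \<psi>1 k z) (at z within {0..1})"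
    and d2: "\<And>k z. k \<in> K \<Longrightarrow> z \<in> {0..1} \<Longrightarrow> (\<psi>1 k has_real_derivative \<psi>2 k z) (at z within {0..1})"
    and mean: "\<And>k. k \<in> K \<Longrightarrow> integral {0..1} (\<psi> k) = 0"
    and cov: "\<And>k l. k \<in> K \<Longrightarrow> l \<in> K \<Longrightarrow> integral {0..1} (\<lambda>z. \<psi> k z * \<psi> l z) = (if k = l then 1 else 0)"
    and B0: "\<And>k z. k \<in> K \<Longrightarrow> z \<in> {0..1} \<Longrightarrow> \<bar>\<psi> k z\<bar> \<le> B0" "B0 \<ge> 0"
    and B1: "\<And>k z. k \<in> K \<Longrightarrow> z \<in> {0..1} \<Longrightarrow> \<bar>\<psi>1 k z\<bar> \<le> B1" "B1 > 0"
    and B2: "\<And>k z. k \<in> K \<Longrightarrow> z \<in> {0..1} \<Longrightarrow> \<bar>\<psi>2 k z\<bar> \<le> B2" "B2 \<ge> 0"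
    and pos: "h > 0" "\<beta> > 0" "A > 0" "\<eta> > 0"
    and D: "D \<ge> 1" "real (card K) \<le> exp (D\<^sup>2 / 2)" "4 * h * D \<le> 1"
  defines "n \<equiv> real (card I)" and "m \<equiv> real (card J)"
  defines "c \<equiv> sqrt (n * m / (n + m))"
  assumes a: "c / n \<le> a" "c / m \<le> a"
  defines "P \<equiv> unifs (I \<union> J)"
    and "T \<equiv> \<lambda>k x. c * ((\<Sum>j\<in>J. \<psi> k (ecdf I x (x j))) / m)"
  shows "\<bar>measure P {x \<in> space P. \<forall>k\<in>K. \<bar>T k x\<bar> < t} - box_prob t ^ card K\<bar>
    \<le> 4 * exp 4 * h * D
      + 13/6 * \<beta>^3 * a * (B0\<^sup>2 * exp (2 * \<beta> * a * B0) + A^3 + real (card K) * normal_moment16 / A^13)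
      + (2 * real (card K) + 1) * exp (- \<beta> * h)
      + 2 * (n + 1) * exp (- (n * \<eta>\<^sup>2 / 2))
      + 2 * real (card K) * exp (- (m * (h / c)\<^sup>2 / (2 * (2 * B1 * (\<eta> + 1 / n))\<^sup>2)))
      + c * B2 / (n * h)" (is ?bound)
    and "{x \<in> space P. \<forall>k\<in>K. \<bar>T k x\<bar> < t} \<in> sets P"
proof -
  interpret P: prob_space P unfolding P_def by (intro prob_space_PiM prob_space_unif)
  have n: "n > 0" and m: "m > 0" using I J by (simp_all add: n_def m_def card_gt_0_iff)
  then have c: "c > 0" by (simp add: c_def)
  have c2: "c\<^sup>2 = n * m / (n + m)" using n m by (simp add: c_def)
  \<comment> \<open>The first sample enters with negative sign because its projection is
    \<open>- \<psi>\<close>. The normalisation \<open>c\<close> is exactly what makes the squared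
    weights sum to 1.\<close>
  define b where "b s = (if s \<in> J then c / m else - (c / n))" for s
  define W where "W x k = (\<Sum>s\<in>I \<union> J. b s * \<psi> k (x s))" for x k
  define rem where "rem k x = (\<Sum>j\<in>J. \<psi>1 k (x j) * (ecdf I x (x j) - x j) + (\<Sum>i\<in>I. \<psi> k (x i)) / n) / m" for k x
  define Q where "Q x = (\<Sum>j\<in>J. (ecdf I x (x j) - x j)\<^sup>2) / m" for x
  have cont: "continuous_on {0..1} (\<psi> k)" "continuous_on {0..1} (\<psi>1 k)" if "k \<in> K" for k
    using d1[OF that] d2[OF that] by (meson DERIV_continuous_on)+
  have space: "0 < x s" "x s < 1" if "x \<in> space P" "s \<in> I \<union> J" for x s
    using that by (auto simp: P_def space_PiM space_unif PiE_iff)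

  have split: "(\<Sum>s\<in>I \<union> J. f s) = (\<Sum>i\<in>I. f i) + (\<Sum>j\<in>J. f j)" for f :: "'s \<Rightarrow> real"
    using I J IJ by (intro sum.union_disjoint)
  have bI: "b i = - (c / n)" if "i \<in> I" for i using that IJ by (auto simp: b_def)
  have bJ: "b j = c / m" if "j \<in> J" for j using that by (simp add: b_def)
  have W_eq: "W x k = c * ((\<Sum>j\<in>J. \<psi> k (x j)) / m - (\<Sum>i\<in>I. \<psi> k (x i)) / n)" for x k
    unfolding W_def split using bI bJ by (simp add: sum_distrib_left sum_divide_distrib sum_negf algebra_simps)
  have "(\<Sum>s\<in>I \<union> J. (b s)\<^sup>2) = n * (c / n)\<^sup>2 + m * (c / m)\<^sup>2"
    unfolding split using bI bJ by (simp add: n_def m_def)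
  also have "\<dots> = c\<^sup>2 * (n + m) / (n * m)"
    using n m by (simp add: field_simps power2_eq_square)
  also have "\<dots> = 1"
  proof -
    have "n + m \<noteq> 0" using n m by linarith
    then show ?thesis using n m unfolding c2 by simp
  qed
  finally have b1: "(\<Sum>s\<in>I \<union> J. (b s)\<^sup>2) = 1" .
  have b0: "b s \<noteq> 0" "\<bar>b s\<bar> \<le> a" for s
    using c n m a by (auto simp: b_def)

  have psi_meas: "\<psi> k \<in> borel_measurable unif" if "k \<in> K" for k
    using cont[OF that] by (intro borel_measurable_unif_continuous)
  have cont_prod: "continuous_on {0..1} (\<lambda>z. \<psi> k z * \<psi> l z)" if "k \<in> K" "l \<in> K" for k l
    using cont that by (intro continuous_on_mult) auto
  define err where "err = (\<Sum>s\<in>I \<union> J. lindeberg_err (card K) \<beta> B0 A (b s)) + (2 * real (card K) + 1) * exp (- \<beta> * h)"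
  have clt: "measure P {x \<in> space P. \<forall>k\<in>K. \<bar>W x k\<bar> \<le> t} \<le> box_prob (t + 2 * h) ^ card K + err"
    "box_prob (t - 2 * h) ^ card K - err \<le> measure P {x \<in> space P. \<forall>k\<in>K. \<bar>W x k\<bar> < t}" for t
    unfolding P_def W_def err_def
    by (rule normalized_sum_box_bounds[OF K pos(2,3) B0(2) prob_space_unif psi_meas];
        use B0(1) mean cov I J b0 b1 cont cont_prod in \<open>simp add: space_unif integral_unif_continuous less_imp_le\<close>)+
  have err: "err \<le> 13/6 * \<beta>^3 * a * (B0\<^sup>2 * exp (2 * \<beta> * a * B0) + A^3 + real (card K) * normal_moment16 / A^13)
      + (2 * real (card K) + 1) * exp (- \<beta> * h)"
    unfolding err_def using sum_lindeberg_err_le[of "I \<union> J" b a \<beta> B0 A "card K"] I J b0 b1 B0 pos by simp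

  \<comment> \<open>On \<open>E1\<close> the degenerate remainder, and on \<open>E2\<close> the
    quadratic one, may reach size \<open>h\<close> after multiplication by \<open>c\<close>.\<close>
  define E1 where "E1 = {x \<in> space P. \<exists>k\<in>K. h / c \<le> \<bar>rem k x\<bar>}"
  define E2 where "E2 = {x \<in> space P. h \<le> c * B2 * Q x}"
  have rem_meas: "rem k \<in> borel_measurable P" if "k \<in> K" for k
    unfolding rem_def P_def n_def m_def
    by (rule degenerate_remainder_prob(2)[OF I J IJ K d1 cont(2) mean B1 pos(4), where r = 0]) (use that in auto)
  have E1: "E1 \<in> sets P"
    unfolding E1_def using rem_meas K by (intro sets.sets_Collect_finite_Ex) auto
  have E1_prob: "measure P E1 \<le> 2 * (n + 1) * exp (- (n * \<eta>\<^sup>2 / 2))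
      + 2 * real (card K) * exp (- (m * (h / c)\<^sup>2 / (2 * (2 * B1 * (\<eta> + 1 / n))\<^sup>2)))"
    unfolding E1_def rem_def P_def n_def m_def
    by (rule degenerate_remainder_prob(1)[OF I J IJ K d1 cont(2) mean B1 pos(4)])
      (use pos c in \<open>auto simp: n_def m_def\<close>)
  have Q: "integrable P Q" "P.expectation Q \<le> 1 / n"
    unfolding Q_def P_def n_def m_def using ecdf_sq_expectation[OF I J IJ] by auto
  have Q0: "Q x \<ge> 0" for x
    unfolding Q_def using m by (intro divide_nonneg_nonneg sum_nonneg) auto
  have cQ: "integrable P (\<lambda>x. c * B2 * Q x)" using Q(1) by simp
  have E2: "E2 \<in> sets P"
    unfolding E2_def using borel_measurable_integrable[OF cQ] by measurable
  have "measure P E2 \<le> P.expectation (\<lambda>x. c * B2 * Q x) / h"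
    unfolding E2_def using cQ Q0 c B2 pos
    by (intro integral_Markov_inequality_measure[where A = "{}"]) auto
  also have "\<dots> = c * B2 * P.expectation Q / h" using Q(1) by simp
  also have "\<dots> \<le> c * B2 * (1 / n) / h"
    using Q(2) c B2 pos by (intro divide_right_mono mult_left_mono) auto
  finally have E2_prob: "measure P E2 \<le> c * B2 / (n * h)" by simp

  have T_meas: "T k \<in> borel_measurable P" if k: "k \<in> K" for k
    unfolding T_def P_def using ecdf_bounds cont(1)[OF k]
    by (intro borel_measurable_times borel_measurable_divide borel_measurable_sum borel_measurable_const
        borel_measurable_continuous_01[OF cont(1)[OF k]] borel_measurable_ecdf borel_measurable_PiM_unif_component) auto
  have W_meas: "(\<lambda>x. W x k) \<in> borel_measurable P" if k: "k \<in> K" for k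
    unfolding W_def P_def
    by (intro borel_measurable_sum borel_measurable_times borel_measurable_const
        measurable_compose[OF measurable_component_singleton[where M="\<lambda>_. unif"] psi_meas[OF k]])
  show ET: "{x \<in> space P. \<forall>k\<in>K. \<bar>T k x\<bar> < t} \<in> sets P" for t
    using T_meas K by (intro sets.sets_Collect_finite_All) auto
  have EW: "{x \<in> space P. \<forall>k\<in>K. \<bar>W x k\<bar> < t} \<in> sets P" "{x \<in> space P. \<forall>k\<in>K. \<bar>W x k\<bar> \<le> t} \<in> sets P" for t
    using W_meas K by (intro sets.sets_Collect_finite_All; auto)+

  have close: "\<bar>T k x - W x k\<bar> < 2 * h" if x: "x \<in> space P" "x \<notin> E1" "x \<notin> E2" and k: "k \<in> K" for k x
  proof -
    define F where "F j = ecdf I x (x j)" for j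
    define R where "R j = \<psi> k (F j) - \<psi> k (x j) - \<psi>1 k (x j) * (F j - x j)" for j
    have R: "\<bar>R j\<bar> \<le> B2 * (F j - x j)\<^sup>2" if "j \<in> J" for j
      unfolding R_def using d1[OF k] d2[OF k] B2(1)[OF k] space[OF x(1), of j] that ecdf_bounds[of I x "x j"]
      by (intro taylor_first_order_01[of "\<psi> k" "\<psi>1 k" "\<psi>2 k"]) (auto simp: F_def less_imp_le)
    have "\<bar>\<Sum>j\<in>J. R j\<bar> \<le> (\<Sum>j\<in>J. \<bar>R j\<bar>)" by (rule sum_abs)
    also have "\<dots> \<le> (\<Sum>j\<in>J. B2 * (F j - x j)\<^sup>2)" using R by (rule sum_mono)
    also have "\<dots> = B2 * Q x * m" using m by (simp add: Q_def F_def sum_distrib_left)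
    finally have "\<bar>(\<Sum>j\<in>J. R j) / m\<bar> \<le> B2 * Q x" using m by (simp add: pos_divide_le_eq)
    then have "c * \<bar>(\<Sum>j\<in>J. R j) / m\<bar> \<le> c * (B2 * Q x)" using c by (intro mult_left_mono) auto
    then have 1: "\<bar>c * ((\<Sum>j\<in>J. R j) / m)\<bar> \<le> c * B2 * Q x" using c by (simp add: abs_mult)
    \<comment> \<open>The linear Taylor term equals the degenerate remainder minus the average of
      \<open>\<psi> k\<close> over the first sample, and that average is already part of
      \<open>W\<close>.\<close>
    have rem_eq: "rem k x = (\<Sum>j\<in>J. \<psi>1 k (x j) * (F j - x j)) / m + (\<Sum>i\<in>I. \<psi> k (x i)) / n"
      using m by (simp add: rem_def F_def sum.distrib add_divide_distrib m_def[symmetric])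
    have "(\<Sum>j\<in>J. \<psi> k (F j)) = (\<Sum>j\<in>J. R j) + (\<Sum>j\<in>J. \<psi> k (x j)) + (\<Sum>j\<in>J. \<psi>1 k (x j) * (F j - x j))"
      unfolding R_def by (simp add: sum_subtractf)
    then have "T k x - W x k = c * ((\<Sum>j\<in>J. R j) / m) + c * rem k x"
      unfolding T_def W_eq rem_eq F_def[symmetric] by (simp add: add_divide_distrib algebra_simps)
    moreover have "\<bar>rem k x\<bar> < h / c" using x k by (auto simp: E1_def not_le)
    then have "c * \<bar>rem k x\<bar> < h" using c by (simp add: pos_less_divide_eq mult.commute)
    then have "\<bar>c * rem k x\<bar> < h" using c by (simp add: abs_mult)
    moreover have "c * B2 * Q x < h" using x by (auto simp: E2_def not_le)
    ultimately show ?thesis using 1 by linarith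
  qed

  let ?ET = "{x \<in> space P. \<forall>k\<in>K. \<bar>T k x\<bar> < t}"
  have "measure P ?ET \<le> measure P ({x \<in> space P. \<forall>k\<in>K. \<bar>W x k\<bar> \<le> t + 2 * h} \<union> (E1 \<union> E2))"
  proof (rule P.finite_measure_mono)
    show "?ET \<subseteq> {x \<in> space P. \<forall>k\<in>K. \<bar>W x k\<bar> \<le> t + 2 * h} \<union> (E1 \<union> E2)"
    proof
      fix x assume x: "x \<in> ?ET"
      show "x \<in> {x \<in> space P. \<forall>k\<in>K. \<bar>W x k\<bar> \<le> t + 2 * h} \<union> (E1 \<union> E2)"
      proof (cases "x \<in> E1 \<union> E2")
        case False
        have "\<bar>W x k\<bar> \<le> t + 2 * h" if "k \<in> K" for k
        proof -
          have "\<bar>T k x\<bar> < t" "\<bar>T k x - W x k\<bar> < 2 * h" using x that False close by auto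
          then show ?thesis by linarith
        qed
        then show ?thesis using x by auto
      qed simp
    qed
  qed (use EW E1 E2 in auto)
  also have "\<dots> \<le> measure P {x \<in> space P. \<forall>k\<in>K. \<bar>W x k\<bar> \<le> t + 2 * h} + (measure P E1 + measure P E2)"
    using EW E1 E2 by (intro order_trans[OF measure_Un_le] add_left_mono measure_Un_le) auto
  also have "\<dots> \<le> box_prob (t + 2 * h + 2 * h) ^ card K + err + (measure P E1 + measure P E2)"
    using clt(1)[of "t + 2 * h"] by simp
  also have "t + 2 * h + 2 * h = t + 4 * h" by simp
  finally have upper: "measure P ?ET \<le> box_prob (t + 4 * h) ^ card K + err + (measure P E1 + measure P E2)" .
  have "box_prob (t - 2 * h - 2 * h) ^ card K - err \<le> measure P {x \<in> space P. \<forall>k\<in>K. \<bar>W x k\<bar> < t - 2 * h}"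
    by (rule clt(2))
  also have "\<dots> \<le> measure P (?ET \<union> (E1 \<union> E2))"
  proof (rule P.finite_measure_mono)
    show "{x \<in> space P. \<forall>k\<in>K. \<bar>W x k\<bar> < t - 2 * h} \<subseteq> ?ET \<union> (E1 \<union> E2)"
    proof
      fix x assume x: "x \<in> {x \<in> space P. \<forall>k\<in>K. \<bar>W x k\<bar> < t - 2 * h}"
      show "x \<in> ?ET \<union> (E1 \<union> E2)"
      proof (cases "x \<in> E1 \<union> E2")
        case False
        have "\<bar>T k x\<bar> < t" if "k \<in> K" for k
        proof -
          have "\<bar>W x k\<bar> < t - 2 * h" "\<bar>T k x - W x k\<bar> < 2 * h" using x that False close by auto
          then show ?thesis by linarith
        qed
        then show ?thesis using x by auto
      qed simp
    qed
  qed (use ET E1 E2 in auto)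
  also have "\<dots> \<le> measure P ?ET + (measure P E1 + measure P E2)"
    using ET E1 E2 by (intro order_trans[OF measure_Un_le] add_left_mono measure_Un_le) auto
  also have "t - 2 * h - 2 * h = t - 4 * h" by simp
  finally have lower: "box_prob (t - 4 * h) ^ card K - err \<le> measure P ?ET + (measure P E1 + measure P E2)" .
  \<comment> \<open>Anti-concentration is used twice: on the shell outside the cube of radius
    \<open>t\<close> for the upper bound, and on the shell just inside it for the lower
    bound.\<close>
  have "box_prob (t + 4 * h) ^ card K - box_prob t ^ card K \<le> exp 4 * (4 * h) * D"
    using pos D by (intro box_prob_anticoncentration) auto
  moreover have "box_prob (t - 4 * h + 4 * h) ^ card K - box_prob (t - 4 * h) ^ card K \<le> exp 4 * (4 * h) * D"
    using pos D by (intro box_prob_anticoncentration) auto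
  moreover have "exp 4 * (4 * h) * D = 4 * exp 4 * h * D" "t - 4 * h + 4 * h = t" by simp_all
  ultimately show ?bound
    using upper lower err E1_prob E2_prob unfolding abs_le_iff by (simp only:) linarith
qed

section \<open>Reduction to uniform samples\<close>

text \<open>Boundedness has to be supplied because \<open>SUP\<close> of an unbounded set of reals
  has an unspecified value.\<close>

lemma Bsup_upper:
  assumes "k \<in> {1..d}" "z \<in> {0..1}" "bdd_above ((\<lambda>z. \<bar>f k z\<bar>) ` {0..1})"
  shows "\<bar>f k z\<bar> \<le> Bsup f d"
proof -
  have "\<bar>f k z\<bar> \<le> (SUP z\<in>{0..1}. \<bar>f k z\<bar>)"
    using assms by (intro cSUP_upper) auto
  also have "\<dots> \<le> Bsup f d"
    unfolding Bsup_def using assms by (intro Max_ge) auto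
  finally show ?thesis .
qed

lemma continuous_abs_bdd_above:
  fixes f :: "real \<Rightarrow> real"
  assumes "continuous_on {0..1} f"
  shows "bdd_above ((\<lambda>z. \<bar>f z\<bar>) ` {0..1})"
proof -
  obtain B where "\<And>x. x \<in> {0..1} \<Longrightarrow> \<bar>f x\<bar> \<le> B"
    using bounded_continuous_01[OF assms] by blast
  then show ?thesis by (intro bdd_aboveI2[where M=B])
qed

text \<open>For a continuous distribution function the quantile function preserves and reflects the
  order, hence it leaves every rank statistic unchanged.\<close>

lemma quantile_transform:
  assumes F: "prob_space Fd" "sets Fd = sets borel" and ac: "absolutely_continuous lborel Fd"
  obtains q :: "real \<Rightarrow> real" where "q \<in> borel_measurable unif" "distr unif borel q = Fd"
    "\<And>u v. u \<in> {0<..<1} \<Longrightarrow> v \<in> {0<..<1} \<Longrightarrow> q u \<le> q v \<longleftrightarrow> u \<le> v"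
proof -
  interpret F: real_distribution Fd
    using F by (simp add: real_distribution_def real_distribution_axioms_def)
  interpret F: cdf_distribution Fd ..
  have atom: "measure Fd {x} = 0" for x
  proof -
    have "{x} \<in> null_sets lborel" by (simp add: null_sets_def)
    then have "{x} \<in> null_sets Fd" using ac by (auto simp: absolutely_continuous_def)
    then show ?thesis by (simp add: null_sets_def measure_def)
  qed
  \<comment> \<open>Absolute continuity excludes atoms, so the distribution function is continuous.
    A value above \<open>v\<close> at the quantile would persist slightly to its left, contradicting
    minimality, so the generalised inverse is a right inverse.\<close>
  have CI: "cdf Fd (F.I v) = v" if v: "v \<in> {0<..<1}" for v
  proof (rule antisym)
    show "v \<le> cdf Fd (F.I v)" using F.pseudoinverse[of v "F.I v"] v by auto
    show "cdf Fd (F.I v) \<le> v"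
    proof (rule ccontr)
      assume less: "\<not> cdf Fd (F.I v) \<le> v"
      have "isCont (cdf Fd) (F.I v)" using atom by (simp add: F.isCont_cdf)
      then have "(cdf Fd \<longlongrightarrow> cdf Fd (F.I v)) (at_left (F.I v))"
        unfolding isCont_def by (rule tendsto_mono[rotated]) (simp add: at_le)
      then have "eventually (\<lambda>x. v < cdf Fd x) (at_left (F.I v))"
        using less by (intro order_tendstoD) auto
      moreover have "eventually (\<lambda>x. x < F.I v) (at_left (F.I v))"
        by (simp add: eventually_at_filter)
      ultimately have "eventually (\<lambda>x. v < cdf Fd x \<and> x < F.I v) (at_left (F.I v))"
        by (rule eventually_conj)
      then obtain x where "v < cdf Fd x" "x < F.I v"
        using eventually_happens'[OF trivial_limit_at_left_real] by blast
      then show False using F.pseudoinverse[of v x] v by auto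
    qed
  qed
  show thesis
  proof (rule that[of F.I])
    show "F.I \<in> borel_measurable unif"
      using F.measurable_CI measurable_cong_sets[OF sets_unif refl] by blast
    show "distr unif borel F.I = Fd" by (rule F.distr_I_eq_M)
    show "F.I u \<le> F.I v \<longleftrightarrow> u \<le> v" if "u \<in> {0<..<1}" "v \<in> {0<..<1}" for u v
      using F.pseudoinverse[of u "F.I v"] CI that by auto
  qed
qed

text \<open>By independence the joint law is the image of the uniform product under the quantile
  function applied coordinatewise. The statistic reads the sample only through comparisons of
  observations, so this map leaves it unchanged.\<close>

lemma rank_statistic_uniform:
  fixes Z :: "'s \<Rightarrow> 'a \<Rightarrow> real" and \<psi> :: "'k \<Rightarrow> real \<Rightarrow> real" and c m t :: real
  assumes N: "prob_space N" and S: "finite S" "S \<noteq> {}" and K: "finite K"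
    and indep: "prob_space.indep_vars N (\<lambda>_. borel) Z S"
    and distr: "\<And>s. s \<in> S \<Longrightarrow> distr N borel (Z s) = Fd"
    and ac: "absolutely_continuous lborel Fd"
    and sub: "I \<subseteq> S" "J \<subseteq> S"
    and cont: "\<And>k. k \<in> K \<Longrightarrow> continuous_on {0..1} (\<psi> k)"
  defines "T \<equiv> \<lambda>k x. c * ((\<Sum>j\<in>J. \<psi> k (ecdf I x (x j))) / m)"
  shows "measure N {\<omega> \<in> space N. \<forall>k\<in>K. \<bar>T k (\<lambda>s. Z s \<omega>)\<bar> < t}
      = measure (unifs S) {x \<in> space (unifs S). \<forall>k\<in>K. \<bar>T k x\<bar> < t}"
    and "{\<omega> \<in> space N. \<forall>k\<in>K. \<bar>T k (\<lambda>s. Z s \<omega>)\<bar> < t} \<in> sets N"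
proof -
  interpret N: prob_space N by (rule N)
  have rv: "Z s \<in> borel_measurable N" if "s \<in> S" for s
    using indep that by (auto simp: N.indep_vars_def)
  obtain s where s: "s \<in> S" using S by auto
  have Fd: "prob_space Fd" "sets Fd = sets borel"
    using N.prob_space_distr[OF rv[OF s]] sets_distr[of N borel "Z s"] unfolding distr[OF s] by this
  then obtain q where q: "q \<in> borel_measurable unif" "distr unif borel q = Fd"
    "\<And>u v. u \<in> {0<..<1} \<Longrightarrow> v \<in> {0<..<1} \<Longrightarrow> q u \<le> q v \<longleftrightarrow> u \<le> v"
    using quantile_transform[OF _ _ ac] by blast
  have sets: "sets (Pi\<^sub>M S (\<lambda>_. Fd)) = sets (Pi\<^sub>M S (\<lambda>_. borel))"
    using Fd by (intro sets_PiM_cong) auto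
  let ?B = "Pi\<^sub>M S (\<lambda>_. borel :: real measure)"
  \<comment> \<open>Points of the product space are fixed outside \<open>S\<close>, whereas
    \<open>\<lambda>s. Z s \<omega>\<close> is not. This permits passing between the two.\<close>
  have T_cong: "T k x = T k y" if "\<And>s. s \<in> S \<Longrightarrow> x s = y s" for k x y
  proof -
    have "ecdf I x = ecdf I y" using that sub by (intro ext ecdf_cong) auto
    then show ?thesis unfolding T_def using that sub by (auto intro!: sum.cong arg_cong2[where f="(/)"] simp: subset_iff)
  qed
  have T_meas: "T k \<in> borel_measurable ?B" if k: "k \<in> K" for k
    unfolding T_def using sub ecdf_bounds
    by (intro borel_measurable_times borel_measurable_divide borel_measurable_sum borel_measurable_const
        borel_measurable_continuous_01[OF cont[OF k]] borel_measurable_ecdf measurable_component_singleton) auto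
  define E where "E = {x \<in> space ?B. \<forall>k\<in>K. \<bar>T k x\<bar> < t}"
  have E: "E \<in> sets ?B"
    unfolding E_def using T_meas K by (intro sets.sets_Collect_finite_All) auto
  have Zm: "(\<lambda>\<omega>. \<lambda>s\<in>S. Z s \<omega>) \<in> N \<rightarrow>\<^sub>M ?B"
    using rv by (intro measurable_restrict)
  have pre: "(\<lambda>\<omega>. \<lambda>s\<in>S. Z s \<omega>) -` E \<inter> space N = {\<omega> \<in> space N. \<forall>k\<in>K. \<bar>T k (\<lambda>s. Z s \<omega>)\<bar> < t}"
  proof -
    have "T k (\<lambda>s\<in>S. Z s \<omega>) = T k (\<lambda>s. Z s \<omega>)" for k \<omega> by (rule T_cong) simp
    then show ?thesis by (auto simp: E_def space_PiM)
  qed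
  show "{\<omega> \<in> space N. \<forall>k\<in>K. \<bar>T k (\<lambda>s. Z s \<omega>)\<bar> < t} \<in> sets N"
    unfolding pre[symmetric] by (rule measurable_sets[OF Zm E])
  have "distr N ?B (\<lambda>\<omega>. \<lambda>s\<in>S. Z s \<omega>) = Pi\<^sub>M S (\<lambda>s. distr N borel (Z s))"
    using N.indep_vars_iff_distr_eq_PiM'[OF S(2), of Z "\<lambda>_. borel"] rv indep by simp
  also have "\<dots> = Pi\<^sub>M S (\<lambda>_. Fd)"
    using distr by (intro PiM_cong) auto
  also have "\<dots> = Pi\<^sub>M S (\<lambda>_. distr unif Fd q)"
    using Fd q(2) by (intro PiM_cong refl) (metis distr_cong)
  also have "\<dots> = distr (unifs S) (Pi\<^sub>M S (\<lambda>_. Fd)) (compose S q)"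
    using S Fd q(1) prob_space_unif measurable_cong_sets[OF refl Fd(2), of unif]
    by (intro distr_PiM_finite_prob_space'[symmetric]) auto
  also have "\<dots> = distr (unifs S) ?B (compose S q)"
    by (intro distr_cong sets refl)
  finally have law: "distr N ?B (\<lambda>\<omega>. \<lambda>s\<in>S. Z s \<omega>) = distr (unifs S) ?B (compose S q)" .
  have qm: "compose S q \<in> unifs S \<rightarrow>\<^sub>M ?B"
    unfolding compose_def
    by (intro measurable_restrict measurable_compose[OF measurable_component_singleton[where M="\<lambda>_. unif"] q(1)])
  \<comment> \<open>Each indicator in the empirical distribution function compares two coordinates,
    and \<open>q\<close> preserves and reflects that comparison.\<close>
  have "T k (compose S q x) = T k x" if x: "x \<in> space (unifs S)" for k x
  proof -
    have x01: "x s \<in> {0<..<1}" if "s \<in> S" for s using x that by (auto simp: space_PiM space_unif PiE_iff)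
    have "ecdf I (compose S q x) (compose S q x j) = ecdf I x (x j)" if "j \<in> J" for j
      unfolding ecdf_def using sub that x01
      by (intro arg_cong2[where f="(/)"] sum.cong refl arg_cong[where f=of_bool]) (auto simp: compose_def q(3) subset_iff)
    then show ?thesis unfolding T_def by (simp cong: sum.cong)
  qed
  then have pre2: "compose S q -` E \<inter> space (unifs S) = {x \<in> space (unifs S). \<forall>k\<in>K. \<bar>T k x\<bar> < t}"
    using measurable_space[OF qm] by (auto simp: E_def)
  have "measure N ((\<lambda>\<omega>. \<lambda>s\<in>S. Z s \<omega>) -` E \<inter> space N) = measure (unifs S) (compose S q -` E \<inter> space (unifs S))"
    using measure_distr[OF Zm E] measure_distr[OF qm E] law by simp
  then show "measure N {\<omega> \<in> space N. \<forall>k\<in>K. \<bar>T k (\<lambda>s. Z s \<omega>)\<bar> < t}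
      = measure (unifs S) {x \<in> space (unifs S). \<forall>k\<in>K. \<bar>T k x\<bar> < t}"
    unfolding pre pre2 .
qed

section \<open>The test statistic on the disjoint union of the samples\<close>

lemma emp_cdf_ecdf: "emp_cdf n (\<lambda>i. x (Inl i)) v = ecdf (Inl ` {1..n}) x v"
proof -
  have "(\<Sum>i\<in>Inl ` {1..n}. of_bool (x i \<le> v)) = (\<Sum>i\<in>{1..n}. of_bool (x (Inl i) \<le> v) :: real)"
    by (subst sum.reindex) auto
  also have "\<dots> = real (card {i \<in> {1..n}. x (Inl i) \<le> v})"
    by (simp add: of_bool_def sum.If_cases Int_def conj_commute)
  finally show ?thesis
    by (simp add: emp_cdf_def ecdf_def card_image)
qed

text \<open>Acceptance becomes membership of all coefficients in an open cube. The nonnegative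
  normalising factor can be moved through the maximum, which is over a nonempty set because
  \<open>d \<ge> 1\<close>.\<close>

lemma Psi_hat_less_iff:
  assumes "d \<ge> 1"
  shows "Psi_hat n m d psi (\<lambda>i. x (Inl i)) (\<lambda>j. x (Inr j)) < t \<longleftrightarrow>
    (\<forall>k\<in>{1..d}. \<bar>sqrt (real n * real m / (real n + real m)) *
      ((\<Sum>j\<in>Inr ` {1..m}. psi k (ecdf (Inl ` {1..n}) x (x j))) / real m)\<bar> < t)"
proof -
  define c where "c = sqrt (real n * real m / (real n + real m))"
  have c: "c \<ge> 0" by (simp add: c_def)
  have hat: "psi_hat n m (psi k) (\<lambda>i. x (Inl i)) (\<lambda>j. x (Inr j)) = (\<Sum>j\<in>Inr ` {1..m}. psi k (ecdf (Inl ` {1..n}) x (x j))) / real m" for k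
    unfolding psi_hat_def emp_cdf_ecdf by (subst sum.reindex) auto
  let ?f = "\<lambda>k. \<bar>psi_hat n m (psi k) (\<lambda>i. x (Inl i)) (\<lambda>j. x (Inr j))\<bar>"
  have "Psi_hat n m d psi (\<lambda>i. x (Inl i)) (\<lambda>j. x (Inr j)) = c * Max (?f ` {1..d})"
    by (simp add: Psi_hat_def c_def)
  also have "\<dots> = Max ((\<lambda>y. c * y) ` ?f ` {1..d})"
    using assms c by (intro mono_Max_commute) (auto simp: mono_def mult_left_mono)
  finally have "Psi_hat n m d psi (\<lambda>i. x (Inl i)) (\<lambda>j. x (Inr j)) = Max ((\<lambda>k. c * ?f k) ` {1..d})"
    by (simp add: image_image)
  then have "Psi_hat n m d psi (\<lambda>i. x (Inl i)) (\<lambda>j. x (Inr j)) < t \<longleftrightarrow> (\<forall>k\<in>{1..d}. c * ?f k < t)"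
    using assms by (simp add: Max_less_iff)
  also have "\<dots> \<longleftrightarrow> (\<forall>k\<in>{1..d}. \<bar>c * (psi_hat n m (psi k) (\<lambda>i. x (Inl i)) (\<lambda>j. x (Inr j)))\<bar> < t)"
    using c by (simp add: abs_mult)
  finally show ?thesis unfolding hat c_def .
qed

section \<open>Asymptotics\<close>

text \<open>The parameters are tuned so that \<open>h * D = sqrt 2 * \<epsilon>\<close>, while
  \<open>\<beta> * h\<close> and \<open>x * \<eta>\<^sup>2 / 2\<close> both equal
  \<open>2 * L\<close>. The resulting factors \<open>exp (- (2 * L)) = 1 / x\<^sup>2\<close> absorb
  every count of order \<open>x\<close>, and \<open>D\<^sup>2 = 2 * L\<close> is the least choice
  for which dimensions up to \<open>x\<close> are admissible.\<close>

lemma error_bound_rate: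
  fixes x L m d c0 \<epsilon> B0 B1 B2 :: real
  assumes x: "x \<ge> 3" and L: "L = ln x" "L \<ge> 1" and m: "m \<le> x" "c0 * x \<le> m" and c0: "0 < c0"
    and d: "0 \<le> d" "d \<le> x" and \<epsilon>: "0 < \<epsilon>"
    and B0: "0 \<le> B0" "B0 \<le> x powr (1/6)"
    and B1: "0 < B1" "L powr (3/2) * B1 * x powr (-1/2) \<le> \<epsilon> / 12"
    and B2: "0 \<le> B2"
  defines "h \<equiv> \<epsilon> * L powr (-1/2)" and "D \<equiv> sqrt 2 * L powr (1/2)" and "\<beta> \<equiv> 2 * L powr (3/2) / \<epsilon>"
    and "\<eta> \<equiv> 2 * L powr (1/2) * x powr (-1/2)" and "A \<equiv> x powr (1/12)"
    and "a \<equiv> x powr (-1/2) / sqrt c0" and "c \<equiv> sqrt (x * m / (x + m))"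
  shows "4 * exp 4 * h * D
      + 13/6 * \<beta>^3 * a * (B0\<^sup>2 * exp (2 * \<beta> * a * B0) + A^3 + d * normal_moment16 / A^13)
      + (2 * d + 1) * exp (- \<beta> * h)
      + 2 * (x + 1) * exp (- (x * \<eta>\<^sup>2 / 2))
      + 2 * d * exp (- (m * (h / c)\<^sup>2 / (2 * (2 * B1 * (\<eta> + 1 / x))\<^sup>2)))
      + c * B2 / (x * h)
    \<le> 4 * exp 4 * sqrt 2 * \<epsilon>
      + 52 / (3 * \<epsilon>^3 * sqrt c0) * (L powr (9/2) * x powr (-1/6) * exp (4 / (\<epsilon> * sqrt c0) * (L powr (3/2) * x powr (-1/3)))
         + L powr (9/2) * x powr (-1/4) + normal_moment16 * (L powr (9/2) * x powr (-1/2)))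
      + (2 * x + 1) / x\<^sup>2 + 2 * (x + 1) / x\<^sup>2 + 2 / x + L powr (1/2) * B2 * x powr (-1/2) / \<epsilon>" (is ?bound)
    and "c / x \<le> a" "c / m \<le> a" "D \<ge> 1" "x \<le> exp (D\<^sup>2 / 2)" "\<epsilon> \<le> 1/6 \<Longrightarrow> 4 * h * D \<le> 1"
proof -
  have x0: "x > 0" and L0: "L > 0" using x L by auto
  have m0: "m > 0" using m c0 x0 by (smt (verit) mult_pos_pos)
  have hD: "h * D = sqrt 2 * \<epsilon>"
    using L0 by (simp add: h_def D_def flip: powr_add)
  have D2: "D\<^sup>2 = 2 * L"
    using L0 by (simp add: D_def power_mult_distrib powr_half_sqrt)
  show "x \<le> exp (D\<^sup>2 / 2)" using x0 unfolding D2 L by simp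
  have "1 \<le> sqrt 2 * L powr (1/2)"
    using L mult_mono[of 1 "sqrt 2" 1 "L powr (1/2)"] by (simp add: ge_one_powr_ge_zero)
  then show "D \<ge> 1" by (simp add: D_def)
  show "4 * h * D \<le> 1" if "\<epsilon> \<le> 1/6"
  proof -
    have "sqrt 2 \<le> 3/2" by (rule real_le_lsqrt) (auto simp: power2_eq_square)
    then have "sqrt 2 * \<epsilon> \<le> 3/2 * (1/6)" using that \<epsilon> by (intro mult_mono) auto
    then show ?thesis using hD by simp
  qed
  have c: "c > 0" using x0 m0 by (simp add: c_def)
  have c2: "c\<^sup>2 = x * m / (x + m)" using x0 m0 by (simp add: c_def)
  have c2m: "c\<^sup>2 \<le> m" unfolding c2 using x0 m0 by (simp add: field_simps)
  have c2x: "c\<^sup>2 \<le> x" unfolding c2 using x0 m0 by (simp add: field_simps)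
  have cx: "c \<le> sqrt x" using c2x by (intro real_le_rsqrt)
  have cm: "c \<le> sqrt m" using c2m by (intro real_le_rsqrt)
  have a_eq: "a = 1 / sqrt (c0 * x)"
    using x0 c0 by (simp add: a_def powr_minus powr_half_sqrt real_sqrt_mult field_simps)
  \<comment> \<open>The normalisation is at most \<open>sqrt m\<close>, and the balance condition
    \<open>c0 * x \<le> m\<close> bounds the larger weight by a multiple of
    \<open>x powr (-1/2)\<close>.\<close>
  have "c / m \<le> sqrt m / m" using cm m0 by (intro divide_right_mono) auto
  also have "\<dots> = 1 / sqrt m" using m0 by (simp add: field_simps)
  also have "\<dots> \<le> 1 / sqrt (c0 * x)" using m c0 x0 m0 by (intro divide_left_mono) auto
  finally show cma: "c / m \<le> a" by (simp add: a_eq)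
  have "c / x \<le> c / m" using m m0 c x0 by (intro divide_left_mono) auto
  then show "c / x \<le> a" using cma by simp
  have a0: "a > 0" using x0 c0 by (simp add: a_def)
  have \<beta>0: "\<beta> > 0" using L0 \<epsilon> by (simp add: \<beta>_def)
  have nm: "normal_moment16 \<ge> 0" by (simp add: normal_moment16_def)
  define C1 where "C1 = 52 / (3 * \<epsilon>^3 * sqrt c0)"
  have C1: "C1 \<ge> 0" using \<epsilon> c0 by (simp add: C1_def)
  have pw: "(y powr r) ^ k = y powr (r * real k)" if "y > 0" for y r :: real and k
    using that by (simp add: powr_powr flip: powr_realpow)
  \<comment> \<open>The exponent 9/2 is the cube of the \<open>L powr (3/2)\<close> in
    \<beta>.\<close>
  have \<beta>3a: "13/6 * \<beta>^3 * a = C1 * (L powr (9/2) * x powr (-1/2))"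
    using \<epsilon> c0 L0 by (simp add: \<beta>_def a_def C1_def power_mult_distrib power_divide pw field_simps)
  have t1: "4 * exp 4 * h * D = 4 * exp 4 * sqrt 2 * \<epsilon>" using hD by simp
  have t2: "13/6 * \<beta>^3 * a * (B0\<^sup>2 * exp (2 * \<beta> * a * B0) + A^3 + d * normal_moment16 / A^13)
    \<le> C1 * (L powr (9/2) * x powr (-1/6) * exp (4 / (\<epsilon> * sqrt c0) * (L powr (3/2) * x powr (-1/3)))
         + L powr (9/2) * x powr (-1/4) + normal_moment16 * (L powr (9/2) * x powr (-1/2)))"
  proof -
    have "B0\<^sup>2 \<le> (x powr (1/6))\<^sup>2" using B0 by (intro power_mono)
    also have "\<dots> = x powr (1/3)" using x0 by (simp add: pw)
    finally have e1: "B0\<^sup>2 \<le> x powr (1/3)" .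
    have "2 * \<beta> * a * B0 \<le> 2 * \<beta> * a * x powr (1/6)" using B0 \<beta>0 a0 by (intro mult_left_mono) auto
    also have "\<dots> = 4 / (\<epsilon> * sqrt c0) * (L powr (3/2) * (x powr (-1/2) * x powr (1/6)))"
      by (simp add: \<beta>_def a_def)
    also have "x powr (-1/2) * x powr (1/6) = x powr (-1/3)" by (simp flip: powr_add)
    finally have e2: "exp (2 * \<beta> * a * B0) \<le> exp (4 / (\<epsilon> * sqrt c0) * (L powr (3/2) * x powr (-1/3)))"
      by simp
    have e3: "A^3 = x powr (1/4)" using x0 by (simp add: A_def pw)
    \<comment> \<open>The truncation level \<open>x powr (1/12)\<close> is a compromise: its 13th
      power exceeds \<open>x\<close>, hence the dimension, while its cube is only
      \<open>x powr (1/4)\<close> and loses against the weight \<open>x powr (-1/2)\<close>.\<close>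
    have "x = x powr 1" using x0 by simp
    also have "\<dots> \<le> x powr (13/12)" using x by (intro powr_mono) auto
    also have "\<dots> = A^13" using x0 by (simp add: A_def pw)
    finally have "d \<le> A^13" using d by simp
    then have "d / A^13 \<le> 1" using x0 by (simp add: A_def)
    then have e4: "d * normal_moment16 / A^13 \<le> normal_moment16"
      using mult_right_mono[of "d / A^13" 1 normal_moment16] nm by simp
    have "B0\<^sup>2 * exp (2 * \<beta> * a * B0) + A^3 + d * normal_moment16 / A^13
      \<le> x powr (1/3) * exp (4 / (\<epsilon> * sqrt c0) * (L powr (3/2) * x powr (-1/3))) + x powr (1/4) + normal_moment16"
      using e1 e2 e3 e4 by (intro add_mono mult_mono) auto
    then have "13/6 * \<beta>^3 * a * (B0\<^sup>2 * exp (2 * \<beta> * a * B0) + A^3 + d * normal_moment16 / A^13)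
      \<le> C1 * (L powr (9/2) * x powr (-1/2)) * (x powr (1/3) * exp (4 / (\<epsilon> * sqrt c0) * (L powr (3/2) * x powr (-1/3))) + x powr (1/4) + normal_moment16)"
      unfolding \<beta>3a using C1 by (intro mult_left_mono) auto
    also have "\<dots> = C1 * (L powr (9/2) * (x powr (-1/2) * x powr (1/3)) * exp (4 / (\<epsilon> * sqrt c0) * (L powr (3/2) * x powr (-1/3)))
         + L powr (9/2) * (x powr (-1/2) * x powr (1/4)) + normal_moment16 * (L powr (9/2) * x powr (-1/2)))"
      by (simp add: algebra_simps)
    also have "x powr (-1/2) * x powr (1/3) = x powr (-1/6)" by (simp flip: powr_add)
    also have "x powr (-1/2) * x powr (1/4) = x powr (-1/4)" by (simp flip: powr_add)
    finally show ?thesis .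
  qed
  have exp2L: "exp (- (2 * L)) = 1 / x\<^sup>2"
    using x0 by (simp add: L exp_minus exp_double inverse_eq_divide)
  have "\<beta> * h = 2 * (L powr (3/2) * L powr (-1/2))" using \<epsilon> by (simp add: \<beta>_def h_def)
  also have "\<dots> = 2 * L" using L0 by (simp flip: powr_add)
  finally have \<beta>h: "- \<beta> * h = - (2 * L)" by simp
  have t3: "(2 * d + 1) * exp (- \<beta> * h) \<le> (2 * x + 1) / x\<^sup>2"
    unfolding \<beta>h exp2L using d by (simp add: divide_right_mono)
  have "\<eta>\<^sup>2 = 4 * (L * (1 / x))"
    using L0 x0 by (simp add: \<eta>_def power_mult_distrib power_divide pw powr_minus inverse_eq_divide)
  then have "x * \<eta>\<^sup>2 / 2 = 2 * L" using x0 by simp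
  then have t4: "2 * (x + 1) * exp (- (x * \<eta>\<^sup>2 / 2)) = 2 * (x + 1) / x\<^sup>2"
    by (simp only: exp2L) simp
  have t5: "2 * d * exp (- (m * (h / c)\<^sup>2 / (2 * (2 * B1 * (\<eta> + 1 / x))\<^sup>2))) \<le> 2 / x"
  proof -
    \<comment> \<open>The quantity bounded by the assumption on \<open>B1\<close>. The discrepancy
      level is at most 3 times \<open>L powr (1/2) * x powr (-1/2)\<close> and Hoeffding's bound has
      the factor 2, so \<open>\<epsilon> / 12\<close> gives \<open>\<epsilon> / (2 * L)\<close>,
      just what an exponent of \<open>2 * L\<close> requires.\<close>
    define y where "y = L powr (3/2) * B1 * x powr (-1/2)"
    have y: "0 < y" "y \<le> \<epsilon> / 12" using B1 L0 x0 by (auto simp: y_def)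
    have "1 / x \<le> x powr (-1/2)"
      using powr_mono[of "-1" "-1/2" x] x by (simp add: powr_minus inverse_eq_divide)
    also have "\<dots> \<le> L powr (1/2) * x powr (-1/2)"
      using L mult_right_mono[of 1 "L powr (1/2)" "x powr (-1/2)"] by (simp add: ge_one_powr_ge_zero)
    finally have "\<eta> + 1 / x \<le> 3 * (L powr (1/2) * x powr (-1/2))" by (simp add: \<eta>_def)
    then have "2 * B1 * (\<eta> + 1 / x) \<le> 2 * B1 * (3 * (L powr (1/2) * x powr (-1/2)))"
      using B1 by (intro mult_left_mono) auto
    also have "L powr (1/2) = L powr (-1) * L powr (3/2)"
      by (simp only: powr_add[symmetric]) simp
    also have "2 * B1 * (3 * (L powr (-1) * L powr (3/2) * x powr (-1/2))) = 6 * y / L" using L0 by (simp add: y_def powr_minus inverse_eq_divide mult_ac)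
    finally have le: "2 * B1 * (\<eta> + 1 / x) \<le> 6 * y / L" .
    have \<eta>0: "\<eta> > 0" using L0 x0 by (simp add: \<eta>_def)
    then have pos: "0 < 2 * B1 * (\<eta> + 1 / x)" using B1 x0 by (intro mult_pos_pos add_pos_pos) auto
    have "6 * y / L \<le> 6 * (\<epsilon> / 12) / L" using y L0 by (intro divide_right_mono) auto
    then have le2: "2 * B1 * (\<eta> + 1 / x) \<le> \<epsilon> / (2 * L)" using le by simp
    then have "(2 * B1 * (\<eta> + 1 / x))\<^sup>2 \<le> (\<epsilon> / (2 * L))\<^sup>2" using pos by (intro power_mono) auto
    then have q: "2 * L * (2 * (2 * B1 * (\<eta> + 1 / x))\<^sup>2) \<le> 2 * L * (2 * (\<epsilon> / (2 * L))\<^sup>2)"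
      using L0 by (intro mult_left_mono) auto
    also have "\<dots> = \<epsilon>\<^sup>2 / L" using L0 by (simp add: power2_eq_square field_simps)
    also have "\<dots> = h\<^sup>2" using L0 by (simp add: h_def power_mult_distrib power_divide pw powr_minus inverse_eq_divide)
    also have "\<dots> \<le> m * (h / c)\<^sup>2"
    proof -
      have "h\<^sup>2 * c\<^sup>2 \<le> h\<^sup>2 * m" using c2m by (intro mult_left_mono) auto
      then show ?thesis using c by (simp add: power_divide pos_le_divide_eq mult.commute)
    qed
    finally have "2 * L \<le> m * (h / c)\<^sup>2 / (2 * (2 * B1 * (\<eta> + 1 / x))\<^sup>2)"
      using pos by (subst pos_le_divide_eq) auto
    then have "exp (- (m * (h / c)\<^sup>2 / (2 * (2 * B1 * (\<eta> + 1 / x))\<^sup>2))) \<le> 1 / x\<^sup>2"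
      unfolding exp2L[symmetric] by simp
    then have "2 * d * exp (- (m * (h / c)\<^sup>2 / (2 * (2 * B1 * (\<eta> + 1 / x))\<^sup>2))) \<le> 2 * x * (1 / x\<^sup>2)"
      using d x0 by (intro mult_mono) auto
    then show ?thesis using x0 by (simp add: power2_eq_square)
  qed
  have h0: "h > 0" using \<epsilon> L0 by (simp add: h_def)
  have "c * B2 / (x * h) \<le> sqrt x * B2 / (x * h)"
    using cx B2 x0 h0 by (intro divide_right_mono mult_right_mono) auto
  also have "\<dots> = L powr (1/2) * B2 * x powr (-1/2) / \<epsilon>"
    using x0 L0 \<epsilon> by (simp add: h_def powr_minus powr_half_sqrt field_simps)
  finally have t6: "c * B2 / (x * h) \<le> L powr (1/2) * B2 * x powr (-1/2) / \<epsilon>" .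
  show ?bound
    unfolding C1_def[symmetric] using t1 t2 t3 t4 t5 t6 by linarith
qed

text \<open>With \<epsilon> fixed, \<open>C1\<close> and \<open>C2\<close> are constants: every
  power of the logarithm is beaten by a negative power of \<open>n\<close>, and the exponential
  factor tends to 1.\<close>

lemma error_rate_tendsto_0:
  fixes C1 C2 :: real
  shows "(\<lambda>n. C1 * (ln (real n) powr (9/2) * real n powr (-1/6) * exp (C2 * (ln (real n) powr (3/2) * real n powr (-1/3)))
         + ln (real n) powr (9/2) * real n powr (-1/4) + normal_moment16 * (ln (real n) powr (9/2) * real n powr (-1/2)))
      + (2 * real n + 1) / (real n)\<^sup>2 + 2 * (real n + 1) / (real n)\<^sup>2 + 2 / real n) \<longlonglongrightarrow> 0"
proof -
  have "(\<lambda>n. ln (real n) powr (9/2) * real n powr (-1/6)) \<longlonglongrightarrow> 0"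
    "(\<lambda>n. ln (real n) powr (3/2) * real n powr (-1/3)) \<longlonglongrightarrow> 0"
    "(\<lambda>n. ln (real n) powr (9/2) * real n powr (-1/4)) \<longlonglongrightarrow> 0"
    "(\<lambda>n. ln (real n) powr (9/2) * real n powr (-1/2)) \<longlonglongrightarrow> 0"
    "(\<lambda>n. (2 * real n + 1) / (real n)\<^sup>2) \<longlonglongrightarrow> 0"
    "(\<lambda>n. 2 * (real n + 1) / (real n)\<^sup>2) \<longlonglongrightarrow> 0"
    "(\<lambda>n. 2 / real n) \<longlonglongrightarrow> 0"
    by real_asymp+
  then have "(\<lambda>n. C1 * (ln (real n) powr (9/2) * real n powr (-1/6) * exp (C2 * (ln (real n) powr (3/2) * real n powr (-1/3)))
         + ln (real n) powr (9/2) * real n powr (-1/4) + normal_moment16 * (ln (real n) powr (9/2) * real n powr (-1/2)))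
      + (2 * real n + 1) / (real n)\<^sup>2 + 2 * (real n + 1) / (real n)\<^sup>2 + 2 / real n)
    \<longlonglongrightarrow> C1 * (0 * exp (C2 * 0) + 0 + normal_moment16 * 0) + 0 + 0 + 0"
    by (intro tendsto_intros)
  then show ?thesis by simp
qed

theorem theorem1:
  fixes M :: "nat \<Rightarrow> 'a measure"
    and X Y :: "nat \<Rightarrow> nat \<Rightarrow> 'a \<Rightarrow> real"
    and Fd :: "real measure"
    and m d :: "nat \<Rightarrow> nat"
    and c0 :: real
    and psi psi1 psi2 :: "nat \<Rightarrow> nat \<Rightarrow> real \<Rightarrow> real"
  assumes prob: "\<And>n. prob_space (M n)"
    and indep: "\<And>n. n \<ge> 1 \<Longrightarrow> prob_space.indep_vars (M n) (\<lambda>_. borel)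
              (\<lambda>s. case s of Inl i \<Rightarrow> X n i | Inr j \<Rightarrow> Y n j) ({1..n} <+> {1..m n})"
    and F_ac: "absolutely_continuous lborel Fd"
    and X_distr: "\<And>n i. n \<ge> 1 \<Longrightarrow> i \<in> {1..n} \<Longrightarrow> distr (M n) borel (X n i) = Fd"
    and Y_distr_H0: "\<And>n j. n \<ge> 1 \<Longrightarrow> j \<in> {1..m n} \<Longrightarrow> distr (M n) borel (Y n j) = Fd"
    and c0: "0 < c0" "c0 \<le> 1"
    and m_bounds: "\<And>n. n \<ge> 1 \<Longrightarrow> c0 * real n \<le> real (m n) \<and> m n \<le> n"
    and d_bounds: "\<And>n. n \<ge> 1 \<Longrightarrow> 1 \<le> d n \<and> d n \<le> m n"
    and psi0: "\<And>n z. z \<in> {0..1} \<Longrightarrow> psi n 0 z = 1"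
    and deriv1: "\<And>n k z. k \<le> d n \<Longrightarrow> z \<in> {0..1} \<Longrightarrow>
                   (psi n k has_real_derivative psi1 n k z) (at z within {0..1})"
    and deriv2: "\<And>n k z. k \<le> d n \<Longrightarrow> z \<in> {0..1} \<Longrightarrow>
                   (psi1 n k has_real_derivative psi2 n k z) (at z within {0..1})"
    and orthonormal: "\<And>n k l. k \<le> d n \<Longrightarrow> l \<le> d n \<Longrightarrow>
                   integral {0..1} (\<lambda>z. psi n k z * psi n l z) = (if k = l then 1 else 0)"
    and psi2_bdd: "\<And>n k. k \<in> {1..d n} \<Longrightarrow> bdd_above ((\<lambda>z. \<bar>psi2 n k z\<bar>) ` {0..1})"
    and rate0: "(\<lambda>n. ln (real n) powr (7/6) * Bsup (psi n) (d n)) \<in> o(\<lambda>n. real n powr (1/6))"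
    and rate1: "(\<lambda>n. ln (real n) powr (3/2) * Bsup (psi1 n) (d n)) \<in> o(\<lambda>n. real n powr (1/2))"
    and rate2: "(\<lambda>n. ln (real n) powr (1/2) * Bsup (psi2 n) (d n)) \<in> o(\<lambda>n. real n powr (1/2))"
  shows "(\<lambda>n. SUP \<alpha>\<in>{0<..<1::real}.
            \<bar>measure (M n) {\<omega> \<in> space (M n).
                 Psi_hat n (m n) (d n) (psi n) (\<lambda>i. X n i \<omega>) (\<lambda>j. Y n j \<omega>) \<ge> c_alpha \<alpha> (d n)} - \<alpha>\<bar>)
         \<longlonglongrightarrow> 0"
proof -
  have d0: "1 \<le> d n" and m0: "1 \<le> m n" and mn: "m n \<le> n" and dn: "d n \<le> n" if "n \<ge> 1" for n
    using d_bounds[OF that] m_bounds[OF that] by auto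
  have cont: "continuous_on {0..1} (psi n k)" "continuous_on {0..1} (psi1 n k)" if "k \<le> d n" for n k
    using deriv1[OF that] deriv2[OF that] by (meson DERIV_continuous_on)+
  \<comment> \<open>Centring is orthogonality to the constant function
    \<open>psi n 0\<close>.\<close>
  have mean: "integral {0..1} (psi n k) = 0" if "k \<in> {1..d n}" for n k
  proof -
    have "integral {0..1} (\<lambda>z. psi n k z * psi n 0 z) = 0"
      using that orthonormal[of k n 0] by simp
    also have "integral {0..1} (\<lambda>z. psi n k z * psi n 0 z) = integral {0..1} (psi n k)"
      using psi0 by (intro integral_cong) auto
    finally show ?thesis .
  qed
  define B0 B1 B2 where "B0 n = Bsup (psi n) (d n)" and "B1 n = Bsup (psi1 n) (d n)" and "B2 n = Bsup (psi2 n) (d n)" for n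
  have B: "\<bar>psi n k z\<bar> \<le> B0 n" "\<bar>psi1 n k z\<bar> \<le> B1 n" "\<bar>psi2 n k z\<bar> \<le> B2 n"
    if "k \<in> {1..d n}" "z \<in> {0..1}" for n k z
    unfolding B0_def B1_def B2_def using that cont[of k n] psi2_bdd[of k n]
    by (auto intro!: Bsup_upper continuous_abs_bdd_above)
  have Bpos: "0 \<le> B0 n" "0 \<le> B1 n" "0 \<le> B2 n" if "n \<ge> 1" for n
    using B[of 1 n 0] d0[OF that] by (auto intro: order_trans[OF abs_ge_zero])
  \<comment> \<open>Collects the part of the error that vanishes as \<open>n\<close> grows with
    \<epsilon> held fixed.\<close>
  define V where "V \<epsilon> n = 52 / (3 * \<epsilon>^3 * sqrt c0) * (ln (real n) powr (9/2) * real n powr (-1/6)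
          * exp (4 / (\<epsilon> * sqrt c0) * (ln (real n) powr (3/2) * real n powr (-1/3)))
         + ln (real n) powr (9/2) * real n powr (-1/4) + normal_moment16 * (ln (real n) powr (9/2) * real n powr (-1/2)))
      + (2 * real n + 1) / (real n)\<^sup>2 + 2 * (real n + 1) / (real n)\<^sup>2 + 2 / real n
      + ln (real n) powr (1/2) * B2 n * real n powr (-1/2) / \<epsilon>" for \<epsilon> :: real and n :: nat
  let ?G = "\<lambda>n \<alpha>. {\<omega> \<in> space (M n). Psi_hat n (m n) (d n) (psi n) (\<lambda>i. X n i \<omega>) (\<lambda>j. Y n j \<omega>) \<ge> c_alpha \<alpha> (d n)}"
  \<comment> \<open>The right-hand side is free of \<alpha>, so the supremum over the levels
    inherits the bound.\<close>
  have key: "\<bar>measure (M n) (?G n \<alpha>) - \<alpha>\<bar> \<le> 4 * exp 4 * sqrt 2 * \<epsilon> + V \<epsilon> n"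
    if n: "n \<ge> 3" and \<epsilon>: "0 < \<epsilon>" "\<epsilon> \<le> 1/6" and r0: "B0 n \<le> real n powr (1/6)"
      and r1: "ln (real n) powr (3/2) * (B1 n + 1) * real n powr (-1/2) \<le> \<epsilon> / 12"
      and \<alpha>: "0 < \<alpha>" "\<alpha> < 1" for n \<epsilon> \<alpha>
  proof -
    have n1: "n \<ge> 1" using n by simp
    note dd = d0[OF n1] and mm = m0[OF n1] mn[OF n1] and dn' = dn[OF n1]
    interpret N: prob_space "M n" by (rule prob)
    let ?I = "Inl ` {1..n} :: (nat + nat) set" and ?J = "Inr ` {1..m n} :: (nat + nat) set"
    let ?Z = "\<lambda>s. case s of Inl i \<Rightarrow> X n i | Inr j \<Rightarrow> Y n j"
    let ?P = "unifs (?I \<union> ?J)"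
    have S: "{1..n} <+> {1..m n} = ?I \<union> ?J" by (simp add: Plus_def)
    have card: "card ?I = n" "card ?J = m n" by (simp_all add: card_image)
    define c where "c = sqrt (real n * real (m n) / (real n + real (m n)))"
    define T where "T k x = c * ((\<Sum>j\<in>?J. psi n k (ecdf ?I x (x j))) / real (m n))" for k and x :: "nat + nat \<Rightarrow> real"
    define t where "t = c_alpha \<alpha> (d n)"
    let ?ET = "{\<omega> \<in> space (M n). \<forall>k\<in>{1..d n}. \<bar>T k (\<lambda>s. ?Z s \<omega>)\<bar> < t}"
    have iff: "Psi_hat n (m n) (d n) (psi n) (\<lambda>i. X n i \<omega>) (\<lambda>j. Y n j \<omega>) < t \<longleftrightarrow> (\<forall>k\<in>{1..d n}. \<bar>T k (\<lambda>s. ?Z s \<omega>)\<bar> < t)" for \<omega>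
      using Psi_hat_less_iff[OF dd, where x = "\<lambda>s. ?Z s \<omega>"] by (simp add: T_def c_def)
    have distr: "distr (M n) borel (?Z s) = Fd" if "s \<in> ?I \<union> ?J" for s
      using that X_distr[OF n1] Y_distr_H0[OF n1] by auto
    have ne: "?I \<noteq> {}" "?J \<noteq> {}" using n1 mm by auto
    have indep': "N.indep_vars (\<lambda>_. borel) ?Z (?I \<union> ?J)"
      using indep[OF n1] unfolding S .
    have contK: "continuous_on {0..1} (psi n k)" if "k \<in> {1..d n}" for k
      using that by (intro cont) auto
    have fin: "finite (?I \<union> ?J)" and ne': "?I \<union> ?J \<noteq> {}" using ne by auto
    note rank = rank_statistic_uniform[where \<psi> = "psi n" and c = c and m = "real (m n)" and t = t,
        OF prob fin ne' finite_atLeastAtMost indep' distr F_ac Un_upper1 Un_upper2 contK]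
    have transfer1: "measure (M n) ?ET = measure ?P {x \<in> space ?P. \<forall>k\<in>{1..d n}. \<bar>T k x\<bar> < t}"
      unfolding T_def by (rule rank(1))
    have transfer2: "?ET \<in> sets (M n)"
      unfolding T_def by (rule rank(2))
    note pars = error_bound_rate[OF _ refl _ _ _ c0(1) _ _ \<epsilon>(1) Bpos(1)[OF n1] r0 _ r1 Bpos(3)[OF n1],
        of "real (m n)" "real (d n)"]
    \<comment> \<open>The threshold \<open>n \<ge> 3\<close> is there because
      \<open>exp 1 \<le> 3\<close>.\<close>
    have L1: "ln (real n) \<ge> 1"
      using n exp_le by (subst ln_ge_iff) auto
    have side: "real n \<ge> 3" "real (m n) \<le> real n" "c0 * real n \<le> real (m n)" "0 \<le> real (d n)" "real (d n) \<le> real n" "0 < B1 n + 1"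
      using n mm dn' m_bounds[OF n1] Bpos(2)[OF n1] by auto
    note pars = pars[OF side(1) L1 side(2-6)]
    have "\<bar>measure ?P {x \<in> space ?P. \<forall>k\<in>{1..d n}. \<bar>T k x\<bar> < t} - box_prob t ^ card {1..d n}\<bar> \<le> 4 * exp 4 * sqrt 2 * \<epsilon> + V \<epsilon> n"
    proof -
      define L where "L = ln (real n)"
      have L0: "L > 0" using L1 by (simp add: L_def)
      define h D \<beta> \<eta> A a where "h = \<epsilon> * L powr (-1/2)" and "D = sqrt 2 * L powr (1/2)"
        and "\<beta> = 2 * L powr (3/2) / \<epsilon>" and "\<eta> = 2 * L powr (1/2) * real n powr (-1/2)"
        and "A = real n powr (1/12)" and "a = real n powr (-1/2) / sqrt c0"
      note defs = h_def D_def \<beta>_def \<eta>_def A_def a_def L_def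
      have pos: "h > 0" "\<beta> > 0" "A > 0" "\<eta> > 0"
        using \<epsilon> L0 n by (simp_all add: h_def \<beta>_def A_def \<eta>_def)
      have D: "D \<ge> 1" "real (card {1..d n}) \<le> exp (D\<^sup>2 / 2)" "4 * h * D \<le> 1"
        using pars(4,5) pars(6)[OF \<epsilon>(2)] side(5) unfolding defs by simp_all
      have ca: "c / real (card ?I) \<le> a" "c / real (card ?J) \<le> a"
        unfolding card c_def using pars(2,3) by (simp_all add: defs)
      have disj: "?I \<inter> ?J = {}" by auto
      have fins: "finite ?I" "finite ?J" by auto
      have der1: "(psi n k has_real_derivative psi1 n k z) (at z within {0..1})"
        and der2: "(psi1 n k has_real_derivative psi2 n k z) (at z within {0..1})"
        if "k \<in> {1..d n}" "z \<in> {0..1}" for k z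
        using that by (auto intro: deriv1 deriv2)
      have orth: "integral {0..1} (\<lambda>z. psi n k z * psi n l z) = (if k = l then 1 else 0)"
        if "k \<in> {1..d n}" "l \<in> {1..d n}" for k l
        using that by (intro orthonormal) auto
      \<comment> \<open>The added 1 makes the derivative bound strictly positive, as needed where it
        stands in the denominator of Hoeffding's exponent.\<close>
      have b1: "\<bar>psi1 n k z\<bar> \<le> B1 n + 1" if "k \<in> {1..d n}" "z \<in> {0..1}" for k z
        using B(2)[OF that] by simp
      note bound = two_sample_bound(1)[where \<psi> = "psi n" and ?\<psi>1.0 = "psi1 n" and ?\<psi>2.0 = "psi2 n"
          and I = ?I and J = ?J and K = "{1..d n}" and ?B0.0 = "B0 n" and ?B1.0 = "B1 n + 1" and ?B2.0 = "B2 n"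
          and h = h and \<beta> = \<beta> and A = A and \<eta> = \<eta> and D = D and a = a and t = t, unfolded card,
          OF fins(1) ne(1) fins(2) ne(2) disj finite_atLeastAtMost der1 der2 mean orth
          B(1) Bpos(1)[OF n1] b1 side(6) B(3) Bpos(3)[OF n1] pos D ca[unfolded c_def card]]
      have "\<bar>measure ?P {x \<in> space ?P. \<forall>k\<in>{1..d n}. \<bar>T k x\<bar> < t} - box_prob t ^ card {1..d n}\<bar>
        \<le> 4 * exp 4 * h * D
          + 13/6 * \<beta>^3 * a * ((B0 n)\<^sup>2 * exp (2 * \<beta> * a * B0 n) + A^3 + real (card {1..d n}) * normal_moment16 / A^13)
          + (2 * real (card {1..d n}) + 1) * exp (- \<beta> * h)
          + 2 * (real n + 1) * exp (- (real n * \<eta>\<^sup>2 / 2))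
          + 2 * real (card {1..d n}) * exp (- (real (m n) * (h / c)\<^sup>2 / (2 * (2 * (B1 n + 1) * (\<eta> + 1 / real n))\<^sup>2)))
          + c * B2 n / (real n * h)"
        unfolding T_def c_def by (rule bound)
      also have "\<dots> \<le> 4 * exp 4 * sqrt 2 * \<epsilon> + V \<epsilon> n"
        using pars(1) unfolding V_def defs c_def by (simp only: card_atLeastAtMost diff_Suc_1 add_ac)
      finally show ?thesis .
    qed
    moreover have "box_prob t ^ card {1..d n} = 1 - \<alpha>"
      using box_prob_c_alpha[OF \<alpha> dd] by (simp add: t_def)
    \<comment> \<open>The rejection region is closed and the cube event open, so they are exact
      complements and no boundary probability has to be discussed.\<close>
    moreover have "?G n \<alpha> = space (M n) - ?ET"
      using iff by (auto simp: not_less[symmetric] t_def)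
    then have "measure (M n) (?G n \<alpha>) = 1 - measure (M n) ?ET"
      using transfer2 by (simp add: N.prob_compl)
    ultimately show ?thesis
      unfolding transfer1 by linarith
  qed
  have powr_minus_half: "y * real n powr (-1/2) = y / real n powr (1/2)" for y n
    by (simp add: powr_minus_divide)
  have ev0: "\<forall>\<^sub>F n in sequentially. B0 n \<le> real n powr (1/6)"
  proof -
    have "\<forall>\<^sub>F n in sequentially. norm (ln (real n) powr (7/6) * Bsup (psi n) (d n)) \<le> 1 * norm (real n powr (1/6))"
      by (rule landau_o.smallD[OF rate0]) simp
    then show ?thesis
      using eventually_ge_at_top[of 3]
    proof eventually_elim
      case (elim n)
      have "ln (real n) \<ge> 1" using elim exp_le by (subst ln_ge_iff) auto
      then have "1 * B0 n \<le> ln (real n) powr (7/6) * B0 n"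
        using Bpos(1)[of n] elim by (intro mult_right_mono ge_one_powr_ge_zero) auto
      then show ?case using elim Bpos(1)[of n] by (simp add: B0_def)
    qed
  qed
  \<comment> \<open>The extra 1 in the derivative bound is harmless because
    \<open>ln (real n) powr (3/2)\<close> is negligible against
    \<open>real n powr (1/2)\<close>.\<close>
  have lim1: "(\<lambda>n. ln (real n) powr (3/2) * (B1 n + 1) * real n powr (-1/2)) \<longlonglongrightarrow> 0"
  proof -
    have "(\<lambda>n. ln (real n) powr (3/2) * B1 n / real n powr (1/2)) \<longlonglongrightarrow> 0"
      unfolding B1_def by (rule smalloD_tendsto[OF rate1])
    moreover have "(\<lambda>n. ln (real n) powr (3/2) / real n powr (1/2)) \<longlonglongrightarrow> 0" by real_asymp
    ultimately have "(\<lambda>n. ln (real n) powr (3/2) * B1 n / real n powr (1/2) + ln (real n) powr (3/2) / real n powr (1/2)) \<longlonglongrightarrow> 0 + 0"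
      by (rule tendsto_add)
    then show ?thesis unfolding powr_minus_half by (simp add: distrib_left add_divide_distrib)
  qed
  have lim2: "(\<lambda>n. ln (real n) powr (1/2) * B2 n * real n powr (-1/2)) \<longlonglongrightarrow> 0"
    unfolding powr_minus_half B2_def by (rule smalloD_tendsto[OF rate2])
  have limV: "(\<lambda>n. V \<epsilon> n) \<longlonglongrightarrow> 0" for \<epsilon>
  proof -
    have "(\<lambda>n. V \<epsilon> n) \<longlonglongrightarrow> 0 + 0"
      unfolding V_def by (rule tendsto_add[OF error_rate_tendsto_0 tendsto_divide_zero[OF lim2]])
    then show ?thesis by simp
  qed
  show ?thesis
  proof (rule LIMSEQ_I)
    fix e :: real assume e: "e > 0"
    define C :: real where "C = 4 * exp 4 * sqrt 2"
    have C: "C > 0" by (simp add: C_def)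
    \<comment> \<open>The cap 1/6 guarantees \<open>4 * h * D \<le> 1\<close>. The second entry
      brings the anti-concentration term below \<open>e / 4\<close>, and with another
      \<open>e / 4\<close> for \<open>V\<close> the pointwise bound \<open>e / 2\<close> leaves room
      for a strict inequality after taking the supremum.\<close>
    define \<epsilon> where "\<epsilon> = min (1/6) (e / (4 * C))"
    have \<epsilon>: "0 < \<epsilon>" "\<epsilon> \<le> 1/6" using e C by (auto simp: \<epsilon>_def)
    have "C * \<epsilon> \<le> C * (e / (4 * C))" using C by (intro mult_left_mono) (auto simp: \<epsilon>_def)
    then have C\<epsilon>: "C * \<epsilon> \<le> e / 4" using C by simp
    have "\<forall>\<^sub>F n in sequentially. ln (real n) powr (3/2) * (B1 n + 1) * real n powr (-1/2) < \<epsilon> / 12"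
      using lim1 \<epsilon> by (intro order_tendstoD) auto
    moreover have "\<forall>\<^sub>F n in sequentially. V \<epsilon> n < e / 4"
      using limV e by (intro order_tendstoD) auto
    ultimately have "\<forall>\<^sub>F n in sequentially. \<bar>SUP \<alpha>\<in>{0<..<1}. \<bar>measure (M n) (?G n \<alpha>) - \<alpha>\<bar>\<bar> < e"
      using ev0 eventually_ge_at_top[of 3]
    proof eventually_elim
      case (elim n)
      have bd: "\<bar>measure (M n) (?G n \<alpha>) - \<alpha>\<bar> \<le> e / 2" if "\<alpha> \<in> {0<..<1}" for \<alpha>
        using key[of n \<epsilon> \<alpha>] elim \<epsilon> C\<epsilon> that by (simp add: C_def)
      then have "(SUP \<alpha>\<in>{0<..<1}. \<bar>measure (M n) (?G n \<alpha>) - \<alpha>\<bar>) \<le> e / 2"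
        by (intro cSUP_least) auto
      \<comment> \<open>Nonnegativity of the supremum is checked at the level 1/2. The uniform bound
        \<open>e / 2\<close> provides the boundedness that gives the supremum its meaning.\<close>
      moreover have "0 \<le> (SUP \<alpha>\<in>{0<..<1}. \<bar>measure (M n) (?G n \<alpha>) - \<alpha>\<bar>)"
        using bd by (intro cSUP_upper2[where x = "1/2"]) (auto intro!: bdd_aboveI2[where M = "e / 2"])
      ultimately show ?case using e by simp
    qed
    then show "\<exists>no. \<forall>n\<ge>no. norm ((SUP \<alpha>\<in>{0<..<1}. \<bar>measure (M n) (?G n \<alpha>) - \<alpha>\<bar>) - 0) < e"
      by (simp add: eventually_sequentially)
  qed
qed

end
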